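(* Let $U\subseteq\mathbb{R}^2$ be open and let $F_0,G_0\in C^2(U)$ be such that $(F_0,G_0)$ is strictly hyperbolic and genuinely nonlinear in $U$, satisfies the graph condition in $U$, and satisfies the regular manifold assumption. Then for almost every $(u_l,v_l,u_r,v_r)\in U^2$ (i.e. outside a subset of $U^2$ of measure zero) the system $$u_t+(F_0(u,v))_x=0,\quad v_t+(G_0(u,v))_x=0,\qquad (u,v)(x,0)=\begin{cases}(u_l,v_l)& x<0,\\ (u_r,v_r)& x>0,\end{cases}$$ satisfies the transversality property. In particular, for any compact subset $K\subset U$ containing $(u_l,v_l)$ and $(u_r,v_r)$ in its interior, with the restriction of $(F_0,G_0)$ onto $K$, the resulting system satisfies the transversality property on $K$.
   Context: Write $(F,G)=(F_0,G_0)$. $J=\begin{pmatrix}F_u & F_v \\ G_u & G_v\end{pmatrix}$ is the Jacobian matrix, with eigenvalues $\lambda_1<\lambda_2$ (when real and distinct) and corresponding right eigenvectors $\mathbf r_1,\mathbf r_2$. Strictly hyperbolic in $U$: $J(u,v)$ has two distinct real eigenvalues for every $(u,v)\in U$. Genuinely nonlinear in $U$: $\nabla\lambda_k(u,v)\cdot\mathbf r_k(u,v)\neq0$ for all $(u,v)\in U$ and $k=1,2$. Graph condition in $U$: either $F_v\ne0$ at every point of $U$, or $G_u\neq0$ at every point of $U$. By interchanging the roles of $u$ and $v$ one takes $F_v\neq0$ on $U$; the definition of rarefaction curves below is written for this case (in the other case interchange the roles of $u$ and $v$). Hugoniot objective function: $H_{(u_g,v_g)}(u,v)=(F(u,v)-F(u_g,v_g))(v-v_g)-(G(u,v)-G(u_g,v_g))(u-u_g)$.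 The (full) Hugoniot locus $\mathcal H_{(u_g,v_g)}$ is its zero set. Regular manifold assumption: for every $(u_g,v_g)\in U$, the function $H_{(u_g,v_g)}$ restricted to $U\setminus\{(u_g,v_g)\}$ has $0$ as a regular value (so the locus minus $(u_g,v_g)$ is a $C^1$ submanifold). Rarefaction curves: $v_k(\cdot;u_g,v_g)$ is the solution of $\frac{dv_k}{du}=\Xi_k(u,v_k)$, $v_k(u_g)=v_g$, where $\Xi_k=-\frac{F_u-\lambda_k}{F_v}$, continued in both directions until the curve reaches the boundary of $U$. The (full) $k$-rarefaction curve $\mathcal R_{k,(u_g,v_g)}$ is the graph of $v_k(\cdot;u_g,v_g)$. Transversality property (for given $(F,G)$, $(u_l,v_l)$, $(u_r,v_r)$): for every choice $\mathcal W_l\in\{\mathcal H_{(u_l,v_l)},\mathcal R_{1,(u_l,v_l)}\}$ and $\mathcal W_r\in\{\mathcal H_{(u_r,v_r)},\mathcal R_{2,(u_r,v_r)}\}$, the intersection $\mathcal W_l\cap\mathcal W_r$, exclusive of $(u_l,v_l)$ and $(u_r,v_r)$, consists of isolated points $(\bar u,\bar v)$, and at each of them $T_{(\bar u,\bar v)}\mathcal W_l+T_{(\bar u,\bar v)}\mathcal W_r=\mathbb{R}^2$ (an empty intersection satisfies this vacuously). Transversality property on $K$ (for compact $K\subset U$ with both states in its interior, and the fluxes restricted to $K$): for every such choice of $\mathcal W_l,\mathcal W_r$ restricted to $K$, where rarefaction curves are obtained by solving the ODE until the curve first hits $\partial K$, the intersection in $K$, exclusive of $(u_l,v_l)$ and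 $(u_r,v_r)$, consists of only finitely many such points, each satisfying the same tangent space condition. *)

theory Defs
  imports "HOL-Analysis.Analysis"
begin

section \<open>Fluxes and their Jacobian\<close>

text \<open>
  States \<open>(u, v)\<close> are elements of \<open>real \<times> real\<close>. Flux functions are total functions, but only
  their values on the open set \<open>U\<close> matter. Partial derivatives are taken with the total operator
  \<^const>\<open>deriv\<close>, which is meaningful here because all fluxes are required to be \<open>C\<^sup>2\<close> on \<open>U\<close>.
\<close>

definition du :: "(real \<times> real \<Rightarrow> real) \<Rightarrow> real \<times> real \<Rightarrow> real" where
  "du f p = deriv (\<lambda>x. f (x, snd p)) (fst p)"

definition dv :: "(real \<times> real \<Rightarrow> real) \<Rightarrow> real \<times> real \<Rightarrow> real" where
  "dv f p = deriv (\<lambda>y. f (fst p, y)) (snd p)"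

definition C1_on :: "(real \<times> real) set \<Rightarrow> (real \<times> real \<Rightarrow> real) \<Rightarrow> bool" where
  "C1_on U f \<longleftrightarrow> f differentiable_on U \<and> continuous_on U (du f) \<and> continuous_on U (dv f)"

definition C2_on :: "(real \<times> real) set \<Rightarrow> (real \<times> real \<Rightarrow> real) \<Rightarrow> bool" where
  "C2_on U f \<longleftrightarrow> C1_on U f \<and> C1_on U (du f) \<and> C1_on U (dv f)"

definition grad :: "(real \<times> real \<Rightarrow> real) \<Rightarrow> real \<times> real \<Rightarrow> real ^ 2" where
  "grad f p = vector [du f p, dv f p]"

definition jac :: "(real \<times> real \<Rightarrow> real) \<Rightarrow> (real \<times> real \<Rightarrow> real) \<Rightarrow> real \<times> real \<Rightarrow> real ^ 2 ^ 2" where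
  "jac F G p = vector [vector [du F p, dv F p], vector [du G p, dv G p]]"

definition right_eigenvector :: "real ^ 'n ^ 'n \<Rightarrow> real \<Rightarrow> real ^ 'n \<Rightarrow> bool" where
  "right_eigenvector A \<mu> r \<longleftrightarrow> r \<noteq> 0 \<and> A *v r = \<mu> *\<^sub>R r"

definition eigenvalues :: "real ^ 'n ^ 'n \<Rightarrow> real set" where
  "eigenvalues A = {\<mu>. \<exists>r. right_eigenvector A \<mu> r}"

definition strictly_hyperbolic where
  "strictly_hyperbolic F G U \<longleftrightarrow> (\<forall>p\<in>U. card (eigenvalues (jac F G p)) = 2)"

text \<open>
  The characteristic speeds \<open>\<lambda>\<^sub>1 < \<lambda>\<^sub>2\<close>; used only for \<open>k \<in> {1, 2}\<close> and at points where the
  Jacobian has two distinct real eigenvalues.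
\<close>

definition lam ::
    "(real \<times> real \<Rightarrow> real) \<Rightarrow> (real \<times> real \<Rightarrow> real) \<Rightarrow> nat \<Rightarrow> real \<times> real \<Rightarrow> real" where
  "lam F G k p = (if k = 1 then Min (eigenvalues (jac F G p)) else Max (eigenvalues (jac F G p)))"

text \<open>The eigenspaces are lines, so it does not matter which eigenvector \<open>r\<close> is taken as \<open>r\<^sub>k\<close>.\<close>

definition genuinely_nonlinear where
  "genuinely_nonlinear F G U \<longleftrightarrow>
     (\<forall>p\<in>U. \<forall>k\<in>{1, 2}. \<forall>r. right_eigenvector (jac F G p) (lam F G k p) r \<longrightarrow>
        grad (lam F G k) p \<bullet> r \<noteq> 0)"

definition graph_condition where
  "graph_condition F G U \<longleftrightarrow> (\<forall>p\<in>U. dv F p \<noteq> 0) \<or> (\<forall>p\<in>U. du G p \<noteq> 0)"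


section \<open>Hugoniot loci\<close>

definition hugoniot_fun ::
    "(real \<times> real \<Rightarrow> real) \<Rightarrow> (real \<times> real \<Rightarrow> real) \<Rightarrow> real \<times> real \<Rightarrow> real \<times> real \<Rightarrow> real" where
  "hugoniot_fun F G g p = (F p - F g) * (snd p - snd g) - (G p - G g) * (fst p - fst g)"

definition hugoniot where
  "hugoniot F G U g = {p\<in>U. hugoniot_fun F G g p = 0}"

text \<open>Here \<open>c\<close> is a regular value of \<open>f\<close> restricted to the open set \<open>D\<close>.\<close>

definition regular_value_on ::
    "'a::real_normed_vector set \<Rightarrow> ('a \<Rightarrow> 'b::real_normed_vector) \<Rightarrow> 'b \<Rightarrow> bool" where
  "regular_value_on D f c \<longleftrightarrow>
     (\<forall>p\<in>D. f p = c \<longrightarrow> (\<exists>f'. (f has_derivative f') (at p) \<and> surj f'))"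

definition regular_manifold where
  "regular_manifold F G U \<longleftrightarrow> (\<forall>g\<in>U. regular_value_on (U - {g}) (hugoniot_fun F G g) 0)"


section \<open>Rarefaction curves\<close>

definition Xi ::
    "(real \<times> real \<Rightarrow> real) \<Rightarrow> (real \<times> real \<Rightarrow> real) \<Rightarrow> nat \<Rightarrow> real \<times> real \<Rightarrow> real" where
  "Xi F G k p = - (du F p - lam F G k p) / dv F p"

definition ode_solution ::
    "(real \<times> real) set \<Rightarrow> (real \<times> real \<Rightarrow> real) \<Rightarrow> real \<times> real \<Rightarrow> real set \<Rightarrow> (real \<Rightarrow> real) \<Rightarrow> bool"
  where
  "ode_solution U X g I w \<longleftrightarrow>
     open I \<and> is_interval I \<and> fst g \<in> I \<and> w (fst g) = snd g \<and>
     (\<forall>x\<in>I. (x, w x) \<in> U \<and> (w has_real_derivative X (x, w x)) (at x))"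

text \<open>
  A maximal solution within \<open>U\<close>, i.e. one continued in both directions until its graph reaches
  the boundary of \<open>U\<close> (or escapes to infinity).
\<close>

definition maximal_ode_solution ::
    "(real \<times> real) set \<Rightarrow> (real \<times> real \<Rightarrow> real) \<Rightarrow> real \<times> real \<Rightarrow> real set \<Rightarrow> (real \<Rightarrow> real) \<Rightarrow> bool"
  where
  "maximal_ode_solution U X g I w \<longleftrightarrow>
     ode_solution U X g I w \<and>
     (\<forall>J z. ode_solution U X g J z \<and> I \<subseteq> J \<and> (\<forall>x\<in>I. z x = w x) \<longrightarrow> J = I)"

text \<open>
  The \<open>k\<close>-rarefaction curve through \<open>g\<close> as a graph over \<open>u\<close> (the case \<open>F\<^sub>v \<noteq> 0\<close>), followed in both
  directions until it first hits the barrier \<open>B\<close>; the point where it hits \<open>B\<close> still belongs to the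
  curve. With \<open>B = {}\<close> this is the graph of the maximal solution.
\<close>

definition rarefaction_graph ::
    "(real \<times> real \<Rightarrow> real) \<Rightarrow> (real \<times> real \<Rightarrow> real) \<Rightarrow> (real \<times> real) set \<Rightarrow> (real \<times> real) set \<Rightarrow>
     nat \<Rightarrow> real \<times> real \<Rightarrow> (real \<times> real) set" where
  "rarefaction_graph F G U B k g =
     {(x, w x) | x w I. maximal_ode_solution U (Xi F G k) g I w \<and> x \<in> I \<and>
        (\<forall>z\<in>open_segment (fst g) x. (z, w z) \<notin> B)}"

text \<open>
  If \<open>F\<^sub>v\<close> vanishes somewhere on \<open>U\<close>, the roles of \<open>u\<close> and \<open>v\<close> are interchanged. For the state
  \<open>(v, u)\<close> the first equation of the system is \<open>v\<^sub>t + G\<^sub>x = 0\<close> and the second is \<open>u\<^sub>t + F\<^sub>x = 0\<close>, so the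
  fluxes trade places as well.
\<close>

definition rarefaction_until ::
    "(real \<times> real \<Rightarrow> real) \<Rightarrow> (real \<times> real \<Rightarrow> real) \<Rightarrow> (real \<times> real) set \<Rightarrow> (real \<times> real) set \<Rightarrow>
     nat \<Rightarrow> real \<times> real \<Rightarrow> (real \<times> real) set" where
  "rarefaction_until F G U B k g =
     (if \<forall>p\<in>U. dv F p \<noteq> 0 then rarefaction_graph F G U B k g
      else prod.swap ` rarefaction_graph (G \<circ> prod.swap) (F \<circ> prod.swap)
             (prod.swap ` U) (prod.swap ` B) k (prod.swap g))"

definition rarefaction where
  "rarefaction F G U k g = rarefaction_until F G U {} k g"


section \<open>Transversality\<close>

text \<open>
  The tangent space of a \<open>C\<^sup>1\<close> submanifold \<open>W\<close> at \<open>p\<close>, as the set of velocities at \<open>p\<close> of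
  \<open>C\<^sup>1\<close> curves in \<open>W\<close>. Below it is only used at points near which \<open>W\<close> is a submanifold.
\<close>

definition tangent_space :: "'a::real_normed_vector \<Rightarrow> 'a set \<Rightarrow> 'a set" where
  "tangent_space p W =
     {\<gamma>'. \<exists>\<gamma> e. 0 < e \<and> \<gamma> C1_differentiable_on {-e<..<e} \<and> \<gamma> ` {-e<..<e} \<subseteq> W \<and>
        \<gamma> 0 = p \<and> (\<gamma> has_vector_derivative \<gamma>') (at (0::real))}"

definition transversal_at :: "'a::real_normed_vector \<Rightarrow> 'a set \<Rightarrow> 'a set \<Rightarrow> bool" where
  "transversal_at p V W \<longleftrightarrow> {a + b | a b. a \<in> tangent_space p V \<and> b \<in> tangent_space p W} = UNIV"

definition transversality where
  "transversality F G U l r \<longleftrightarrow>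
     (\<forall>Wl\<in>{hugoniot F G U l, rarefaction F G U 1 l}.
      \<forall>Wr\<in>{hugoniot F G U r, rarefaction F G U 2 r}.
      \<forall>p\<in>Wl \<inter> Wr - {l, r}. p isolated_in (Wl \<inter> Wr - {l, r}) \<and> transversal_at p Wl Wr)"

text \<open>
  The curves restricted to \<open>K\<close> are paired with the full curves in \<open>U\<close>: at a point of the frontier
  of \<open>K\<close>, where a restricted curve may end, the tangent space is that of the full curve.
\<close>

definition transversality_on where
  "transversality_on F G U K l r \<longleftrightarrow>
     (\<forall>(Wl, WlK)\<in>{(hugoniot F G U l, hugoniot F G U l \<inter> K),
                   (rarefaction F G U 1 l, rarefaction_until F G U (frontier K) 1 l)}.
      \<forall>(Wr, WrK)\<in>{(hugoniot F G U r, hugoniot F G U r \<inter> K),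
                   (rarefaction F G U 2 r, rarefaction_until F G U (frontier K) 2 r)}.
        finite (WlK \<inter> WrK - {l, r}) \<and> (\<forall>p\<in>WlK \<inter> WrK - {l, r}. transversal_at p Wl Wr))"

end

theory Submission
  imports Defs "HOL-Complex_Analysis.Great_Picard"
begin

text \<open>
  Write \<open>H l p\<close> for the Hugoniot function of the base state \<open>l\<close>, evaluated at \<open>p\<close>. It is symmetric
  in \<open>l\<close> and \<open>p\<close>. So the regular manifold assumption, read with base state \<open>p\<close>, says that for fixed
  \<open>p\<close> the equation \<open>H l p = 0\<close> is also regular as an equation for \<open>l \<noteq> p\<close>: moving the base state moves
  its locus through \<open>p\<close> with nonzero speed, and base states can serve as the parameters of a
  transversality theorem.

  Fix a \<open>C\<^sup>1\<close> curve \<open>C\<close>. A base state \<open>l\<close> whose locus touches \<open>C\<close> at some \<open>p \<noteq> l\<close> lies on the envelope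
  of the curves \<open>{l. H l p = 0}\<close> with \<open>p \<in> C\<close>. In suitable local coordinates the envelope consists of
  critical values of a map from the plane to the plane, so it is a null set by Sard's theorem
  (\<open>negligible_envelope\<close>, \<open>negligible_tangent_base_states\<close>). With \<open>C\<close> the locus or the rarefaction curve
  of the other state, this shows that for every fixed state almost every partner is good. Two
  rarefaction curves of different families have the different slopes \<open>\<Xi>\<^sub>1\<close> and \<open>\<Xi>\<^sub>2\<close> wherever they meet.

  By Fubini's theorem a set of pairs is null if its slices are null, provided that the set is
  measurable. Here the relevant sets are countable unions of compact sets: tangency is a closed
  condition, and the relation ``\<open>p\<close> is joined to \<open>g\<close> by an integral curve inside the compact set \<open>K\<close>'' is
  compact by the theorem of Arzela and Ascoli (\<open>compact_reach\<close>).

  The same relation gives the finiteness on \<open>K\<close>. The intersections to be counted lie in a compact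
  set. At a limit point of that set both curves would pass through it, and the chords from the
  limit point to nearby intersection points would be almost orthogonal to two independent normals
  at the same time (\<open>not_islimpt_Int_if_normals_independent\<close>). The loci are singular at their base
  states, but for almost every pair neither state lies on a locus or curve through the other one
  that could cause an accumulation there.

  All this is carried out for curves that are graphs over \<open>u\<close>, i.e. for \<open>F\<^sub>v \<noteq> 0\<close>. The case
  \<open>G\<^sub>u \<noteq> 0\<close> follows by interchanging the two coordinates together with the two fluxes.
\<close>

section \<open>An envelope theorem in the plane\<close>

definition perp :: "real \<times> real \<Rightarrow> real \<times> real" where
  "perp p = (- snd p, fst p)"

lemma inner_perp_perp [simp]: "perp p \<bullet> perp q = p \<bullet> q"
  by (simp add: perp_def inner_prod_def)

lemma norm_perp [simp]: "norm (perp p) = norm p"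
  by (simp add: norm_eq_sqrt_inner)

lemma perp_perp: "perp (perp p) = - p"
  by (simp add: perp_def prod_eq_iff)

lemma norm_pair_le: "norm (x :: 'a::real_normed_vector \<times> 'b::real_normed_vector) \<le> norm (fst x) + norm (snd x)"
  by (metis norm_Pair_le prod.collapse)

lemma orthonormal_decomposition:
  fixes n z :: "real \<times> real"
  assumes "norm n = 1"
  shows "z = (perp n \<bullet> z) *\<^sub>R perp n + (n \<bullet> z) *\<^sub>R n"
proof -
  obtain a b c d where ab: "n = (a, b)" and cd: "z = (c, d)" by fastforce
  have 1: "a * a + b * b = 1"
    using assms by (simp add: ab norm_eq_sqrt_inner)
  have "(a * d - b * c) * (- b) + (a * c + b * d) * a = c * (a * a + b * b)"
       "(a * d - b * c) * a + (a * c + b * d) * b = d * (a * a + b * b)"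
    by algebra+
  then show ?thesis
    by (simp add: ab cd perp_def 1 algebra_simps)
qed

lemma norm_le_perp_inner:
  fixes n z :: "real \<times> real"
  assumes "norm n = 1"
  shows "norm z \<le> \<bar>perp n \<bullet> z\<bar> + \<bar>n \<bullet> z\<bar>"
proof -
  have "norm z = norm ((perp n \<bullet> z) *\<^sub>R perp n + (n \<bullet> z) *\<^sub>R n)"
    using orthonormal_decomposition[OF assms, of z] by simp
  also have "\<dots> \<le> \<bar>perp n \<bullet> z\<bar> + \<bar>n \<bullet> z\<bar>"
    by (rule order_trans[OF norm_triangle_ineq]) (simp add: assms)
  finally show ?thesis .
qed

text \<open>
  An isometry onto the type in which Sard's theorem is formulated.
\<close>

definition vec2 :: "real \<times> real \<Rightarrow> real ^ 2" where
  "vec2 z = vector [fst z, snd z]"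

lemma vec2_linear: "vec2 (x + y) = vec2 x + vec2 y" "vec2 (c *\<^sub>R x) = c *\<^sub>R vec2 x"
    "vec2 (x - y) = vec2 x - vec2 y"
  by (simp_all add: vec2_def vec_eq_iff forall_2)

lemma norm_vec2 [simp]: "norm (vec2 z) = norm z"
  by (cases z) (simp add: vec2_def norm_vec_def L2_set_def UNIV_2 norm_Pair)

lemma negligible_vec2_image:
  assumes "negligible (vec2 ` S)"
  shows "negligible S"
proof -
  let ?h = "\<lambda>v::real^2. (v $ 1, v $ 2)"
  have "S = ?h ` (vec2 ` S)"
    by (force simp: vec2_def image_image)
  moreover have "negligible (?h ` (vec2 ` S))"
  proof (rule negligible_differentiable_image_negligible[OF _ assms])
    have "?h differentiable (at x within vec2 ` S)" for x
      unfolding differentiable_def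
      by (rule exI[of _ ?h]) (auto intro!: derivative_eq_intros bounded_linear.has_derivative[OF bounded_linear_vec_nth])
    then show "?h differentiable_on vec2 ` S"
      by (simp add: differentiable_on_def)
  qed auto
  ultimately show ?thesis by simp
qed

text \<open>
  Think of \<open>A\<close> as the set of pairs \<open>(r, p)\<close> where \<open>p\<close> runs through a curve with normal \<open>\<nu>\<close> and \<open>r\<close> is a
  point in which the \<open>p\<close>-th member of a family of curves, with normal \<open>n\<close>, touches the envelope of
  the family. To first order \<open>r\<close> then moves orthogonally to \<open>n\<close>, whatever \<open>p\<close> does. The hypothesis
  expresses this through two-point difference quotients, so that nothing has to be parametrized:
  near a point \<open>a\<close> of \<open>A\<close> the coordinate of \<open>r\<close> along \<open>perp (n a)\<close> and the coordinate of \<open>p\<close> along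
  \<open>perp (\<nu> a)\<close> determine the pair. The map from these two coordinates to \<open>r\<close> is differentiable within
  its domain and its derivative ignores the second coordinate, so Sard's theorem applies.
\<close>

lemma negligible_envelope_unit:
  fixes A :: "((real \<times> real) \<times> (real \<times> real)) set" and n \<nu> :: "_ \<Rightarrow> real \<times> real"
  assumes cont: "continuous_on A n"
    and n1: "\<And>a. a \<in> A \<Longrightarrow> norm (n a) = 1"
    and nu1: "\<And>a. a \<in> A \<Longrightarrow> norm (\<nu> a) = 1"
    and flat: "\<And>a \<epsilon>. \<lbrakk>a \<in> A; 0 < \<epsilon>\<rbrakk> \<Longrightarrow> \<exists>\<delta>>0. \<forall>x\<in>A \<inter> ball a \<delta>. \<forall>y\<in>A \<inter> ball a \<delta>.
        \<bar>n a \<bullet> (fst x - fst y)\<bar> \<le> \<epsilon> * norm (x - y) \<and>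
        \<bar>\<nu> a \<bullet> (snd x - snd y)\<bar> \<le> \<epsilon> * norm (x - y)"
  shows "negligible (fst ` A)"
proof -
  have local: "\<exists>e>0. negligible (fst ` (A \<inter> ball a e))" if a: "a \<in> A" for a
  proof -
    \<comment> \<open>Any constant below 1/2 makes the two coordinates bi-Lipschitz on the ball.\<close>
    obtain e1 where e1: "e1 > 0" and e1': "\<And>x y. \<lbrakk>x \<in> A \<inter> ball a e1; y \<in> A \<inter> ball a e1\<rbrakk> \<Longrightarrow>
        \<bar>n a \<bullet> (fst x - fst y)\<bar> \<le> 1/8 * norm (x - y) \<and>
        \<bar>\<nu> a \<bullet> (snd x - snd y)\<bar> \<le> 1/8 * norm (x - y)"
      using flat[OF a, of "1/8"] by force
    obtain e2 where e2: "e2 > 0" and e2': "\<And>x. \<lbrakk>x \<in> A; dist x a < e2\<rbrakk> \<Longrightarrow> dist (n x) (n a) < 1/2"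
    proof -
      have "0 < (1/2::real)" by simp
      then show ?thesis using cont a that unfolding continuous_on_iff by blast
    qed
    define e where "e = min e1 e2"
    have "e > 0" using e1 e2 by (simp add: e_def)
    define B where "B = A \<inter> ball a e"
    have BA: "x \<in> A" "x \<in> A \<inter> ball a e1" if "x \<in> B" for x
      using that by (auto simp: B_def e_def)
    \<comment> \<open>The first coordinate is measured along \<open>perp (n a)\<close>, the motion of \<open>r\<close> near another point \<open>x\<close> goes along \<open>perp (n x)\<close>; \<open>\<kappa> x\<close> is the cosine of the angle between the two directions.\<close>
    define \<kappa> where "\<kappa> x = n a \<bullet> n x" for x
    have kap: "\<kappa> x \<ge> 1/2" if "x \<in> B" for x
    proof -
      have "dist x a < e2" using that by (auto simp: B_def e_def dist_commute)
      then have "norm (n x - n a) < 1/2" using e2' BA that by (auto simp: dist_norm)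
      then have "\<bar>n a \<bullet> (n x - n a)\<bar> \<le> 1/2"
        using Cauchy_Schwarz_ineq2[of "n a" "n x - n a"] n1[OF a] by simp
      moreover have "n a \<bullet> n a = 1" using n1[OF a] by (simp add: norm_eq_1)
      ultimately show ?thesis unfolding \<kappa>_def inner_diff_right by argo
    qed
    define \<Lambda> :: "_ \<Rightarrow> real ^ 2" where
      "\<Lambda> x = vec2 (perp (n a) \<bullet> fst x, perp (\<nu> a) \<bullet> snd x)" for x
    have Lbd: "norm (x - y) \<le> 4 * norm (\<Lambda> x - \<Lambda> y)" if "x \<in> B" "y \<in> B" for x y
    proof -
      let ?s = "perp (n a) \<bullet> (fst x - fst y)" and ?t = "perp (\<nu> a) \<bullet> (snd x - snd y)"
      have "\<Lambda> x - \<Lambda> y = vec2 (?s, ?t)"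
        by (simp add: \<Lambda>_def inner_diff_right flip: vec2_linear)
      then have N: "norm (\<Lambda> x - \<Lambda> y) = norm (?s, ?t)" by simp
      have st: "\<bar>?s\<bar> \<le> norm (?s, ?t)" "\<bar>?t\<bar> \<le> norm (?s, ?t)"
        using norm_fst_le[of ?s ?t] norm_snd_le[of ?t ?s] by auto
      have "norm (fst x - fst y) \<le> \<bar>?s\<bar> + 1/8 * norm (x - y)"
        using norm_le_perp_inner[OF n1[OF a], of "fst x - fst y"] e1'[OF BA(2)[OF that(1)] BA(2)[OF that(2)]] by linarith
      moreover have "norm (snd x - snd y) \<le> \<bar>?t\<bar> + 1/8 * norm (x - y)"
        using norm_le_perp_inner[OF nu1[OF a], of "snd x - snd y"] e1'[OF BA(2)[OF that(1)] BA(2)[OF that(2)]] by linarith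
      moreover have "norm (x - y) \<le> norm (fst x - fst y) + norm (snd x - snd y)"
        using norm_pair_le[of "x - y"] by simp
      ultimately show ?thesis unfolding N using st by argo
    qed
    have inj: "inj_on \<Lambda> B"
    proof (rule inj_onI)
      fix x y assume "x \<in> B" "y \<in> B" "\<Lambda> x = \<Lambda> y"
      then show "x = y" using Lbd[of x y] by simp
    qed
    define f where "f y = vec2 (fst (inv_into B \<Lambda> y))" for y
    have fL: "f (\<Lambda> x) = vec2 (fst x)" if "x \<in> B" for x
      using that by (simp add: f_def inv_into_f_f[OF inj])
    \<comment> \<open>Divide by \<open>\<kappa>\<close> to recover the length of the motion along \<open>perp (n x)\<close> from the first coordinate.\<close>
    define f' where "f' y = (\<lambda>d::real^2. (d $ 1 / \<kappa> (inv_into B \<Lambda> y)) *\<^sub>R vec2 (perp (n (inv_into B \<Lambda> y))))" for y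
    have f'L: "f' (\<Lambda> x) = (\<lambda>d. (d $ 1 / \<kappa> x) *\<^sub>R vec2 (perp (n x)))" if "x \<in> B" for x
      using that by (simp add: f'_def inv_into_f_f[OF inj])
    have bl: "bounded_linear (f' y)" for y
      unfolding f'_def divide_inverse
      by (intro bounded_linear_scaleR_const bounded_linear_mult_const bounded_linear_vec_nth)
    have der: "(f has_derivative f' y) (at y within \<Lambda> ` B)" if y: "y \<in> \<Lambda> ` B" for y
    proof -
      obtain x where x: "x \<in> B" and yx: "y = \<Lambda> x" using y by auto
      have "\<exists>d>0. \<forall>z\<in>\<Lambda> ` B. norm (z - y) < d \<longrightarrow> norm (f z - f y - f' y (z - y)) \<le> \<epsilon> * norm (z - y)"
        if "\<epsilon> > 0" for \<epsilon>
      proof -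
        \<comment> \<open>The factor 12 is 4 (Lipschitz constant of the inverse chart) times 3 (bound of the vector that multiplies the error).\<close>
        obtain \<delta> where "\<delta> > 0" and \<delta>: "\<And>w. w \<in> A \<inter> ball x \<delta> \<Longrightarrow> \<bar>n x \<bullet> (fst w - fst x)\<bar> \<le> \<epsilon>/12 * norm (w - x)"
        proof -
          have "\<epsilon>/12 > 0" using \<open>\<epsilon> > 0\<close> by simp
          from flat[OF BA(1)[OF x] this] obtain \<delta> where "\<delta> > 0" and
            "\<And>w y. \<lbrakk>w \<in> A \<inter> ball x \<delta>; y \<in> A \<inter> ball x \<delta>\<rbrakk> \<Longrightarrow> \<bar>n x \<bullet> (fst w - fst y)\<bar> \<le> \<epsilon>/12 * norm (w - y)"
            by blast
          moreover have "x \<in> A \<inter> ball x \<delta>" using \<open>\<delta> > 0\<close> BA(1)[OF x] by simp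
          ultimately show ?thesis using that by blast
        qed
        have "norm (f z - f y - f' y (z - y)) \<le> \<epsilon> * norm (z - y)"
          if z: "z \<in> \<Lambda> ` B" and zd: "norm (z - y) < \<delta>/4" for z
        proof -
          obtain w where w: "w \<in> B" and zw: "z = \<Lambda> w" using z by auto
          have wx: "norm (w - x) \<le> 4 * norm (z - y)"
            using Lbd[OF w x] by (simp add: zw yx)
          then have "w \<in> A \<inter> ball x \<delta>"
            using zd BA[OF w] by (auto simp: dist_norm norm_minus_commute)
          then have small: "\<bar>n x \<bullet> (fst w - fst x)\<bar> \<le> \<epsilon>/12 * (4 * norm (z - y))"
            using \<delta>[of w] wx mult_left_mono[OF wx, of "\<epsilon>/12"] \<open>\<epsilon> > 0\<close> by linarith
          let ?r = "fst w - fst x"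
          let ?c = "perp (n a) \<bullet> n x"
          have kx: "\<kappa> x \<ge> 1/2" "\<kappa> x \<noteq> 0" using kap[OF x] by auto
          have dec: "?r = (perp (n x) \<bullet> ?r) *\<^sub>R perp (n x) + (n x \<bullet> ?r) *\<^sub>R n x"
            by (rule orthonormal_decomposition) (use n1 BA x in auto)
          have "(z - y) $ 1 = perp (n a) \<bullet> ?r"
            by (simp add: zw yx \<Lambda>_def vec2_def inner_diff_right)
          also have "\<dots> = perp (n a) \<bullet> ((perp (n x) \<bullet> ?r) *\<^sub>R perp (n x) + (n x \<bullet> ?r) *\<^sub>R n x)"
            using dec by (rule arg_cong)
          also have "\<dots> = \<kappa> x * (perp (n x) \<bullet> ?r) + ?c * (n x \<bullet> ?r)"
            by (simp add: inner_add_right \<kappa>_def mult.commute)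
          finally have "perp (n x) \<bullet> ?r - (z - y) $ 1 / \<kappa> x = - (?c / \<kappa> x) * (n x \<bullet> ?r)"
            using kx by (simp add: field_simps)
          moreover have "?r - ((z - y) $ 1 / \<kappa> x) *\<^sub>R perp (n x)
             = (perp (n x) \<bullet> ?r - (z - y) $ 1 / \<kappa> x) *\<^sub>R perp (n x) + (n x \<bullet> ?r) *\<^sub>R n x"
            using arg_cong[OF dec, of "\<lambda>u. u - ((z - y) $ 1 / \<kappa> x) *\<^sub>R perp (n x)"]
            by (simp add: scaleR_diff_left)
          ultimately have "?r - ((z - y) $ 1 / \<kappa> x) *\<^sub>R perp (n x)
              = (n x \<bullet> ?r) *\<^sub>R (n x - (?c / \<kappa> x) *\<^sub>R perp (n x))"
            by (simp add: scaleR_diff_right mult.commute)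
          moreover have "norm (n x - (?c / \<kappa> x) *\<^sub>R perp (n x)) \<le> 3"
          proof -
            have "\<bar>?c\<bar> \<le> 1"
              using Cauchy_Schwarz_ineq2[of "perp (n a)" "n x"] n1 BA(1)[OF x] a by simp
            then have "\<bar>?c / \<kappa> x\<bar> \<le> 2"
              using kx by (simp add: field_simps)
            then show ?thesis
              using norm_triangle_ineq4[of "n x" "(?c / \<kappa> x) *\<^sub>R perp (n x)"] n1[OF BA(1)[OF x]] by simp
          qed
          ultimately have "norm (?r - ((z - y) $ 1 / \<kappa> x) *\<^sub>R perp (n x)) \<le> \<bar>n x \<bullet> ?r\<bar> * 3"
            by (simp add: mult_left_mono)
          also have "\<dots> \<le> \<epsilon> * norm (z - y)"
            using small by (simp add: mult.assoc)
          finally have *: "norm (?r - ((z - y) $ 1 / \<kappa> x) *\<^sub>R perp (n x)) \<le> \<epsilon> * norm (z - y)" .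
          have "f z - f y - f' y (z - y) = vec2 (?r - ((z - y) $ 1 / \<kappa> x) *\<^sub>R perp (n x))"
            unfolding zw yx by (simp add: fL f'L w x vec2_linear)
          then show ?thesis using * by simp
        qed
        then show ?thesis using \<open>\<delta> > 0\<close> by (intro exI[of _ "\<delta>/4"]) auto
      qed
      then show ?thesis
        unfolding has_derivative_within_alt using bl by blast
    qed
    have "rank (matrix (f' y)) < CARD(2)" for y
    proof -
      have "linear (f' y)" using bl by (rule bounded_linear.linear)
      then have eq: "(*v) (matrix (f' y)) = f' y" by (simp add: fun_eq_iff matrix_works)
      have "f' y (axis 2 1) = f' y 0"
        by (simp add: f'_def axis_def)
      moreover have "axis 2 1 \<noteq> (0 :: real ^ 2)"
        by (simp add: axis_eq_0_iff)
      ultimately have "\<not> inj (f' y)"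
        unfolding inj_def by blast
      then show ?thesis
        using less_rank_noninjective[of "matrix (f' y)"] unfolding eq by blast
    qed
    then have "negligible (f ` (\<Lambda> ` B))"
      by (intro baby_Sard[OF _ der]) auto
    moreover have "f ` (\<Lambda> ` B) = vec2 ` (fst ` B)"
      unfolding image_image by (rule image_cong) (simp_all add: fL)
    ultimately have "negligible (fst ` B)"
      using negligible_vec2_image by metis
    then show ?thesis using \<open>e > 0\<close> unfolding B_def by blast
  qed
  then obtain e where e: "\<And>a. a \<in> A \<Longrightarrow> e a > 0 \<and> negligible (fst ` (A \<inter> ball a (e a)))"
    by metis
  obtain \<F>' where F': "\<F>' \<subseteq> (\<lambda>a. ball a (e a)) ` A" "countable \<F>'" "\<Union>\<F>' = (\<Union>a\<in>A. ball a (e a))"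
    using Lindelof[of "(\<lambda>a. ball a (e a)) ` A"] by auto
  have "A \<subseteq> \<Union>\<F>'"
    unfolding F'(3) using e by force
  then have "fst ` A = \<Union> ((\<lambda>V. fst ` (A \<inter> V)) ` \<F>')"
    by blast
  moreover have "negligible (\<Union> ((\<lambda>V. fst ` (A \<inter> V)) ` \<F>'))"
    using F'(1,2) e by (intro negligible_countable_Union) auto
  ultimately show ?thesis by simp
qed

lemma negligible_envelope:
  fixes A :: "((real \<times> real) \<times> (real \<times> real)) set" and n \<nu> :: "_ \<Rightarrow> real \<times> real"
  assumes cont: "continuous_on A n"
    and n0: "\<And>a. a \<in> A \<Longrightarrow> n a \<noteq> 0"
    and nu0: "\<And>a. a \<in> A \<Longrightarrow> \<nu> a \<noteq> 0"
    and flat: "\<And>a \<epsilon>. \<lbrakk>a \<in> A; 0 < \<epsilon>\<rbrakk> \<Longrightarrow> \<exists>\<delta>>0. \<forall>x\<in>A \<inter> ball a \<delta>. \<forall>y\<in>A \<inter> ball a \<delta>.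
        \<bar>n a \<bullet> (fst x - fst y)\<bar> \<le> \<epsilon> * norm (x - y) \<and>
        \<bar>\<nu> a \<bullet> (snd x - snd y)\<bar> \<le> \<epsilon> * norm (x - y)"
  shows "negligible (fst ` A)"
proof (rule negligible_envelope_unit[where n = "\<lambda>a. n a /\<^sub>R norm (n a)" and \<nu> = "\<lambda>a. \<nu> a /\<^sub>R norm (\<nu> a)"])
  show "continuous_on A (\<lambda>a. n a /\<^sub>R norm (n a))"
    using cont n0 by (intro continuous_intros) auto
  fix a and \<epsilon> :: real assume a: "a \<in> A" and "0 < \<epsilon>"
  define m where "m = min (norm (n a)) (norm (\<nu> a))"
  have m: "m > 0" "m \<le> norm (n a)" "m \<le> norm (\<nu> a)" using n0 nu0 a by (auto simp: m_def)
  have resc: "\<bar>(k /\<^sub>R norm k) \<bullet> z\<bar> \<le> \<epsilon> * t"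
    if "\<bar>k \<bullet> z\<bar> \<le> \<epsilon> * m * t" "m \<le> norm k" "0 \<le> t" for k z :: "real \<times> real" and t
  proof -
    have "\<epsilon> * m * t \<le> \<epsilon> * norm k * t"
      using that \<open>0 < \<epsilon>\<close> by (intro mult_right_mono mult_left_mono) auto
    then have "\<bar>k \<bullet> z\<bar> \<le> norm k * (\<epsilon> * t)" using that(1) by (simp add: mult.commute mult.left_commute)
    moreover have "norm k > 0" using that m by linarith
    ultimately show ?thesis by (simp add: abs_mult pos_divide_le_eq divide_inverse_commute[symmetric] mult.commute)
  qed
  show "\<exists>\<delta>>0. \<forall>x\<in>A \<inter> ball a \<delta>. \<forall>y\<in>A \<inter> ball a \<delta>.
        \<bar>(n a /\<^sub>R norm (n a)) \<bullet> (fst x - fst y)\<bar> \<le> \<epsilon> * norm (x - y) \<and>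
        \<bar>(\<nu> a /\<^sub>R norm (\<nu> a)) \<bullet> (snd x - snd y)\<bar> \<le> \<epsilon> * norm (x - y)"
  proof -
    obtain \<delta> where "\<delta> > 0" and \<delta>: "\<forall>x\<in>A \<inter> ball a \<delta>. \<forall>y\<in>A \<inter> ball a \<delta>.
        \<bar>n a \<bullet> (fst x - fst y)\<bar> \<le> \<epsilon> * m * norm (x - y) \<and>
        \<bar>\<nu> a \<bullet> (snd x - snd y)\<bar> \<le> \<epsilon> * m * norm (x - y)"
      using flat[OF a, of "\<epsilon> * m"] \<open>0 < \<epsilon>\<close> m by auto
    show ?thesis
      by (intro exI[of _ \<delta>] conjI \<open>\<delta> > 0\<close> ballI resc m norm_ge_zero) (use \<delta> in blast)+
  qed
qed (use n0 nu0 in auto)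

section \<open>Null sets with null slices\<close>

definition sigma_compact :: "'a::topological_space set \<Rightarrow> bool" where
  "sigma_compact S \<longleftrightarrow> (\<exists>K :: nat \<Rightarrow> 'a set. (\<forall>n. compact (K n)) \<and> S = (\<Union>n. K n))"

lemma compact_imp_sigma_compact: "compact S \<Longrightarrow> sigma_compact S"
  unfolding sigma_compact_def by (rule exI[of _ "\<lambda>_. S"]) auto

lemma compact_exhaustion:
  fixes S :: "'a::euclidean_space set"
  assumes "open S"
  shows "\<exists>C :: nat \<Rightarrow> 'a set. (\<forall>n. compact (C n) \<and> C n \<subseteq> S) \<and> (\<forall>K. compact K \<and> K \<subseteq> S \<longrightarrow> (\<exists>n. K \<subseteq> C n))"
proof (rule open_Union_compact_subsets[OF assms])
  fix C :: "nat \<Rightarrow> 'a set" assume C: "\<And>n. compact (C n)" "\<And>n. C n \<subseteq> S"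
    and exh: "\<And>K. \<lbrakk>compact K; K \<subseteq> S\<rbrakk> \<Longrightarrow> \<exists>N. \<forall>n\<ge>N. K \<subseteq> C n"
  have "\<exists>n. K \<subseteq> C n" if "compact K" "K \<subseteq> S" for K
    using exh[OF that] by auto
  then show ?thesis using C by (intro exI[of _ C]) auto
qed

text \<open>
  The equations below only make sense on open sets that avoid the base states, so that the solution
  sets are not closed; this is how they are seen to be measurable, together with their projections.
\<close>

lemma sigma_compact_zero_set:
  fixes \<phi> :: "'a::euclidean_space \<Rightarrow> 'b::{t1_space, zero}"
  assumes "open O'" and "continuous_on O' \<phi>"
  shows "sigma_compact {z \<in> O'. \<phi> z = 0}"
proof -
  obtain C :: "nat \<Rightarrow> 'a set" where "(\<forall>n. compact (C n) \<and> C n \<subseteq> O') \<and> (\<forall>K. compact K \<and> K \<subseteq> O' \<longrightarrow> (\<exists>n. K \<subseteq> C n))"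
    using compact_exhaustion[OF \<open>open O'\<close>] ..
  then have C: "\<And>n. compact (C n)" "\<And>n. C n \<subseteq> O'" and exh: "\<And>K. \<lbrakk>compact K; K \<subseteq> O'\<rbrakk> \<Longrightarrow> \<exists>n. K \<subseteq> C n"
    by auto
  have un: "O' = (\<Union>n. C n)"
  proof
    show "O' \<subseteq> (\<Union>n. C n)"
    proof
      fix x assume "x \<in> O'"
      then obtain n where "{x} \<subseteq> C n" using exh[of "{x}"] by auto
      then show "x \<in> (\<Union>n. C n)" by blast
    qed
  qed (use C(2) in blast)
  have "compact {z \<in> C n. \<phi> z = 0}" for n
  proof -
    have "closedin (top_of_set (C n)) {z \<in> C n. \<phi> z = 0}"
      using continuous_on_subset[OF assms(2) C(2)]
      by (rule continuous_closedin_preimage_constant)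
    then show ?thesis
      using C(1) closedin_compact by blast
  qed
  moreover have "{z \<in> O'. \<phi> z = 0} = (\<Union>n. {z \<in> C n. \<phi> z = 0})"
    using un by auto
  ultimately show ?thesis
    unfolding sigma_compact_def by (intro exI[of _ "\<lambda>n. {z \<in> C n. \<phi> z = 0}"]) auto
qed

lemma sigma_compact_image:
  assumes "sigma_compact S" and "continuous_on S f"
  shows "sigma_compact (f ` S)"
proof -
  obtain K :: "nat \<Rightarrow> _" where K: "\<And>n. compact (K n)" "S = (\<Union>n. K n)"
    using assms(1) unfolding sigma_compact_def by blast
  have "compact (f ` K n)" for n
    using assms(2) K by (intro compact_continuous_image continuous_on_subset[OF assms(2)]) auto
  moreover have "f ` S = (\<Union>n. f ` K n)" using K(2) by auto
  ultimately show ?thesis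
    unfolding sigma_compact_def by (intro exI[of _ "\<lambda>n. f ` K n"]) auto
qed

text \<open>
  Pairs \<open>(l, r)\<close> are bad because of a point \<open>p\<close> at which the locus of \<open>l\<close> is tangent to a field of
  directions and which is joined to \<open>r\<close>; both relations are composed here.
\<close>

lemma sigma_compact_compose:
  fixes S :: "('a::metric_space \<times> 'b::metric_space) set" and T :: "('c::metric_space \<times> 'b) set"
  assumes "sigma_compact S" and "compact T"
  shows "sigma_compact {(a, c). \<exists>b. (a, b) \<in> S \<and> (c, b) \<in> T}"
proof -
  obtain K :: "nat \<Rightarrow> _" where K: "\<And>n. compact (K n)" "S = (\<Union>n. K n)"
    using assms(1) unfolding sigma_compact_def by blast
  have "compact ((\<lambda>((a, b), (c, b')). (a, c)) ` ((K n \<times> T) \<inter> {z. snd (fst z) = snd (snd z)}))" for n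
    using K(1)[of n] \<open>compact T\<close>
    by (intro compact_continuous_image compact_Int_closed compact_Times closed_Collect_eq)
       (auto intro!: continuous_intros simp: case_prod_unfold)
  moreover have "{(a, c). \<exists>b. (a, b) \<in> S \<and> (c, b) \<in> T}
      = (\<Union>n. (\<lambda>((a, b), (c, b')). (a, c)) ` ((K n \<times> T) \<inter> {z. snd (fst z) = snd (snd z)}))"
    unfolding K(2) by force
  ultimately show ?thesis
    unfolding sigma_compact_def
    by (intro exI[of _ "\<lambda>n. (\<lambda>((a, b), (c, b')). (a, c)) ` ((K n \<times> T) \<inter> {z. snd (fst z) = snd (snd z)})"] conjI allI)
qed

lemma negligible_if_slices_negligible:
  fixes S :: "('a::euclidean_space \<times> 'b::euclidean_space) set"
  assumes "sigma_compact S" and slices: "\<And>x. negligible {y. (x, y) \<in> S}"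
  shows "negligible S"
proof -
  have S: "S \<in> sets borel"
  proof -
    obtain K :: "nat \<Rightarrow> _" where K: "\<And>n. compact (K n)" "S = (\<Union>n. K n)"
      using assms(1) unfolding sigma_compact_def by blast
    show ?thesis
      unfolding K(2) using K(1) by (intro sets.countable_UN) (auto intro: borel_closed compact_imp_closed)
  qed
  then have S': "S \<in> sets (lborel \<Otimes>\<^sub>M lborel)"
    by (metis lborel_prod sets_lborel)
  have "emeasure lborel (Pair x -` S) = 0" for x
  proof -
    have "Pair x -` S \<in> sets borel"
      using sets_Pair1[OF S'] by simp
    moreover have "Pair x -` S \<in> null_sets lebesgue"
      using slices[of x] by (simp add: negligible_iff_null_sets vimage_def)
    ultimately show ?thesis
      by (metis null_setsD1 null_sets_completion_iff sets_lborel)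
  qed
  then have "emeasure (lborel \<Otimes>\<^sub>M lborel) S = 0"
    by (simp add: lborel.emeasure_pair_measure_alt[OF S'])
  then have "S \<in> null_sets lborel"
    using S by (simp add: lborel_prod null_setsI)
  then show ?thesis
    by (simp add: negligible_iff_null_sets null_sets_completionI)
qed

lemma negligible_prod_swap:
  fixes S :: "('a::euclidean_space \<times> 'b::euclidean_space) set"
  assumes "negligible S"
  shows "negligible (prod.swap ` S)"
proof (rule negligible_differentiable_image_negligible[OF _ assms])
  have "prod.swap differentiable (at x within S)" for x
    unfolding prod.swap_def by (auto intro!: bounded_linear_imp_differentiable bounded_linear_Pair bounded_linear_fst bounded_linear_snd)
  then show "prod.swap differentiable_on S"
    by (simp add: differentiable_on_def)
qed simp

lemma negligible_if_swapped_slices_negligible: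
  fixes S :: "('a::euclidean_space \<times> 'b::euclidean_space) set"
  assumes "sigma_compact S" and "\<And>y. negligible {x. (x, y) \<in> S}"
  shows "negligible S"
proof -
  have "negligible (prod.swap ` S)"
  proof (rule negligible_if_slices_negligible)
    show "sigma_compact (prod.swap ` S)"
      by (rule sigma_compact_image[OF assms(1)]) (auto intro!: continuous_intros simp: prod.swap_def)
    have "{x. (y, x) \<in> prod.swap ` S} = {x. (x, y) \<in> S}" for y by force
    then show "negligible {x. (y, x) \<in> prod.swap ` S}" for y by (simp add: assms(2))
  qed
  then show ?thesis
    using negligible_prod_swap[of "prod.swap ` S"] by (simp add: image_image)
qed

section \<open>Normals and tangents of planar sets\<close>

text \<open>
  For a \<open>C\<^sup>1\<close> curve with normal \<open>\<nu>\<close> at \<open>p\<close>, chords between points near \<open>p\<close> are almost orthogonal to \<open>\<nu>\<close>.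
  Stated for arbitrary sets this covers level sets and graphs alike, also at the end point of an arc.
\<close>

definition flat_at :: "(real \<times> real) set \<Rightarrow> real \<times> real \<Rightarrow> real \<times> real \<Rightarrow> bool" where
  "flat_at C p \<nu> \<longleftrightarrow> (\<forall>\<epsilon>>0. \<exists>\<delta>>0. \<forall>x\<in>C \<inter> ball p \<delta>. \<forall>y\<in>C \<inter> ball p \<delta>.
      \<bar>\<nu> \<bullet> (x - y)\<bar> \<le> \<epsilon> * norm (x - y))"

text \<open>
  The weaker condition on chords that start in \<open>p\<close>: it passes to unions, which \<^const>\<open>flat_at\<close> does not.
\<close>

definition normal_at :: "(real \<times> real) set \<Rightarrow> real \<times> real \<Rightarrow> real \<times> real \<Rightarrow> bool" where
  "normal_at C p \<nu> \<longleftrightarrow> (\<forall>\<epsilon>>0. \<exists>\<delta>>0. \<forall>x\<in>C \<inter> ball p \<delta>. \<bar>\<nu> \<bullet> (x - p)\<bar> \<le> \<epsilon> * norm (x - p))"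

lemma flat_at_imp_normal_at: "\<lbrakk>flat_at C p \<nu>; p \<in> C\<rbrakk> \<Longrightarrow> normal_at C p \<nu>"
  unfolding flat_at_def normal_at_def by (meson IntI centre_in_ball)

lemma flat_at_subset: "\<lbrakk>flat_at C p \<nu>; B \<subseteq> C\<rbrakk> \<Longrightarrow> flat_at B p \<nu>"
  unfolding flat_at_def by (meson Int_mono order_refl subsetD)

lemma normal_at_subset: "\<lbrakk>normal_at C p \<nu>; B \<subseteq> C\<rbrakk> \<Longrightarrow> normal_at B p \<nu>"
  unfolding normal_at_def by (meson Int_mono order_refl subsetD)

text \<open>
  Cramer's rule for the linear system with the rows \<open>\<nu>\<close> and \<open>\<mu>\<close>, whose determinant is \<open>- (\<nu> \<bullet> perp \<mu>)\<close>.
\<close>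

lemma cramer_plane:
  "(\<nu> \<bullet> perp \<mu>) *\<^sub>R z = (\<nu> \<bullet> z) *\<^sub>R perp \<mu> - (\<mu> \<bullet> z) *\<^sub>R perp \<nu>"
  by (cases \<nu>; cases \<mu>; cases z) (simp add: perp_def algebra_simps)

text \<open>
  A chord from \<open>p\<close> to a nearby common point would be almost orthogonal to two independent vectors, hence
  shorter than itself. This is the isolation of transversal intersections without a
  parametrization of the curves.
\<close>

lemma not_islimpt_Int_if_normals_independent:
  assumes V: "normal_at V p \<nu>" and W: "normal_at W p \<mu>" and ind: "\<nu> \<bullet> perp \<mu> \<noteq> 0"
  shows "\<not> p islimpt (V \<inter> W)"
proof
  assume lim: "p islimpt (V \<inter> W)"
  define c where "c = \<bar>\<nu> \<bullet> perp \<mu>\<bar>"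
  define \<epsilon> where "\<epsilon> = c / (2 * (norm \<mu> + norm \<nu> + 1))"
  have "c > 0" using ind by (simp add: c_def)
  have pos: "norm \<mu> + norm \<nu> + 1 > 0" by (smt (verit) norm_ge_zero)
  then have "\<epsilon> > 0" using \<open>c > 0\<close> by (simp add: \<epsilon>_def)
  obtain d1 where d1: "d1 > 0" "\<And>x. x \<in> V \<inter> ball p d1 \<Longrightarrow> \<bar>\<nu> \<bullet> (x - p)\<bar> \<le> \<epsilon> * norm (x - p)"
    using V \<open>\<epsilon> > 0\<close> unfolding normal_at_def by blast
  obtain d2 where d2: "d2 > 0" "\<And>x. x \<in> W \<inter> ball p d2 \<Longrightarrow> \<bar>\<mu> \<bullet> (x - p)\<bar> \<le> \<epsilon> * norm (x - p)"
    using W \<open>\<epsilon> > 0\<close> unfolding normal_at_def by blast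
  obtain x where x: "x \<in> V \<inter> W" "x \<noteq> p" "dist x p < min d1 d2"
    using lim d1(1) d2(1) unfolding islimpt_approachable by (metis min_less_iff_conj)
  let ?z = "x - p"
  have z: "norm ?z > 0" using x(2) by simp
  have "\<bar>\<nu> \<bullet> ?z\<bar> \<le> \<epsilon> * norm ?z" "\<bar>\<mu> \<bullet> ?z\<bar> \<le> \<epsilon> * norm ?z"
    using d1(2)[of x] d2(2)[of x] x by (auto simp: dist_commute)
  moreover have "c * norm ?z \<le> \<bar>\<nu> \<bullet> ?z\<bar> * norm \<mu> + \<bar>\<mu> \<bullet> ?z\<bar> * norm \<nu>"
  proof -
    have "c * norm ?z = norm ((\<nu> \<bullet> perp \<mu>) *\<^sub>R ?z)" by (simp add: c_def)
    also have "\<dots> \<le> \<bar>\<nu> \<bullet> ?z\<bar> * norm \<mu> + \<bar>\<mu> \<bullet> ?z\<bar> * norm \<nu>"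
      unfolding cramer_plane by (rule order_trans[OF norm_triangle_ineq4]) simp
    finally show ?thesis .
  qed
  ultimately have "c * norm ?z \<le> (\<epsilon> * norm ?z) * norm \<mu> + (\<epsilon> * norm ?z) * norm \<nu>"
    by (smt (verit) mult_right_mono norm_ge_zero)
  also have "\<dots> = (\<epsilon> * (norm \<mu> + norm \<nu>)) * norm ?z" by (simp add: algebra_simps)
  finally have "c \<le> \<epsilon> * (norm \<mu> + norm \<nu>)" using z by simp
  also have "\<dots> \<le> \<epsilon> * (norm \<mu> + norm \<nu> + 1)" using \<open>\<epsilon> > 0\<close> by simp
  also have "\<dots> = c / 2"
  proof -
    have "c / (2 * s) * s = c / 2" if "s > 0" for s :: real using that by simp
    from this[OF pos] show ?thesis unfolding \<epsilon>_def .
  qed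
  finally show False using \<open>c > 0\<close> by simp
qed

lemma finite_if_compact_no_islimpt:
  assumes "compact S" and "\<And>q. q \<in> S \<Longrightarrow> \<not> q islimpt S"
  shows "finite S"
  using Heine_Borel_imp_Bolzano_Weierstrass[OF assms(1), of S] assms(2) by blast

lemma tangent_space_scaleR:
  assumes "v \<in> tangent_space p W"
  shows "c *\<^sub>R v \<in> tangent_space p W"
proof -
  obtain \<gamma> e where e: "0 < e" "\<gamma> C1_differentiable_on {-e<..<e}" "\<gamma> ` {-e<..<e} \<subseteq> W" "\<gamma> 0 = p"
      "(\<gamma> has_vector_derivative v) (at (0::real))"
    using assms unfolding tangent_space_def by blast
  obtain D where D: "\<And>x. x \<in> {-e<..<e} \<Longrightarrow> (\<gamma> has_vector_derivative D x) (at x)" "continuous_on {-e<..<e} D"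
    using e(2) unfolding C1_differentiable_on_def by blast
  define e' where "e' = e / (\<bar>c\<bar> + 1)"
  have "e' > 0" using e(1) by (simp add: e'_def add_nonneg_pos)
  have in_dom: "c * t \<in> {-e<..<e}" if "t \<in> {-e'<..<e'}" for t
  proof -
    have "\<bar>c * t\<bar> \<le> (\<bar>c\<bar> + 1) * \<bar>t\<bar>" by (simp add: abs_mult mult_right_mono)
    also have "\<dots> < (\<bar>c\<bar> + 1) * e'" using that by (intro mult_strict_left_mono) auto
    also have "\<dots> = e" by (simp add: e'_def)
    finally show ?thesis by auto
  qed
  have chain: "((\<lambda>t. \<gamma> (c * t)) has_vector_derivative c *\<^sub>R D (c * t)) (at t)" if "c * t \<in> {-e<..<e}" for t
  proof -
    have "((\<lambda>t. c * t) has_vector_derivative c) (at t)"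
      by (auto intro!: derivative_eq_intros simp: has_vector_derivative_def)
    from vector_diff_chain_at[OF this D(1)[OF that]] show ?thesis by (simp add: o_def)
  qed
  show ?thesis
    unfolding tangent_space_def
  proof (intro CollectI exI conjI)
    show "0 < e'" by fact
    show "(\<lambda>t. \<gamma> (c * t)) C1_differentiable_on {-e'<..<e'}"
      unfolding C1_differentiable_on_def
    proof (intro exI conjI ballI)
      show "continuous_on {-e'<..<e'} (\<lambda>t. c *\<^sub>R D (c * t))"
        by (intro continuous_intros continuous_on_compose2[OF D(2)]) (use in_dom in auto)
    qed (use chain in_dom in auto)
    show "(\<lambda>t. \<gamma> (c * t)) ` {-e'<..<e'} \<subseteq> W" using e(3) in_dom by blast
    have "D 0 = v"
      using D(1)[of 0] e(1,5) by (auto dest: vector_derivative_unique_at)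
    then show "((\<lambda>t. \<gamma> (c * t)) has_vector_derivative c *\<^sub>R v) (at 0)"
      using chain[of 0] e(1) by simp
  qed (use e in auto)
qed

lemma transversal_atI:
  assumes v: "v \<in> tangent_space p V" and w: "w \<in> tangent_space p W" and ind: "v \<bullet> perp w \<noteq> 0"
  shows "transversal_at p V W"
proof -
  have "z \<in> {a + b |a b. a \<in> tangent_space p V \<and> b \<in> tangent_space p W}" for z
  proof -
    let ?c = "v \<bullet> perp w"
    have "?c *\<^sub>R z = (perp w \<bullet> z) *\<^sub>R v - (perp v \<bullet> z) *\<^sub>R w"
      by (cases v; cases w; cases z) (simp add: perp_def algebra_simps)
    then have "z = (1 / ?c) *\<^sub>R ((perp w \<bullet> z) *\<^sub>R v - (perp v \<bullet> z) *\<^sub>R w)"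
      using ind by (simp flip: \<open>?c *\<^sub>R z = _\<close>)
    then have "z = ((perp w \<bullet> z) / ?c) *\<^sub>R v + (- (perp v \<bullet> z) / ?c) *\<^sub>R w"
      by (simp add: scaleR_diff_right)
    then show ?thesis
      using tangent_space_scaleR[OF v] tangent_space_scaleR[OF w] by blast
  qed
  then show ?thesis unfolding transversal_at_def by blast
qed

text \<open>
  Continuity of the gradient makes the derivative strict; by the mean value theorem for \<open>f\<close> minus its
  linearization at \<open>a\<close>.
\<close>

lemma gradient_strict:
  fixes f :: "'a::real_inner \<Rightarrow> real"
  assumes "open O'" and der: "\<And>z. z \<in> O' \<Longrightarrow> (f has_derivative (\<lambda>h. g z \<bullet> h)) (at z)"
    and cont: "continuous_on O' g" and a: "a \<in> O'" and "0 < \<epsilon>"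
  shows "\<exists>\<delta>>0. ball a \<delta> \<subseteq> O' \<and> (\<forall>x\<in>ball a \<delta>. \<forall>y\<in>ball a \<delta>. \<bar>f x - f y - g a \<bullet> (x - y)\<bar> \<le> \<epsilon> * norm (x - y))"
proof -
  obtain d1 where d1: "d1 > 0" "ball a d1 \<subseteq> O'" using \<open>open O'\<close> a openE by blast
  obtain d2 where d2: "d2 > 0" "\<And>x. \<lbrakk>x \<in> O'; dist x a < d2\<rbrakk> \<Longrightarrow> dist (g x) (g a) < \<epsilon>"
    using cont a \<open>0 < \<epsilon>\<close> unfolding continuous_on_iff by blast
  define \<delta> where "\<delta> = min d1 d2"
  have sub: "ball a \<delta> \<subseteq> O'" using d1 by (auto simp: \<delta>_def)
  have "\<bar>f x - f y - g a \<bullet> (x - y)\<bar> \<le> \<epsilon> * norm (x - y)" if "x \<in> ball a \<delta>" "y \<in> ball a \<delta>" for x y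
  proof -
    have "norm ((f x - g a \<bullet> x) - (f y - g a \<bullet> y)) \<le> \<epsilon> * norm (x - y)"
    proof (rule differentiable_bound[where S = "ball a \<delta>" and f' = "\<lambda>z h. (g z - g a) \<bullet> h"])
      fix z assume z: "z \<in> ball a \<delta>"
      show "((\<lambda>z. f z - g a \<bullet> z) has_derivative (\<lambda>h. (g z - g a) \<bullet> h)) (at z within ball a \<delta>)"
        unfolding inner_diff_left using sub z
        by (intro has_derivative_at_withinI[OF has_derivative_diff[OF der bounded_linear_imp_has_derivative[OF bounded_linear_inner_right]]]) auto
      show "onorm (\<lambda>h. (g z - g a) \<bullet> h) \<le> \<epsilon>"
      proof (rule onorm_bound)
        show "0 \<le> \<epsilon>" using \<open>0 < \<epsilon>\<close> by simp
        have "norm (g z - g a) \<le> \<epsilon>"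
          using d2(2)[of z] sub z by (force simp: dist_norm \<delta>_def norm_minus_commute)
        then show "norm ((g z - g a) \<bullet> h) \<le> \<epsilon> * norm h" for h
          using Cauchy_Schwarz_ineq2[of "g z - g a" h] by (simp add: order_trans mult_right_mono)
      qed
    qed (use that in auto)
    then show ?thesis by (simp add: inner_diff_right algebra_simps)
  qed
  then show ?thesis using sub d1(1) d2(1) by (intro exI[of _ \<delta>]) (auto simp: \<delta>_def)
qed

text \<open>
  A \<open>C\<^sup>1\<close> curve in the level set with the right velocity comes from the inverse function theorem
  for the map \<open>z \<mapsto> (perp N \<bullet> z, f z)\<close>, where \<open>N\<close> is the gradient at \<open>p\<close>: pull back the horizontal line
  through the image of \<open>p\<close>.
\<close>

lemma perp_gradient_in_tangent_space:
  assumes "open O'" and der: "\<And>z. z \<in> O' \<Longrightarrow> (f has_derivative (\<lambda>h. g z \<bullet> h)) (at z)"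
    and cont: "continuous_on O' g" and p: "p \<in> O'" and gp: "g p \<noteq> 0" and fp: "f p = (0::real)"
    and W: "\<And>z. \<lbrakk>z \<in> O'; f z = 0\<rbrakk> \<Longrightarrow> z \<in> W"
  shows "perp (g p) \<in> tangent_space p W"
proof -
  define N where "N = g p"
  define m where "m = N \<bullet> N"
  have "m > 0" using gp by (simp add: m_def N_def)
  define \<Phi> where "\<Phi> z = (perp N \<bullet> z, f z)" for z
  have bl: "bounded_linear (\<lambda>h. (perp N \<bullet> h, g z \<bullet> h))" for z
    by (intro bounded_linear_Pair bounded_linear_inner_right)
  define \<Phi>' where "\<Phi>' z = Blinfun (\<lambda>h. (perp N \<bullet> h, g z \<bullet> h))" for z
  have \<Phi>'_apply: "blinfun_apply (\<Phi>' z) = (\<lambda>h. (perp N \<bullet> h, g z \<bullet> h))" for z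
    unfolding \<Phi>'_def using bl by (rule bounded_linear_Blinfun_apply)
  have bli: "bounded_linear (\<lambda>y::real\<times>real. (fst y / m) *\<^sub>R perp N + (snd y / m) *\<^sub>R N)"
    unfolding divide_inverse
    by (intro bounded_linear_add bounded_linear_scaleR_const bounded_linear_mult_const bounded_linear_fst bounded_linear_snd)
  define inv' where "inv' = Blinfun (\<lambda>y. (fst y / m) *\<^sub>R perp N + (snd y / m) *\<^sub>R N)"
  have inv'_apply: "blinfun_apply inv' = (\<lambda>y. (fst y / m) *\<^sub>R perp N + (snd y / m) *\<^sub>R N)"
    unfolding inv'_def using bli by (rule bounded_linear_Blinfun_apply)
  have inv: "inv' o\<^sub>L \<Phi>' p = id_blinfun"
  proof (rule blinfun_eqI)
    fix h
    have "m *\<^sub>R h = (perp N \<bullet> h) *\<^sub>R perp N + (N \<bullet> h) *\<^sub>R N"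
      unfolding m_def by (cases N; cases h) (simp add: perp_def algebra_simps)
    then have "h = (1 / m) *\<^sub>R ((perp N \<bullet> h) *\<^sub>R perp N + (N \<bullet> h) *\<^sub>R N)"
      using \<open>m > 0\<close> by (simp flip: \<open>m *\<^sub>R h = _\<close>)
    then show "blinfun_apply (inv' o\<^sub>L \<Phi>' p) h = blinfun_apply id_blinfun h"
      by (simp add: inv'_apply \<Phi>'_apply scaleR_add_right flip: N_def)
  qed
  have d\<Phi>: "(\<Phi> has_derivative blinfun_apply (\<Phi>' z)) (at z)" if "z \<in> O'" for z
    unfolding \<Phi>_def \<Phi>'_apply
    by (rule has_derivative_Pair[OF bounded_linear_imp_has_derivative[OF bounded_linear_inner_right] der[OF that]])
  have c\<Phi>: "continuous_on O' \<Phi>'"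
    by (rule continuous_on_blinfun_componentwise)
       (auto simp: \<Phi>'_apply intro!: continuous_intros cont)
  obtain U' V G G' where G: "open U'" "U' \<subseteq> O'" "p \<in> U'" "open V" "\<Phi> p \<in> V" "homeomorphism U' V \<Phi> G"
    "\<And>y. y \<in> V \<Longrightarrow> (G has_derivative (G' y)) (at y)"
    "\<And>y. y \<in> V \<Longrightarrow> G' y = inv (blinfun_apply (\<Phi>' (G y)))"
    "\<And>y. y \<in> V \<Longrightarrow> bij (blinfun_apply (\<Phi>' (G y)))"
    using inverse_function_theorem[OF \<open>open O'\<close> d\<Phi> c\<Phi> p inv] by blast
  have GV: "G y \<in> U'" "\<Phi> (G y) = y" if "y \<in> V" for y
    using G(6) that by (auto simp: homeomorphism_def)
  define c where "c = perp N \<bullet> p"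
  have \<Phi>p: "\<Phi> p = (c, 0)" by (simp add: \<Phi>_def c_def fp)
  define \<gamma> where "\<gamma> t = G (c + t, 0)" for t
  obtain e1 where e1: "e1 > 0" "ball (c, 0) e1 \<subseteq> V" using G(4,5) \<Phi>p openE by metis
  have inV: "(c + t, 0) \<in> V" if "t \<in> {-e1<..<e1}" for t
    using that e1(2) by (auto simp: dist_norm norm_Pair subset_iff)
  have \<gamma>U: "\<gamma> t \<in> O'" "f (\<gamma> t) = 0" if "t \<in> {-e1<..<e1}" for t
    using GV[OF inV[OF that]] G(2) by (auto simp: \<gamma>_def \<Phi>_def)
  have \<gamma>0: "\<gamma> 0 = p" using G(3,6) \<Phi>p by (auto simp: \<gamma>_def homeomorphism_def)
  have d\<gamma>: "(\<gamma> has_vector_derivative G' (c + t, 0) (1, 0)) (at t)" if "t \<in> {-e1<..<e1}" for t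
  proof -
    have "((\<lambda>t. (c + t, 0)) has_vector_derivative (1, 0)) (at t)"
      by (auto simp: has_vector_derivative_def intro!: derivative_eq_intros)
    moreover have "(G has_derivative G' (c + t, 0)) (at (c + t, 0))"
      using G(7) inV[OF that] by blast
    ultimately have A: "(G \<circ> (\<lambda>t. (c + t, 0)) has_derivative G' (c + t, 0) \<circ> (\<lambda>h. h *\<^sub>R (1, 0))) (at t)"
      unfolding has_vector_derivative_def by (intro diff_chain_at)
    have eq: "G' (c + t, 0) \<circ> (\<lambda>h. h *\<^sub>R (1, 0)) = (\<lambda>h. h *\<^sub>R G' (c + t, 0) (1, 0))"
      using linear_cmul[OF has_derivative_linear[OF \<open>(G has_derivative _) _\<close>]] by (simp only: o_def)
    have "G \<circ> (\<lambda>t. (c + t, 0)) = \<gamma>" by (simp add: fun_eq_iff \<gamma>_def)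
    then show ?thesis
      using A unfolding has_vector_derivative_def eq by simp
  qed
  have c\<gamma>: "continuous_on {-e1<..<e1} \<gamma>"
    using d\<gamma> by (meson continuous_at_imp_continuous_on has_vector_derivative_continuous)
  have cg: "continuous_on {-e1<..<e1} (\<lambda>t. g (\<gamma> t))"
    by (rule continuous_on_compose2[OF cont c\<gamma>]) (use \<gamma>U in auto)
  \<comment> \<open>Differentiating both coordinates of the map along the curve gives a linear system for the velocity, and Cramer's rule gives a formula that is visibly continuous.\<close>
  have ivel: "(N \<bullet> g (\<gamma> t)) *\<^sub>R G' (c + t, 0) (1, 0) = perp (g (\<gamma> t))" if "t \<in> {-e1<..<e1}" for t
  proof -
    let ?v = "G' (c + t, 0) (1, 0)"
    have "blinfun_apply (\<Phi>' (\<gamma> t)) ?v = (1, 0)"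
      using G(8,9)[OF inV[OF that]] by (simp add: \<gamma>_def bij_is_surj surj_f_inv_f)
    then have "perp N \<bullet> ?v = 1" "g (\<gamma> t) \<bullet> ?v = 0" by (auto simp: \<Phi>'_apply)
    then show ?thesis using cramer_plane[of "perp N" "g (\<gamma> t)" ?v] by simp
  qed
  have "\<exists>e2>0. \<forall>t. t \<in> {-e1<..<e1} \<and> dist t 0 < e2 \<longrightarrow> dist (N \<bullet> g (\<gamma> t)) (N \<bullet> g (\<gamma> 0)) < m"
  proof -
    have "continuous_on {-e1<..<e1} (\<lambda>t. N \<bullet> g (\<gamma> t))" by (intro continuous_intros cg)
    then show ?thesis using e1(1) \<open>m > 0\<close> unfolding continuous_on_iff by (metis greaterThanLessThan_iff neg_less_0_iff_less)
  qed
  then obtain e2 where e2: "e2 > 0" "\<And>t. \<lbrakk>t \<in> {-e1<..<e1}; \<bar>t\<bar> < e2\<rbrakk> \<Longrightarrow> \<bar>N \<bullet> g (\<gamma> t) - m\<bar> < m"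
    by (auto simp: dist_real_def \<gamma>0 m_def simp flip: N_def)
  define e where "e = min e1 e2"
  have "e > 0" using e1 e2 by (simp add: e_def)
  have sub: "t \<in> {-e1<..<e1}" if "t \<in> {-e<..<e}" for t using that by (auto simp: e_def)
  have nz: "N \<bullet> g (\<gamma> t) \<noteq> 0" if "t \<in> {-e<..<e}" for t
  proof -
    have "\<bar>t\<bar> < e2" using that by (auto simp: e_def abs_less_iff)
    then show ?thesis using e2(2)[OF sub[OF that]] \<open>m > 0\<close> by auto
  qed
  have vel: "G' (c + t, 0) (1, 0) = (1 / (N \<bullet> g (\<gamma> t))) *\<^sub>R perp (g (\<gamma> t))" if "t \<in> {-e<..<e}" for t
    using ivel[OF sub[OF that]] nz[OF that] by (simp flip: ivel[OF sub[OF that]])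
  have "(1 / m) *\<^sub>R perp N \<in> tangent_space p W"
    unfolding tangent_space_def
  proof (intro CollectI exI conjI)
    show "\<gamma> C1_differentiable_on {-e<..<e}"
      unfolding C1_differentiable_on_def
    proof (intro exI conjI ballI)
      show "(\<gamma> has_vector_derivative (1 / (N \<bullet> g (\<gamma> t))) *\<^sub>R perp (g (\<gamma> t))) (at t)" if "t \<in> {-e<..<e}" for t
        using d\<gamma>[OF sub[OF that]] vel[OF that] by simp
      have "continuous_on {-e<..<e} (\<lambda>t. g (\<gamma> t))"
        using cg by (rule continuous_on_subset) (use sub in auto)
      then show "continuous_on {-e<..<e} (\<lambda>t. (1 / (N \<bullet> g (\<gamma> t))) *\<^sub>R perp (g (\<gamma> t)))"
        unfolding perp_def by (intro continuous_intros) (use nz in auto)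
    qed
    show "\<gamma> ` {-e<..<e} \<subseteq> W" using \<gamma>U sub W by blast
    have "(\<gamma> has_vector_derivative (1 / (N \<bullet> g (\<gamma> 0))) *\<^sub>R perp (g (\<gamma> 0))) (at 0)"
      using d\<gamma>[of 0] vel[of 0] \<open>e > 0\<close> e1(1) by simp
    then show "(\<gamma> has_vector_derivative (1 / m) *\<^sub>R perp N) (at 0)"
      by (simp add: \<gamma>0 m_def flip: N_def)
  qed (use \<open>e > 0\<close> \<gamma>0 in auto)
  from tangent_space_scaleR[OF this, of m] show ?thesis
    using \<open>m > 0\<close> by (simp add: N_def)
qed

section \<open>Points joined by an integral curve in a compact set\<close>

text \<open>
  Pairs \<open>(r, p)\<close> such that a solution of \<open>dv/du = X(u, v)\<close> through \<open>r\<close> reaches \<open>p\<close> without leaving \<open>K\<close>.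
  The solution is reparametrized over the unit interval, so that solutions between different end
  points, in both directions of \<open>u\<close>, form a single space of functions. One-sided derivatives at the
  ends make the relation closed.
\<close>

definition reach :: "(real \<times> real) set \<Rightarrow> (real \<times> real \<Rightarrow> real) \<Rightarrow> ((real \<times> real) \<times> (real \<times> real)) set" where
  "reach K X = {(r, p). \<exists>c. c 0 = snd r \<and> c 1 = snd p \<and>
     (\<forall>t\<in>{0..1}. (fst r + t * (fst p - fst r), c t) \<in> K \<and>
        (c has_real_derivative (fst p - fst r) * X (fst r + t * (fst p - fst r), c t)) (at t within {0..1}))}"

lemma abs_fst_diff_le: "\<bar>fst x - fst y\<bar> \<le> norm (x - y)" for x y :: "real \<times> real"
  by (cases x; cases y) (simp add: norm_Pair)

lemma reach_mono: "K \<subseteq> L \<Longrightarrow> reach K X \<subseteq> reach L X"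
  unfolding reach_def by blast

lemma reach_endpoints:
  assumes "(r, p) \<in> reach K X" shows "r \<in> K" "p \<in> K"
proof -
  obtain c where c: "c 0 = snd r" "c 1 = snd p" "\<And>t. t \<in> {0..1} \<Longrightarrow> (fst r + t * (fst p - fst r), c t) \<in> K"
    using assms unfolding reach_def by blast
  show "r \<in> K" using c(3)[of 0] c(1) by simp
  show "p \<in> K" using c(3)[of 1] c(2) by simp
qed

lemma uniform_limit_const_in_domain:
  "(a \<longlongrightarrow> b) F \<Longrightarrow> uniform_limit S (\<lambda>n t. a n) (\<lambda>t. b) F"
  by (auto simp: uniform_limit_iff tendsto_iff elim: eventually_mono)

lemma uniform_limit_Pair_intro:
  assumes "uniform_limit S f f' F" "uniform_limit S g g' F"
  shows "uniform_limit S (\<lambda>n t. (f n t, g n t)) (\<lambda>t. (f' t, g' t)) F"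
  unfolding uniform_limit_iff
proof (intro allI impI)
  fix e :: real assume "e > 0"
  then have "\<forall>\<^sub>F n in F. \<forall>t\<in>S. dist (f n t) (f' t) < e/2" "\<forall>\<^sub>F n in F. \<forall>t\<in>S. dist (g n t) (g' t) < e/2"
    using uniform_limitD[OF assms(1), of "e/2"] uniform_limitD[OF assms(2), of "e/2"] by auto
  then show "\<forall>\<^sub>F n in F. \<forall>t\<in>S. dist (f n t, g n t) (f' t, g' t) < e"
  proof eventually_elim
    case (elim n)
    have "dist (f n t, g n t) (f' t, g' t) \<le> dist (f n t) (f' t) + dist (g n t) (g' t)" for t
      unfolding dist_Pair_Pair by (rule sqrt_sum_squares_le_sum) auto
    then show ?case using elim by (smt (verit) field_sum_of_halves)
  qed
qed

text \<open>
  Solutions inside a compact set have bounded slope, so the theorem of Arzela and Ascoli provides a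
  uniformly convergent subsequence of curves. The derivatives converge uniformly along with it,
  since \<open>X\<close> is uniformly continuous on \<open>K\<close>, and the limit is again a solution.
\<close>

lemma compact_reach:
  assumes K: "compact K" and X: "continuous_on K X"
  shows "compact (reach K X)"
  unfolding compact_eq_seq_compact_metric seq_compact_def
proof (intro allI impI)
  fix f :: "nat \<Rightarrow> (real \<times> real) \<times> (real \<times> real)"
  assume f: "\<forall>n. f n \<in> reach K X"
  define s where "s z = fst (snd z) - fst (fst z)" for z :: "(real \<times> real) \<times> (real \<times> real)"
  define x where "x z t = fst (fst z) + t * s z" for z t
  have "\<exists>c. c 0 = snd (fst (f n)) \<and> c 1 = snd (snd (f n)) \<and> (\<forall>t\<in>{0..1}. (x (f n) t, c t) \<in> K \<and>
      (c has_real_derivative s (f n) * X (x (f n) t, c t)) (at t within {0..1}))" for n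
    using f[rule_format, of n] by (simp add: reach_def case_prod_unfold s_def x_def)
  then obtain c where c: "\<And>n. c n 0 = snd (fst (f n))" "\<And>n. c n 1 = snd (snd (f n))"
    "\<And>n t. t \<in> {0..1} \<Longrightarrow> (x (f n) t, c n t) \<in> K"
    "\<And>n t. t \<in> {0..1} \<Longrightarrow> (c n has_real_derivative s (f n) * X (x (f n) t, c n t)) (at t within {0..1})"
    by metis
  have fK: "f n \<in> K \<times> K" for n
    using f[rule_format, of n] reach_endpoints by (cases "f n") auto
  obtain l k1 where l: "l \<in> K \<times> K" and k1: "strict_mono (k1 :: nat \<Rightarrow> nat)" and lim1: "(f \<circ> k1) \<longlonglongrightarrow> l"
    using compact_Times[OF K K] fK unfolding compact_eq_seq_compact_metric seq_compact_def by metis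
  obtain M where M: "\<And>q. q \<in> K \<Longrightarrow> norm q \<le> M"
    using compact_imp_bounded[OF K] bounded_iff by blast
  have "compact (X ` K)" using compact_continuous_image[OF X K] .
  then obtain B where B: "\<And>q. q \<in> K \<Longrightarrow> \<bar>X q\<bar> \<le> B"
    using compact_imp_bounded bounded_iff by (metis image_eqI real_norm_def)
  have B0: "B \<ge> 0" using B[of "fst l"] l by (auto simp: mem_Times_iff)
  have M0: "M \<ge> 0" using order_trans[OF norm_ge_zero M[of "fst l"]] l by (auto simp: mem_Times_iff)
  have absM: "\<bar>fst q\<bar> \<le> M" "\<bar>snd q\<bar> \<le> M" if "q \<in> K" for q
    using M[OF that] norm_fst_le[of "fst q" "snd q"] norm_snd_le[of "snd q" "fst q"] by auto
  have s2M: "\<bar>s (f n)\<bar> \<le> 2 * M" for n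
    using absM(1)[of "fst (f n)"] absM(1)[of "snd (f n)"] fK[of n] by (auto simp: s_def mem_Times_iff)
  have lip: "\<bar>c n t - c n u\<bar> \<le> 2 * M * B * \<bar>t - u\<bar>" if "t \<in> {0..1}" "u \<in> {0..1}" for n t u
  proof -
    have "norm (c n t - c n u) \<le> 2 * M * B * norm (t - u)"
    proof (rule field_differentiable_bound[OF convex_real_interval(5)])
      show "(c n has_real_derivative s (f n) * X (x (f n) v, c n v)) (at v within {0..1})" if "v \<in> {0..1}" for v
        using c(4)[OF that] .
      show "norm (s (f n) * X (x (f n) v, c n v)) \<le> 2 * M * B" if "v \<in> {0..1}" for v
        using s2M[of n] B[OF c(3)[OF that, of n]] M0 by (simp add: abs_mult mult_mono)
    qed (use that in auto)
    then show ?thesis by simp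
  qed
  obtain g k2 where g: "continuous_on {0..1::real} g" and k2: "strict_mono (k2 :: nat \<Rightarrow> nat)"
    and unif: "\<And>e. 0 < e \<Longrightarrow> \<exists>N. \<forall>n t. n \<ge> N \<and> t \<in> {0..1} \<longrightarrow> norm (c (k1 (k2 n)) t - g t) < e"
  proof (rule Arzela_Ascoli[of "{0..1::real}" "\<lambda>n. c (k1 n)" M])
    show "norm (c (k1 n) t) \<le> M" if "t \<in> {0..1}" for n t
      using absM(2)[OF c(3)[OF that, of "k1 n"]] by simp
    show "\<exists>d>0. \<forall>n u. u \<in> {0..1} \<and> norm (t - u) < d \<longrightarrow> norm (c (k1 n) t - c (k1 n) u) < e"
      if "t \<in> {0..1}" "0 < e" for t e :: real
    proof -
      define L where "L = 2 * M * B + 1"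
      have L: "L > 0" "2 * M * B \<le> L" using M0 B0 by (auto simp: L_def add_nonneg_pos)
      have "norm (c (k1 n) t - c (k1 n) u) < e" if u: "u \<in> {0..1}" "norm (t - u) < e / L" for n u
      proof -
        have "\<bar>c (k1 n) t - c (k1 n) u\<bar> \<le> L * \<bar>t - u\<bar>"
          using lip[OF \<open>t \<in> {0..1}\<close> u(1), of "k1 n"] L(2) by (meson abs_ge_zero mult_right_mono order_trans)
        also have "\<dots> < e" using u(2) L by (simp add: pos_less_divide_eq mult.commute)
        finally show ?thesis by simp
      qed
      then show ?thesis using L(1) \<open>0 < e\<close> by (intro exI[of _ "e / L"]) auto
    qed
  qed (use that in auto)
  define k where "k = k1 \<circ> k2"
  have lim: "(\<lambda>n. f (k n)) \<longlonglongrightarrow> l"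
    using LIMSEQ_subseq_LIMSEQ[OF lim1 k2] by (simp add: o_def k_def)
  have ul_c: "uniform_limit {0..1} (\<lambda>n. c (k n)) g sequentially"
    unfolding uniform_limit_iff eventually_sequentially
  proof (intro allI impI)
    fix e :: real assume "0 < e"
    then obtain N where "\<forall>n t. n \<ge> N \<and> t \<in> {0..1} \<longrightarrow> norm (c (k1 (k2 n)) t - g t) < e"
      using unif by blast
    then show "\<exists>N. \<forall>n\<ge>N. \<forall>t\<in>{0..1}. dist (c (k n) t) (g t) < e"
      by (intro exI[of _ N]) (simp add: k_def dist_norm)
  qed
  have lims: "(\<lambda>n. s (f (k n))) \<longlonglongrightarrow> s l"
    unfolding s_def by (intro tendsto_intros lim)
  have ul_s: "uniform_limit {0..1} (\<lambda>n t. s (f (k n))) (\<lambda>t. s l) sequentially"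
    by (intro uniform_limit_const_in_domain lims)
  have ul_x: "uniform_limit {0..1} (\<lambda>n t. x (f (k n)) t) (\<lambda>t. x l t) sequentially"
    unfolding x_def
  proof (intro uniform_limit_add uniform_lim_mult uniform_limit_const_in_domain lims uniform_limit_const)
    show "(\<lambda>n. fst (fst (f (k n)))) \<longlonglongrightarrow> fst (fst l)" by (intro tendsto_intros lim)
  qed (auto simp: image_constant_conv)
  have ul_xc: "uniform_limit {0..1} (\<lambda>n t. (x (f (k n)) t, c (k n) t)) (\<lambda>t. (x l t, g t)) sequentially"
    by (intro uniform_limit_Pair_intro ul_x ul_c)
  have inK: "(x l t, g t) \<in> K" if "t \<in> {0..1}" for t
    using compact_imp_closed[OF K]
  proof (rule closed_sequentially)
    show "(x (f (k n)) t, c (k n) t) \<in> K" for n using c(3)[OF that] .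
    show "(\<lambda>n. (x (f (k n)) t, c (k n) t)) \<longlonglongrightarrow> (x l t, g t)"
      by (rule tendsto_uniform_limitI[OF ul_xc that])
  qed
  have ul_X: "uniform_limit {0..1} (\<lambda>n t. X (x (f (k n)) t, c (k n) t)) (\<lambda>t. X (x l t, g t)) sequentially"
    by (rule uniform_limit_compose_uniformly_continuous_on[OF ul_xc compact_uniformly_continuous[OF X K]])
       (use c(3) compact_imp_closed[OF K] in auto)
  have "bounded ((\<lambda>t. X (x l t, g t)) ` {0..1})"
    by (rule bounded_subset[OF compact_imp_bounded[OF \<open>compact (X ` K)\<close>]]) (use inK in auto)
  then have ul_d: "uniform_limit {0..1} (\<lambda>n t. s (f (k n)) * X (x (f (k n)) t, c (k n) t)) (\<lambda>t. s l * X (x l t, g t)) sequentially"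
    by (intro uniform_lim_mult ul_s ul_X) (auto simp: image_constant_conv)
  have "\<exists>G. \<forall>t\<in>{0..1}. (\<lambda>n. c (k n) t) \<longlonglongrightarrow> G t \<and> (G has_derivative (*) (s l * X (x l t, g t))) (at t within {0..1})"
  proof (rule has_derivative_sequence)
    show "(c (k n) has_derivative (*) (s (f (k n)) * X (x (f (k n)) t, c (k n) t))) (at t within {0..1})"
      if "t \<in> {0..1}" for n t
      using c(4)[OF that, of "k n"] by (simp add: has_field_derivative_def)
    show "\<forall>\<^sub>F n in sequentially. \<forall>t\<in>{0..1}. \<forall>h. norm (s (f (k n)) * X (x (f (k n)) t, c (k n) t) * h - s l * X (x l t, g t) * h) \<le> e * norm h"
      if "e > 0" for e :: real
      using uniform_limitD[OF ul_d that]
    proof eventually_elim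
      case (elim n)
      have "norm (a * h - b * h) \<le> e * norm h" if "dist a b < e" for a b h :: real
        using that by (simp add: dist_real_def abs_mult mult_right_mono flip: left_diff_distrib)
      then show ?case using elim by blast
    qed
    show "(\<lambda>n. c (k n) 0) \<longlonglongrightarrow> g 0" by (rule tendsto_uniform_limitI[OF ul_c]) auto
  qed auto
  then obtain G where G: "\<And>t. t \<in> {0..1} \<Longrightarrow> (\<lambda>n. c (k n) t) \<longlonglongrightarrow> G t"
    "\<And>t. t \<in> {0..1} \<Longrightarrow> (G has_derivative (*) (s l * X (x l t, g t))) (at t within {0..1})" by blast
  have Gg: "g t = G t" if "t \<in> {0..1}" for t
    using LIMSEQ_unique[OF tendsto_uniform_limitI[OF ul_c that] G(1)[OF that]] .
  have dg: "(g has_real_derivative s l * X (x l t, g t)) (at t within {0..1})" if "t \<in> {0..1}" for t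
    unfolding has_field_derivative_def
    by (rule has_derivative_transform[OF that _ G(2)[OF that]]) (use Gg in auto)
  have "g 0 = snd (fst l)"
  proof (rule LIMSEQ_unique)
    show "(\<lambda>n. c (k n) 0) \<longlonglongrightarrow> g 0" by (rule tendsto_uniform_limitI[OF ul_c]) auto
    show "(\<lambda>n. c (k n) 0) \<longlonglongrightarrow> snd (fst l)" unfolding c(1) by (intro tendsto_intros lim)
  qed
  moreover have "g 1 = snd (snd l)"
  proof (rule LIMSEQ_unique)
    show "(\<lambda>n. c (k n) 1) \<longlonglongrightarrow> g 1" by (rule tendsto_uniform_limitI[OF ul_c]) auto
    show "(\<lambda>n. c (k n) 1) \<longlonglongrightarrow> snd (snd l)" unfolding c(2) by (intro tendsto_intros lim)
  qed
  ultimately have "l \<in> reach K X"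
    unfolding reach_def case_prod_unfold using inK dg
    by (intro CollectI exI[of _ g]) (auto simp: s_def x_def)
  moreover have "strict_mono k" unfolding k_def by (rule strict_mono_o[OF k1 k2])
  ultimately show "\<exists>l\<in>reach K X. \<exists>r. strict_mono r \<and> (f \<circ> r) \<longlonglongrightarrow> l"
    using lim by (auto simp: o_def)
qed

text \<open>
  Gronwall's argument: the squared distance, multiplied by \<open>exp (- 2 * M * t)\<close>, decreases.
\<close>

lemma ode_unique_Icc:
  fixes c z :: "real \<Rightarrow> real"
  assumes c: "\<And>t. t \<in> {0..1} \<Longrightarrow> (c has_real_derivative f t (c t)) (at t within {0..1})"
    and z: "\<And>t. t \<in> {0..1} \<Longrightarrow> (z has_real_derivative f t (z t)) (at t within {0..1})"
    and lip: "\<And>t. t \<in> {0..1} \<Longrightarrow> \<bar>f t (c t) - f t (z t)\<bar> \<le> M * \<bar>c t - z t\<bar>"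
    and init: "c 0 = z 0" and t: "t \<in> {0..1}"
  shows "c t = z t"
proof -
  define g where "g t = (c t - z t)\<^sup>2 * exp (- (2 * M * t))" for t
  have "g t \<le> g 0"
  proof (rule DERIV_nonpos_imp_decreasing_open[where f = g and a = 0 and b = t])
    show "continuous_on {0..t} g"
    proof -
      have "continuous_on {0..1} c" by (rule DERIV_continuous_on) (erule c)
      moreover have "continuous_on {0..1} z" by (rule DERIV_continuous_on) (erule z)
      ultimately have "continuous_on {0..1} g" unfolding g_def by (intro continuous_intros)
      then show ?thesis by (rule continuous_on_subset) (use t in auto)
    qed
    fix u assume u: "0 < u" "u < t"
    then have u1: "u \<in> {0..1}" and at: "at u within {0..1} = at u"
      using t by (auto intro!: at_within_interior)
    let ?d = "c u - z u" and ?d' = "f u (c u) - f u (z u)"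
    have "(g has_real_derivative (2 * ?d * ?d' - 2 * M * ?d\<^sup>2) * exp (- (2 * M * u))) (at u)"
      unfolding g_def using c[OF u1] z[OF u1] unfolding at
      by (auto intro!: derivative_eq_intros simp: power2_eq_square algebra_simps)
    moreover have "2 * ?d * ?d' - 2 * M * ?d\<^sup>2 \<le> 0"
    proof -
      have "?d * ?d' \<le> \<bar>?d\<bar> * \<bar>?d'\<bar>" by (simp flip: abs_mult)
      also have "\<dots> \<le> \<bar>?d\<bar> * (M * \<bar>?d\<bar>)" using lip[OF u1] by (intro mult_left_mono) auto
      also have "\<dots> = M * ?d\<^sup>2" by (simp add: power2_eq_square)
      finally show ?thesis unfolding mult.assoc by linarith
    qed
    ultimately show "\<exists>y. (g has_real_derivative y) (at u) \<and> y \<le> 0"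
      by (meson exp_ge_zero mult_nonpos_nonneg)
  qed (use t in auto)
  then have "(c t - z t)\<^sup>2 * exp (- (2 * M * t)) \<le> 0" by (simp add: g_def init)
  then have "(c t - z t)\<^sup>2 \<le> 0" by (simp add: mult_le_0_iff)
  then show ?thesis by simp
qed

text \<open>
  If \<open>q\<close> lies on the same side of \<open>r\<close> as the end of the given curve and not further away in the
  \<open>u\<close>-direction, then both curves agree after a linear change of parameter.
\<close>

lemma reach_same_curve:
  assumes L: "L-lipschitz_on K X"
    and c: "c 0 = snd r" "\<And>t. t \<in> {0..1} \<Longrightarrow> (fst r + t * s, c t) \<in> K"
      "\<And>t. t \<in> {0..1} \<Longrightarrow> (c has_real_derivative s * X (fst r + t * s, c t)) (at t within {0..1})"
    and q: "(r, q) \<in> reach K X" and \<theta>: "fst q - fst r = \<theta> * s" "\<theta> \<in> {0..1}"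
  shows "snd q = c \<theta>"
proof -
  obtain z where z: "z 0 = snd r" "z 1 = snd q" "\<And>t. t \<in> {0..1} \<Longrightarrow> (fst r + t * (\<theta> * s), z t) \<in> K"
      "\<And>t. t \<in> {0..1} \<Longrightarrow> (z has_real_derivative (\<theta> * s) * X (fst r + t * (\<theta> * s), z t)) (at t within {0..1})"
    using q unfolding reach_def \<theta>(1)[symmetric] by blast
  have \<theta>t: "\<theta> * t \<in> {0..1}" if "t \<in> {0..1}" for t
    using that \<theta>(2) by (auto intro: mult_le_one)
  have "z 1 = c (\<theta> * 1)"
  proof (rule ode_unique_Icc[where c = z and z = "\<lambda>t. c (\<theta> * t)" and t = 1 and f = "\<lambda>t y. (\<theta> * s) * X (fst r + t * (\<theta> * s), y)" and M = "\<bar>\<theta> * s\<bar> * L"])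
    fix t :: real assume t: "t \<in> {0..1}"
    have "(c \<circ> (\<lambda>t. \<theta> * t) has_real_derivative (s * X (fst r + (\<theta> * t) * s, c (\<theta> * t))) * \<theta>) (at t within {0..1})"
    proof (rule DERIV_image_chain)
      have "(c has_real_derivative s * X (fst r + (\<theta> * t) * s, c (\<theta> * t))) (at (\<theta> * t) within {0..1})"
        using c(3)[OF \<theta>t[OF t]] .
      then show "(c has_real_derivative s * X (fst r + (\<theta> * t) * s, c (\<theta> * t))) (at (\<theta> * t) within (\<lambda>t. \<theta> * t) ` {0..1})"
        by (rule DERIV_subset) (use \<theta>t in auto)
    qed (auto intro!: derivative_eq_intros)
    from this[unfolded o_def]
    show "((\<lambda>t. c (\<theta> * t)) has_real_derivative (\<theta> * s) * X (fst r + t * (\<theta> * s), c (\<theta> * t))) (at t within {0..1})"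
      by (rule DERIV_cong) (simp add: mult_ac)
    have "(fst r + t * (\<theta> * s), c (\<theta> * t)) \<in> K"
      using c(2)[OF \<theta>t[OF t]] by (simp add: mult.commute mult.left_commute)
    then have "\<bar>X (fst r + t * (\<theta> * s), z t) - X (fst r + t * (\<theta> * s), c (\<theta> * t))\<bar> \<le> L * \<bar>z t - c (\<theta> * t)\<bar>"
      using lipschitz_onD[OF L z(3)[OF t] \<open>(_, c (\<theta> * t)) \<in> K\<close>] by (simp add: dist_Pair_Pair dist_real_def)
    then show "\<bar>(\<theta> * s) * X (fst r + t * (\<theta> * s), z t) - (\<theta> * s) * X (fst r + t * (\<theta> * s), c (\<theta> * t))\<bar> \<le> \<bar>\<theta> * s\<bar> * L * \<bar>z t - c (\<theta> * t)\<bar>"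
      by (simp add: mult_left_mono mult.assoc abs_mult flip: right_diff_distrib)
  qed (use z c(1) in auto)
  then show ?thesis using z(2) by simp
qed

text \<open>
  Two points reached from \<open>r\<close> on the same side (the sign \<open>\<sigma>\<close>) lie on one solution, and by the mean value
  theorem the slope of their chord is a value of \<open>X\<close> at a point of the solution in between. That
  point is also near \<open>p\<close>, because slopes in \<open>K\<close> are bounded.
\<close>

lemma reach_flat:
  assumes K: "compact K" and L: "L-lipschitz_on K X"
    and p: "(r, p) \<in> reach K X"
  shows "flat_at {q. (r, q) \<in> reach K X \<and> 0 \<le> \<sigma> * (fst q - fst r) \<and> \<bar>\<sigma>\<bar> = 1} p (- X p, 1)"
    (is "flat_at ?C _ _")
  unfolding flat_at_def
proof (intro allI impI)
  fix \<epsilon> :: real assume "\<epsilon> > 0"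
  have X: "continuous_on K X" using L by (rule lipschitz_on_continuous_on)
  have pK: "p \<in> K" using reach_endpoints[OF p] by simp
  obtain \<delta>0 where d0: "\<delta>0 > 0" "\<And>q. \<lbrakk>q \<in> K; dist q p < \<delta>0\<rbrakk> \<Longrightarrow> dist (X q) (X p) < \<epsilon>"
    using X pK \<open>\<epsilon> > 0\<close> unfolding continuous_on_iff by blast
  obtain B where B: "\<And>q. q \<in> K \<Longrightarrow> \<bar>X q\<bar> \<le> B"
    using compact_imp_bounded[OF compact_continuous_image[OF X K]] bounded_iff by (metis image_eqI real_norm_def)
  have B0: "B \<ge> 0" using B[OF pK] by simp
  \<comment> \<open>The intermediate point is at most \<open>(1 + B) * 2 * \<delta>\<close> away from a point of the \<open>\<delta>\<close>-ball.\<close>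
  define \<delta> where "\<delta> = \<delta>0 / (3 + 2 * B)"
  have d: "\<delta> > 0" "(3 + 2 * B) * \<delta> = \<delta>0" using d0 B0 by (auto simp: \<delta>_def)
  have main: "\<bar>(- X p, 1) \<bullet> (x - y)\<bar> \<le> \<epsilon> * norm (x - y)"
    if x: "x \<in> ?C" "x \<in> ball p \<delta>" and y: "y \<in> ?C" "y \<in> ball p \<delta>"
      and le: "\<bar>fst y - fst r\<bar> \<le> \<bar>fst x - fst r\<bar>" for x y
  proof -
    define s where "s = fst x - fst r"
    obtain \<theta> where \<theta>: "fst y - fst r = \<theta> * s" "\<theta> \<in> {0..1}"
    proof (cases "s = 0")
      case True
      then show ?thesis using le that[of 1] by (simp add: s_def)
    next
      case False
      have same: "0 \<le> (fst y - fst r) * s"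
        using x y by (auto simp: s_def abs_if zero_le_mult_iff split: if_splits)
      have "0 \<le> (fst y - fst r) / s" using same by (simp add: zero_le_mult_iff zero_le_divide_iff)
      moreover have "\<bar>(fst y - fst r) / s\<bar> \<le> 1" using le False by (simp add: s_def field_simps)
      then have "(fst y - fst r) / s \<le> 1" by (rule abs_le_D1)
      ultimately have "(fst y - fst r) / s \<in> {0..1}" by simp
      then show ?thesis using that[of "(fst y - fst r) / s"] False by simp
    qed
    obtain c where c: "c 0 = snd r" "c 1 = snd x" "\<And>t. t \<in> {0..1} \<Longrightarrow> (fst r + t * s, c t) \<in> K"
      "\<And>t. t \<in> {0..1} \<Longrightarrow> (c has_real_derivative s * X (fst r + t * s, c t)) (at t within {0..1})"
      using x(1) unfolding reach_def s_def by blast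
    have cy: "snd y = c \<theta>"
      by (rule reach_same_curve[OF L c(1,3,4) _ \<theta>]) (use y in auto)
    have "\<exists>\<xi>\<in>{\<theta>..1}. c 1 - c \<theta> = s * X (fst r + \<xi> * s, c \<xi>) * (1 - \<theta>)"
    proof (rule mvt_very_simple)
      show "(c has_derivative (*) (s * X (fst r + t * s, c t))) (at t within {\<theta>..1})" if "\<theta> \<le> t" "t \<le> 1" for t
        using DERIV_subset[OF c(4)[of t], of "{\<theta>..1}"] \<theta>(2) that by (auto simp: has_field_derivative_def)
    qed (use \<theta> in auto)
    then obtain \<xi> where \<xi>: "\<xi> \<in> {\<theta>..1}" and eq: "c 1 - c \<theta> = s * X (fst r + \<xi> * s, c \<xi>) * (1 - \<theta>)" by blast
    have \<xi>01: "\<xi> \<in> {0..1}" using \<xi> \<theta>(2) by auto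
    define q where "q = (fst r + \<xi> * s, c \<xi>)"
    have qK: "q \<in> K" using c(3)[OF \<xi>01] by (simp add: q_def)
    have "norm (c 1 - c \<xi>) \<le> \<bar>s\<bar> * B * norm (1 - \<xi>)"
    proof (rule field_differentiable_bound[OF convex_real_interval(5)])
      show "(c has_real_derivative s * X (fst r + v * s, c v)) (at v within {0..1})" if "v \<in> {0..1}" for v
        using c(4)[OF that] .
      show "norm (s * X (fst r + v * s, c v)) \<le> \<bar>s\<bar> * B" if "v \<in> {0..1}" for v
        using B[OF c(3)[OF that]] by (simp add: abs_mult mult_left_mono)
    qed (use \<xi>01 in auto)
    moreover have fx: "fst x = fst r + s" by (simp add: s_def)
    then have "x - q = (s * (1 - \<xi>), c 1 - c \<xi>)" by (cases x) (use c(2) in \<open>auto simp: q_def algebra_simps\<close>)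
    then have "norm (x - q) \<le> \<bar>s\<bar> * \<bar>1 - \<xi>\<bar> + \<bar>c 1 - c \<xi>\<bar>"
      using norm_Pair_le[of "s * (1 - \<xi>)" "c 1 - c \<xi>"] by (simp add: abs_mult)
    ultimately have "norm (x - q) \<le> (1 + B) * (\<bar>s\<bar> * (1 - \<xi>))"
      using \<xi>01 by (simp add: algebra_simps)
    also have "\<dots> \<le> (1 + B) * (\<bar>s\<bar> * (1 - \<theta>))"
      using \<xi> B0 by (intro mult_left_mono) auto
    also have dxy: "\<bar>s\<bar> * (1 - \<theta>) = \<bar>fst x - fst y\<bar>"
    proof -
      have "fst x - fst y = s * (1 - \<theta>)" using \<theta>(1) fx by (simp add: algebra_simps)
      then show ?thesis using \<theta>(2) by (simp add: abs_mult)
    qed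
    also have "(1 + B) * \<bar>fst x - fst y\<bar> \<le> (1 + B) * (2 * \<delta>)"
    proof (rule mult_left_mono)
      have "\<bar>fst x - fst y\<bar> \<le> norm (x - y)" by (rule abs_fst_diff_le)
      also have "\<dots> \<le> dist x p + dist p y" by (metis dist_norm dist_triangle)
      finally show "\<bar>fst x - fst y\<bar> \<le> 2 * \<delta>" using x(2) y(2) by (simp add: dist_commute)
    qed (use B0 in auto)
    finally have "dist q x \<le> (1 + B) * (2 * \<delta>)" by (simp add: dist_norm norm_minus_commute)
    then have "dist q p < (1 + B) * (2 * \<delta>) + \<delta>"
      using dist_triangle[of q p x] x(2) by (simp add: dist_commute)
    also have "\<dots> = \<delta>0" using d(2) by (simp add: algebra_simps)
    finally have Xq: "\<bar>X q - X p\<bar> \<le> \<epsilon>" using d0(2)[OF qK] by (simp add: dist_real_def)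
    have "snd x - snd y = X q * (fst x - fst y)"
    proof -
      have "fst x - fst y = s * (1 - \<theta>)" using \<theta>(1) fx by (simp add: algebra_simps)
      then show ?thesis using eq c(2) cy by (simp add: q_def mult.commute mult.left_commute)
    qed
    then have "(- X p, 1) \<bullet> (x - y) = (X q - X p) * (fst x - fst y)"
      by (simp add: inner_prod_def algebra_simps)
    then have "\<bar>(- X p, 1) \<bullet> (x - y)\<bar> \<le> \<epsilon> * \<bar>fst x - fst y\<bar>"
      using Xq by (simp add: abs_mult mult_right_mono)
    also have "\<dots> \<le> \<epsilon> * norm (x - y)"
    proof (rule mult_left_mono)
      show "\<bar>fst x - fst y\<bar> \<le> norm (x - y)"
        by (rule abs_fst_diff_le)
    qed (use \<open>\<epsilon> > 0\<close> in simp)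
    finally show ?thesis .
  qed
  have "\<bar>(- X p, 1) \<bullet> (x - y)\<bar> \<le> \<epsilon> * norm (x - y)" if "x \<in> ?C \<inter> ball p \<delta>" "y \<in> ?C \<inter> ball p \<delta>" for x y
  proof (cases "\<bar>fst y - fst r\<bar> \<le> \<bar>fst x - fst r\<bar>")
    case True
    then show ?thesis using main[of x y] that by blast
  next
    case False
    then have "\<bar>(- X p, 1) \<bullet> (y - x)\<bar> \<le> \<epsilon> * norm (y - x)" using main[of y x] that by auto
    then show ?thesis by (simp add: inner_diff_right abs_minus_commute norm_minus_commute)
  qed
  then show "\<exists>\<delta>>0. \<forall>x\<in>?C \<inter> ball p \<delta>. \<forall>y\<in>?C \<inter> ball p \<delta>. \<bar>(- X p, 1) \<bullet> (x - y)\<bar> \<le> \<epsilon> * norm (x - y)"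
    using d(1) by blast
qed

section \<open>Maximal solutions as curves\<close>

definition trajectory :: "(real \<times> real) set \<Rightarrow> (real \<times> real \<Rightarrow> real) \<Rightarrow> real \<times> real \<Rightarrow> (real \<times> real) set" where
  "trajectory U X g = {(x, w x) | x w I. maximal_ode_solution U X g I w \<and> x \<in> I}"

lemma rarefaction_graph_empty_barrier:
  "rarefaction_graph F G U {} k g = trajectory U (Xi F G k) g"
  unfolding rarefaction_graph_def trajectory_def by simp

text \<open>
  The regularity of the slope that uniqueness of solutions needs. It is inherited by sums, products and
  compositions without computing derivatives of the explicit formula for the slopes.
\<close>

definition lipschitz_on_compacts :: "(real \<times> real) set \<Rightarrow> (real \<times> real \<Rightarrow> real) \<Rightarrow> bool" where
  "lipschitz_on_compacts U f \<longleftrightarrow> (\<forall>K. compact K \<and> K \<subseteq> U \<longrightarrow> (\<exists>L. L-lipschitz_on K f))"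

lemma lipschitz_on_compacts_imp_continuous_on:
  assumes "open U" "lipschitz_on_compacts U f"
  shows "continuous_on U f"
proof (rule continuous_at_imp_continuous_on, intro ballI)
  fix p assume "p \<in> U"
  then obtain e where e: "e > 0" "cball p e \<subseteq> U" using \<open>open U\<close> open_contains_cball by blast
  then obtain L where "L-lipschitz_on (cball p e) f"
    using assms(2) unfolding lipschitz_on_compacts_def by (meson compact_cball)
  then have "continuous_on (cball p e) f" by (rule lipschitz_on_continuous_on)
  moreover have "p \<in> interior (cball p e)" using e(1) by (simp add: interior_cball)
  ultimately show "isCont f p" by (rule continuous_on_interior)
qed

lemma ode_solution_continuous_on:
  assumes "ode_solution U X g I w" shows "continuous_on I w"
  using assms unfolding ode_solution_def
  by (meson DERIV_isCont continuous_at_imp_continuous_on)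

lemma ode_solution_segment_subset:
  assumes "ode_solution U X g I w" "x \<in> I" shows "closed_segment (fst g) x \<subseteq> I"
  using assms unfolding ode_solution_def
  by (meson closed_segment_subset is_interval_convex)

lemma ode_solution_compact_graph:
  assumes sol: "ode_solution U X g I w" and x: "x \<in> I"
  shows "compact ((\<lambda>z. (z, w z)) ` closed_segment (fst g) x)"
    and "connected ((\<lambda>z. (z, w z)) ` closed_segment (fst g) x)"
    and "(\<lambda>z. (z, w z)) ` closed_segment (fst g) x \<subseteq> U"
proof -
  have sub: "closed_segment (fst g) x \<subseteq> I" by (rule ode_solution_segment_subset[OF sol x])
  have cont: "continuous_on (closed_segment (fst g) x) (\<lambda>z. (z, w z))"
    by (intro continuous_intros continuous_on_subset[OF ode_solution_continuous_on[OF sol] sub])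
  show "compact ((\<lambda>z. (z, w z)) ` closed_segment (fst g) x)"
    by (intro compact_continuous_image cont compact_segment)
  show "connected ((\<lambda>z. (z, w z)) ` closed_segment (fst g) x)"
    by (intro connected_continuous_image cont connected_segment)
  show "(\<lambda>z. (z, w z)) ` closed_segment (fst g) x \<subseteq> U"
    using sub sol unfolding ode_solution_def by blast
qed

lemma ode_solution_reach:
  assumes sol: "ode_solution U X g I w" and x: "x \<in> I"
    and K: "(\<lambda>z. (z, w z)) ` closed_segment (fst g) x \<subseteq> K"
  shows "(g, (x, w x)) \<in> reach K X"
proof -
  let ?h = "\<lambda>t. fst g + t * (x - fst g)"
  have seg: "?h t \<in> closed_segment (fst g) x" if "t \<in> {0..1}" for t
    using that by (auto simp: in_segment algebra_simps intro!: exI[of _ t])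
  have der: "((\<lambda>t. w (?h t)) has_real_derivative (x - fst g) * X (?h t, w (?h t))) (at t within {0..1})"
    if "t \<in> {0..1}" for t
  proof -
    have "(w has_real_derivative X (?h t, w (?h t))) (at (?h t))"
      using seg[OF that] ode_solution_segment_subset[OF sol x] sol unfolding ode_solution_def by blast
    moreover have "(?h has_real_derivative (x - fst g)) (at t within {0..1})"
      by (auto intro!: derivative_eq_intros)
    ultimately show ?thesis
      using DERIV_chain2[of w "X (?h t, w (?h t))" ?h t "x - fst g" "{0..1}"] by (simp add: mult.commute)
  qed
  have "w (fst g) = snd g" using sol unfolding ode_solution_def by blast
  then show ?thesis
    unfolding reach_def using seg K der
    by (auto intro!: exI[of _ "\<lambda>t. w (?h t)"])
qed

lemma reach_unique:
  assumes L: "L-lipschitz_on K X" and p: "(r, p) \<in> reach K X" and q: "(r, q) \<in> reach K X"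
    and eq: "fst p = fst q"
  shows "p = q"
proof -
  obtain c where c: "c 0 = snd r" "c 1 = snd p" "\<And>t. t \<in> {0..1} \<Longrightarrow> (fst r + t * (fst p - fst r), c t) \<in> K"
     "\<And>t. t \<in> {0..1} \<Longrightarrow> (c has_real_derivative (fst p - fst r) * X (fst r + t * (fst p - fst r), c t)) (at t within {0..1})"
    using p unfolding reach_def by blast
  have "snd q = c 1"
    by (rule reach_same_curve[OF L c(1,3,4) q]) (use eq in auto)
  then show ?thesis using c(2) eq by (simp add: prod_eq_iff)
qed

lemma ode_solution_unique:
  assumes X: "lipschitz_on_compacts U X"
    and w: "ode_solution U X g I w" and z: "ode_solution U X g J z" and x: "x \<in> I" "x \<in> J"
  shows "w x = z x"
proof -
  define K where "K = (\<lambda>y. (y, w y)) ` closed_segment (fst g) x \<union> (\<lambda>y. (y, z y)) ` closed_segment (fst g) x"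
  have "compact K" "K \<subseteq> U"
    unfolding K_def using ode_solution_compact_graph[OF w x(1)] ode_solution_compact_graph[OF z x(2)] by auto
  then obtain L where L: "L-lipschitz_on K X" using X unfolding lipschitz_on_compacts_def by blast
  have "(x, w x) = (x, z x)"
    by (rule reach_unique[OF L ode_solution_reach[OF w x(1)] ode_solution_reach[OF z x(2)]]) (auto simp: K_def)
  then show ?thesis by simp
qed

lemma ode_solution_glue:
  assumes X: "lipschitz_on_compacts U X"
    and w: "ode_solution U X g I w" and z: "ode_solution U X g J z"
  shows "ode_solution U X g (I \<union> J) (\<lambda>x. if x \<in> I then w x else z x)" (is "ode_solution _ _ _ _ ?y")
proof -
  have oI: "open I" "open J" "is_interval I" "is_interval J" "fst g \<in> I" "fst g \<in> J"
    and wI: "w (fst g) = snd g" "\<And>x. x \<in> I \<Longrightarrow> (x, w x) \<in> U \<and> (w has_real_derivative X (x, w x)) (at x)"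
    and zJ: "\<And>x. x \<in> J \<Longrightarrow> (x, z x) \<in> U \<and> (z has_real_derivative X (x, z x)) (at x)"
    using w z unfolding ode_solution_def by auto
  have yI: "?y x = w x" if "x \<in> I" for x using that by simp
  have yJ: "?y x = z x" if "x \<in> J" for x using ode_solution_unique[OF X w z] that by auto
  have "(x, ?y x) \<in> U \<and> (?y has_real_derivative X (x, ?y x)) (at x)" if "x \<in> I \<union> J" for x
  proof (cases "x \<in> I")
    case True
    have "(?y has_real_derivative X (x, w x)) (at x)"
      by (rule has_field_derivative_transform_within_open[of w _ _ I]) (use wI(2)[OF True] oI True yI in auto)
    then show ?thesis using wI(2)[OF True] True by simp
  next
    case False
    then have xJ: "x \<in> J" using that by blast
    have "(?y has_real_derivative X (x, z x)) (at x)"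
      by (rule has_field_derivative_transform_within_open[of z _ _ J]) (use zJ[OF xJ] oI xJ yJ in \<open>auto simp del: if_split\<close>)
    then show ?thesis using zJ[OF xJ] False by simp
  qed
  moreover have "is_interval (I \<union> J)"
    using oI unfolding is_interval_connected_1 by (intro connected_Un) auto
  ultimately show ?thesis
    unfolding ode_solution_def using oI wI(1) by auto
qed

lemma maximal_ode_solutionD:
  assumes "maximal_ode_solution U X g I w" "ode_solution U X g J z" "I \<subseteq> J" "\<And>x. x \<in> I \<Longrightarrow> z x = w x"
  shows "J = I"
  using assms unfolding maximal_ode_solution_def by blast

lemma maximal_ode_solution_unique:
  assumes X: "lipschitz_on_compacts U X"
    and w: "maximal_ode_solution U X g I w" and z: "maximal_ode_solution U X g J z"
  shows "J = I"
proof -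
  have ws: "ode_solution U X g I w" and zs: "ode_solution U X g J z"
    using w z unfolding maximal_ode_solution_def by auto
  have "I \<union> J = I"
    by (rule maximal_ode_solutionD[OF w ode_solution_glue[OF X ws zs]]) auto
  moreover have "J \<union> I = J"
    by (rule maximal_ode_solutionD[OF z ode_solution_glue[OF X zs ws]]) auto
  ultimately show ?thesis by blast
qed

text \<open>
  Solutions through the same state can be glued, so a maximal one is unique and the union over all
  maximal solutions is a single graph.
\<close>

lemma trajectory_eq_graph:
  assumes X: "lipschitz_on_compacts U X" and w: "maximal_ode_solution U X g I w"
  shows "trajectory U X g = (\<lambda>x. (x, w x)) ` I"
proof
  show "(\<lambda>x. (x, w x)) ` I \<subseteq> trajectory U X g"
    unfolding trajectory_def using w by blast
  show "trajectory U X g \<subseteq> (\<lambda>x. (x, w x)) ` I"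
  proof
    fix p assume "p \<in> trajectory U X g"
    then obtain x z J where z: "maximal_ode_solution U X g J z" and p: "p = (x, z x)" "x \<in> J"
      unfolding trajectory_def by blast
    have "J = I" using maximal_ode_solution_unique[OF X w z] .
    moreover have "z x = w x"
      using ode_solution_unique[OF X, of g J z I w x] z w p \<open>J = I\<close> unfolding maximal_ode_solution_def by blast
    ultimately show "p \<in> (\<lambda>x. (x, w x)) ` I" using p by blast
  qed
qed

lemma trajectoryE:
  assumes X: "lipschitz_on_compacts U X" and p: "p \<in> trajectory U X g"
  obtains I w where "ode_solution U X g I w" "fst p \<in> I" "p = (fst p, w (fst p))" "trajectory U X g = (\<lambda>x. (x, w x)) ` I"
proof -
  obtain x w I where w: "maximal_ode_solution U X g I w" and px: "p = (x, w x)" "x \<in> I"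
    using p unfolding trajectory_def by blast
  then show ?thesis
    using that[of I w] trajectory_eq_graph[OF X w] unfolding maximal_ode_solution_def by auto
qed

lemma trajectory_subset: "trajectory U X g \<subseteq> U"
  unfolding trajectory_def maximal_ode_solution_def ode_solution_def by blast

lemma normal_at_trajectory:
  assumes X: "lipschitz_on_compacts U X" and p: "p \<in> trajectory U X g"
  shows "normal_at (trajectory U X g) p (- X p, 1)"
proof -
  obtain I w where sol: "ode_solution U X g I w" and pI: "fst p \<in> I" and pw: "p = (fst p, w (fst p))"
    and tr: "trajectory U X g = (\<lambda>x. (x, w x)) ` I"
    using trajectoryE[OF X p] .
  have "(w has_derivative (*) (X p)) (at (fst p))"
    using sol pI pw unfolding ode_solution_def has_field_derivative_def by metis
  then have d: "\<And>e. e > 0 \<Longrightarrow> \<exists>d>0. \<forall>y. norm (y - fst p) < d \<longrightarrow> norm (w y - w (fst p) - X p * (y - fst p)) \<le> e * norm (y - fst p)"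
    unfolding has_derivative_at_alt by blast
  show ?thesis
    unfolding normal_at_def
  proof (intro allI impI)
    fix \<epsilon> :: real assume "\<epsilon> > 0"
    then obtain d where d: "d > 0" "\<And>y. norm (y - fst p) < d \<Longrightarrow> norm (w y - w (fst p) - X p * (y - fst p)) \<le> \<epsilon> * norm (y - fst p)"
      using d by blast
    have "\<bar>(- X p, 1) \<bullet> (q - p)\<bar> \<le> \<epsilon> * norm (q - p)" if q: "q \<in> trajectory U X g \<inter> ball p d" for q
    proof -
      obtain y where y: "q = (y, w y)" using q tr by auto
      have le: "\<bar>y - fst p\<bar> \<le> norm (q - p)" using abs_fst_diff_le[of q p] y by simp
      also have "\<dots> < d" using q by (simp add: dist_norm norm_minus_commute)
      finally have "\<bar>w y - w (fst p) - X p * (y - fst p)\<bar> \<le> \<epsilon> * \<bar>y - fst p\<bar>" using d(2)[of y] by simp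
      also have "\<dots> \<le> \<epsilon> * norm (q - p)" using le \<open>\<epsilon> > 0\<close> by simp
      finally have A: "\<bar>w y - w (fst p) - X p * (y - fst p)\<bar> \<le> \<epsilon> * norm (q - p)" .
      have "snd p = w (fst p)" using pw by (metis snd_conv)
      then have "(- X p, 1) \<bullet> (q - p) = w y - w (fst p) - X p * (y - fst p)"
        by (simp add: y inner_prod_def algebra_simps)
      then show ?thesis using A by simp
    qed
    then show "\<exists>\<delta>>0. \<forall>x\<in>trajectory U X g \<inter> ball p \<delta>. \<bar>(- X p, 1) \<bullet> (x - p)\<bar> \<le> \<epsilon> * norm (x - p)"
      using d(1) by blast
  qed
qed

lemma tangent_space_trajectory:
  assumes "open U" and X: "lipschitz_on_compacts U X" and p: "p \<in> trajectory U X g"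
  shows "(1, X p) \<in> tangent_space p (trajectory U X g)"
proof -
  obtain I w where sol: "ode_solution U X g I w" and pI: "fst p \<in> I" and pw: "p = (fst p, w (fst p))"
    and tr: "trajectory U X g = (\<lambda>x. (x, w x)) ` I"
    using trajectoryE[OF X p] .
  have "open I" and der: "\<And>x. x \<in> I \<Longrightarrow> (x, w x) \<in> U \<and> (w has_real_derivative X (x, w x)) (at x)"
    using sol unfolding ode_solution_def by auto
  obtain e where e: "e > 0" "ball (fst p) e \<subseteq> I" using \<open>open I\<close> pI openE by blast
  have inI: "fst p + t \<in> I" if "t \<in> {-e<..<e}" for t
    using that e(2) by (auto simp: subset_iff dist_real_def)
  define \<gamma> where "\<gamma> t = (fst p + t, w (fst p + t))" for t
  have d\<gamma>: "(\<gamma> has_vector_derivative (1, X (\<gamma> t))) (at t)" if "t \<in> {-e<..<e}" for t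
  proof -
    have "((\<lambda>t. w (fst p + t)) has_real_derivative X (\<gamma> t)) (at t)"
      using der[OF inI[OF that]] by (simp add: \<gamma>_def DERIV_shift add.commute)
    moreover have "((\<lambda>t. fst p + t) has_real_derivative 1) (at t)"
      by (auto intro!: derivative_eq_intros)
    ultimately show ?thesis
      unfolding \<gamma>_def by (intro has_vector_derivative_Pair) (auto simp: has_real_derivative_iff_has_vector_derivative)
  qed
  have cont: "continuous_on {-e<..<e} \<gamma>"
    using d\<gamma> by (meson continuous_at_imp_continuous_on has_vector_derivative_continuous)
  have "continuous_on {-e<..<e} (\<lambda>t. X (\<gamma> t))"
    by (rule continuous_on_compose2[OF lipschitz_on_compacts_imp_continuous_on[OF \<open>open U\<close> X] cont])
       (use der inI in \<open>auto simp: \<gamma>_def\<close>)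
  then have "\<gamma> C1_differentiable_on {-e<..<e}"
    unfolding C1_differentiable_on_def
    by (intro exI[of _ "\<lambda>t. (1, X (\<gamma> t))"] conjI ballI d\<gamma> continuous_intros)
  moreover have "\<gamma> 0 = p" using pw by (simp add: \<gamma>_def)
  moreover have "\<gamma> ` {-e<..<e} \<subseteq> trajectory U X g" unfolding tr using inI by (auto simp: \<gamma>_def)
  moreover have "(\<gamma> has_vector_derivative (1, X p)) (at 0)" using d\<gamma>[of 0] e(1) \<open>\<gamma> 0 = p\<close> by simp
  ultimately show ?thesis unfolding tangent_space_def using e(1) by blast
qed

lemma trajectory_reach:
  assumes X: "lipschitz_on_compacts U X" and p: "p \<in> trajectory U X g"
  obtains K where "compact K" "K \<subseteq> U" "(g, p) \<in> reach K X"
proof -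
  obtain I w where sol: "ode_solution U X g I w" and pI: "fst p \<in> I" and pw: "p = (fst p, w (fst p))"
    using trajectoryE[OF X p] .
  show ?thesis
    by (rule that[OF ode_solution_compact_graph(1)[OF sol pI] ode_solution_compact_graph(3)[OF sol pI]])
       (use ode_solution_reach[OF sol pI order_refl] pw in simp)
qed

text \<open>
  The curve starts in the interior of \<open>K\<close>. If it left \<open>K\<close> before its end it would, by connectedness, have
  met the frontier earlier.
\<close>

lemma rarefaction_graph_barrier_reach:
  assumes K: "compact K" "K \<subseteq> U" and g: "g \<in> interior K"
  shows "rarefaction_graph F G U (frontier K) k g \<subseteq> {p. (g, p) \<in> reach K (Xi F G k)}"
proof
  fix p assume "p \<in> rarefaction_graph F G U (frontier K) k g"
  then obtain x w I where sol: "ode_solution U (Xi F G k) g I w" and p: "p = (x, w x)" and x: "x \<in> I"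
    and bar: "\<And>z. z \<in> open_segment (fst g) x \<Longrightarrow> (z, w z) \<notin> frontier K"
    unfolding rarefaction_graph_def maximal_ode_solution_def by blast
  have wg: "w (fst g) = snd g" using sol unfolding ode_solution_def by blast
  have gF: "g \<notin> frontier K" using g by (simp add: frontier_def)
  have gK: "g \<in> K" using g interior_subset by blast
  have "(z, w z) \<in> K" if z: "z \<in> closed_segment (fst g) x" for z
  proof (rule ccontr)
    assume nz: "(z, w z) \<notin> K"
    have zI: "z \<in> I" using z ode_solution_segment_subset[OF sol x] by blast
    let ?S = "(\<lambda>y. (y, w y)) ` closed_segment (fst g) z"
    have "?S \<inter> frontier K \<noteq> {}"
    proof (rule connected_Int_frontier)
      show "connected ?S" by (rule ode_solution_compact_graph[OF sol zI])
      have "g \<in> ?S" using wg by (auto intro!: image_eqI[of _ _ "fst g"])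
      then show "?S \<inter> K \<noteq> {}" using gK by blast
      show "?S - K \<noteq> {}" using nz by (auto intro!: image_eqI[of _ _ z])
    qed
    then obtain y where y: "y \<in> closed_segment (fst g) z" "(y, w y) \<in> frontier K" by blast
    have "(y, w y) \<in> K" using y(2) K(1) compact_imp_closed frontier_subset_closed by blast
    then have "y \<noteq> z" using nz by auto
    moreover have "y \<noteq> fst g" using y(2) gF wg by auto
    ultimately have "y \<in> open_segment (fst g) x"
      using y(1) z by (auto simp: open_segment_def closed_segment_eq_real_ivl split: if_splits)
    then show False using bar y(2) by blast
  qed
  then show "p \<in> {p. (g, p) \<in> reach K (Xi F G k)}"
    using ode_solution_reach[OF sol x, of K] p by auto
qed

section \<open>Generic transversality for loci and integral curves\<close>

text \<open>
  The envelope theorem for a constant curve parameter.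
\<close>

lemma negligible_if_flat:
  assumes n: "continuous_on C n" "\<And>p. p \<in> C \<Longrightarrow> n p \<noteq> 0" "\<And>p. p \<in> C \<Longrightarrow> flat_at C p (n p)"
  shows "negligible C"
proof -
  have "negligible (fst ` (C \<times> {0 :: real \<times> real}))"
  proof (rule negligible_envelope[where n = "\<lambda>a. n (fst a)" and \<nu> = "\<lambda>_. (1, 0)"])
    show "continuous_on (C \<times> {0}) (\<lambda>a. n (fst a))"
      by (rule continuous_on_compose2[OF n(1)]) (auto intro!: continuous_intros)
    fix a :: "(real \<times> real) \<times> (real \<times> real)" and \<epsilon> :: real
    assume a: "a \<in> C \<times> {0}" and "0 < \<epsilon>"
    have "flat_at C (fst a) (n (fst a))" using a n(3) by (auto simp: mem_Times_iff)
    then obtain \<delta> where \<delta>: "\<delta> > 0" "\<forall>x\<in>C \<inter> ball (fst a) \<delta>. \<forall>y\<in>C \<inter> ball (fst a) \<delta>. \<bar>n (fst a) \<bullet> (x - y)\<bar> \<le> \<epsilon> * norm (x - y)"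
      using \<open>0 < \<epsilon>\<close> unfolding flat_at_def by blast
    have "\<bar>n (fst a) \<bullet> (fst x - fst y)\<bar> \<le> \<epsilon> * norm (x - y) \<and> \<bar>(1, 0) \<bullet> (snd x - snd y)\<bar> \<le> \<epsilon> * norm (x - y)"
      if "x \<in> C \<times> {0} \<inter> ball a \<delta>" "y \<in> C \<times> {0} \<inter> ball a \<delta>" for x y
    proof -
      have "fst x \<in> C \<inter> ball (fst a) \<delta>" "fst y \<in> C \<inter> ball (fst a) \<delta>"
        using that order_le_less_trans[OF dist_fst_le[of a]] by (auto simp: mem_Times_iff)
      then have "\<bar>n (fst a) \<bullet> (fst x - fst y)\<bar> \<le> \<epsilon> * norm (fst x - fst y)" using \<delta>(2) by blast
      also have "\<dots> \<le> \<epsilon> * norm (x - y)"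
        using \<open>0 < \<epsilon>\<close> dist_fst_le[of x y] by (simp add: dist_norm)
      finally show ?thesis using that \<open>0 < \<epsilon>\<close> by (auto simp: mem_Times_iff)
    qed
    then show "\<exists>\<delta>>0. \<forall>x\<in>C \<times> {0} \<inter> ball a \<delta>. \<forall>y\<in>C \<times> {0} \<inter> ball a \<delta>.
        \<bar>n (fst a) \<bullet> (fst x - fst y)\<bar> \<le> \<epsilon> * norm (x - y) \<and> \<bar>(1, 0) \<bullet> (snd x - snd y)\<bar> \<le> \<epsilon> * norm (x - y)"
      using \<delta>(1) by blast
  qed (use n in \<open>auto simp: zero_prod_def\<close>)
  moreover have "fst ` (C \<times> {0 :: real \<times> real}) = C" by force
  ultimately show ?thesis by simp
qed

definition smooth_at :: "(real \<times> real) set \<Rightarrow> real \<times> real \<Rightarrow> real \<times> real \<Rightarrow> bool" where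
  "smooth_at V p \<nu> \<longleftrightarrow> normal_at V p \<nu> \<and> perp \<nu> \<in> tangent_space p V"

lemma smooth_transversal:
  assumes "smooth_at V p \<nu>" "smooth_at W p \<mu>" "\<nu> \<bullet> perp \<mu> \<noteq> 0" "p \<in> V \<inter> W - B"
  shows "p isolated_in (V \<inter> W - B) \<and> transversal_at p V W"
proof -
  have "\<not> p islimpt (V \<inter> W)"
    using assms not_islimpt_Int_if_normals_independent unfolding smooth_at_def by blast
  then have "\<not> p islimpt (V \<inter> W - B)" by (meson Diff_subset islimpt_subset)
  moreover have "transversal_at p V W"
    using assms by (intro transversal_atI[of "perp \<nu>" _ _ "perp \<mu>"]) (auto simp: smooth_at_def)
  ultimately show ?thesis using assms(4) by (simp add: isolated_in_islimpt_iff)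
qed

lemma normal_at_Un:
  assumes "normal_at V p \<nu>" "normal_at W p \<nu>"
  shows "normal_at (V \<union> W) p \<nu>"
  unfolding normal_at_def
proof (intro allI impI)
  fix \<epsilon> :: real assume e: "\<epsilon> > 0"
  obtain d1 where d1: "d1 > 0" "\<forall>x\<in>V \<inter> ball p d1. \<bar>\<nu> \<bullet> (x - p)\<bar> \<le> \<epsilon> * norm (x - p)"
    using assms(1) e unfolding normal_at_def by blast
  obtain d2 where d2: "d2 > 0" "\<forall>x\<in>W \<inter> ball p d2. \<bar>\<nu> \<bullet> (x - p)\<bar> \<le> \<epsilon> * norm (x - p)"
    using assms(2) e unfolding normal_at_def by blast
  show "\<exists>\<delta>>0. \<forall>x\<in>(V \<union> W) \<inter> ball p \<delta>. \<bar>\<nu> \<bullet> (x - p)\<bar> \<le> \<epsilon> * norm (x - p)"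
    using d1 d2 by (intro exI[of _ "min d1 d2"]) auto
qed

text \<open>
  Points reached to the left and to the right of \<open>r\<close> are treated separately. On the side that does not
  contain \<open>p\<close> there are no points near \<open>p\<close>.
\<close>

lemma normal_at_reach:
  assumes K: "compact K" and L: "L-lipschitz_on K X" and p: "(r, p) \<in> reach K X"
  shows "normal_at {q. (r, q) \<in> reach K X} p (- X p, 1)"
proof -
  let ?C = "\<lambda>\<sigma>. {q. (r, q) \<in> reach K X \<and> 0 \<le> \<sigma> * (fst q - fst r) \<and> \<bar>\<sigma>\<bar> = 1}"
  have side: "normal_at (?C \<sigma>) p (- X p, 1)" if \<sigma>: "\<bar>\<sigma>\<bar> = 1" for \<sigma>
  proof (cases "p \<in> ?C \<sigma>")
    case True
    then show ?thesis by (intro flat_at_imp_normal_at reach_flat[OF K L p])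
  next
    case False
    then have neg: "\<sigma> * (fst p - fst r) < 0" using p \<sigma> by auto
    have "?C \<sigma> \<inter> ball p \<bar>fst p - fst r\<bar> = {}"
    proof (rule ccontr)
      assume "?C \<sigma> \<inter> ball p \<bar>fst p - fst r\<bar> \<noteq> {}"
      then obtain q where q: "0 \<le> \<sigma> * (fst q - fst r)" "norm (p - q) < \<bar>fst p - fst r\<bar>" by (auto simp: dist_norm)
      have "\<bar>fst p - fst q\<bar> < \<bar>fst p - fst r\<bar>" using abs_fst_diff_le[of p q] q(2) by linarith
      then show False using neg q(1) \<sigma> by (auto simp: abs_if zero_le_mult_iff split: if_splits)
    qed
    then show ?thesis
      unfolding normal_at_def using neg by (intro allI impI exI[of _ "\<bar>fst p - fst r\<bar>"]) auto
  qed
  have "normal_at (?C 1 \<union> ?C (- 1)) p (- X p, 1)" by (intro normal_at_Un side) auto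
  moreover have "{q. (r, q) \<in> reach K X} = ?C 1 \<union> ?C (- 1)" by auto
  ultimately show ?thesis by simp
qed

lemma compact_reach_slice:
  assumes K: "compact K" and X: "continuous_on K X"
  shows "compact {q. (r, q) \<in> reach K X}"
proof -
  have "compact (snd ` (reach K X \<inter> ({r} \<times> UNIV)))"
    by (intro compact_continuous_image compact_Int_closed compact_reach[OF K X] closed_Times) (auto intro!: continuous_intros)
  moreover have "snd ` (reach K X \<inter> ({r} \<times> UNIV)) = {q. (r, q) \<in> reach K X}" by force
  ultimately show ?thesis by simp
qed

text \<open>
  What the argument uses of the Hugoniot function \<open>H\<close>: by symmetry one function \<open>D\<close>, the gradient in the
  second argument, describes both partial gradients, and nonvanishing of \<open>D\<close> on the zero set gives
  regular loci as well as a regular dependence on the base state.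
\<close>

locale shock_function =
  fixes U :: "(real \<times> real) set" and H :: "real \<times> real \<Rightarrow> real \<times> real \<Rightarrow> real"
    and D :: "real \<times> real \<Rightarrow> real \<times> real \<Rightarrow> real \<times> real"
  assumes open_U: "open U"
    and H_sym: "H l p = H p l"
    and H_deriv: "\<lbrakk>l \<in> U; p \<in> U\<rbrakk> \<Longrightarrow>
      ((\<lambda>z. H (fst z) (snd z)) has_derivative (\<lambda>h. (D p l, D l p) \<bullet> h)) (at (l, p))"
    and D_cont: "continuous_on (U \<times> U) (\<lambda>z. D (fst z) (snd z))"
    and D_nonzero: "\<lbrakk>l \<in> U; p \<in> U; l \<noteq> p; H l p = 0\<rbrakk> \<Longrightarrow> D l p \<noteq> 0"
begin

definition locus where "locus l = {p \<in> U. H l p = 0}"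

lemma H_cont: "continuous_on (U \<times> U) (\<lambda>z. H (fst z) (snd z))"
proof (rule continuous_at_imp_continuous_on, intro ballI)
  fix z assume "z \<in> U \<times> U"
  then show "isCont (\<lambda>z. H (fst z) (snd z)) z"
    using has_derivative_continuous[OF H_deriv, of "fst z" "snd z"] by auto
qed

lemma continuous_on_H [continuous_intros]:
  assumes "continuous_on S a" "continuous_on S b" "\<And>x. x \<in> S \<Longrightarrow> a x \<in> U \<and> b x \<in> U"
  shows "continuous_on S (\<lambda>x. H (a x) (b x))"
  using continuous_on_compose2[OF H_cont continuous_on_Pair[OF assms(1,2)]] assms(3) by auto

lemma continuous_on_D [continuous_intros]:
  assumes "continuous_on S a" "continuous_on S b" "\<And>x. x \<in> S \<Longrightarrow> a x \<in> U \<and> b x \<in> U"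
  shows "continuous_on S (\<lambda>x. D (a x) (b x))"
  using continuous_on_compose2[OF D_cont continuous_on_Pair[OF assms(1,2)]] assms(3) by auto

lemma H_deriv_snd:
  assumes "l \<in> U" "p \<in> U"
  shows "(H l has_derivative (\<lambda>h. D l p \<bullet> h)) (at p)"
proof -
  have "((\<lambda>p. (l, p)) has_derivative (\<lambda>h. (0, h))) (at p)"
    by (auto intro!: derivative_eq_intros)
  from diff_chain_at[OF this H_deriv[OF assms]] show ?thesis by (simp add: o_def)
qed

lemma flat_at_locus:
  assumes "l \<in> U" "p \<in> U"
  shows "flat_at (locus l) p (D l p)"
  unfolding flat_at_def
proof (intro allI impI)
  fix \<epsilon> :: real assume "\<epsilon> > 0"
  have "continuous_on U (D l)" using assms by (intro continuous_intros) auto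
  from gradient_strict[OF open_U H_deriv_snd[OF assms(1)] this assms(2) \<open>\<epsilon> > 0\<close>]
  obtain \<delta> where \<delta>: "\<delta> > 0" "\<forall>x\<in>ball p \<delta>. \<forall>y\<in>ball p \<delta>. \<bar>H l x - H l y - D l p \<bullet> (x - y)\<bar> \<le> \<epsilon> * norm (x - y)"
    by blast
  have "\<bar>D l p \<bullet> (x - y)\<bar> \<le> \<epsilon> * norm (x - y)" if "x \<in> locus l \<inter> ball p \<delta>" "y \<in> locus l \<inter> ball p \<delta>" for x y
    using \<delta>(2)[rule_format, of x y] that by (auto simp: locus_def)
  then show "\<exists>\<delta>>0. \<forall>x\<in>locus l \<inter> ball p \<delta>. \<forall>y\<in>locus l \<inter> ball p \<delta>. \<bar>D l p \<bullet> (x - y)\<bar> \<le> \<epsilon> * norm (x - y)"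
    using \<delta>(1) by blast
qed

lemma smooth_at_locus:
  assumes "l \<in> U" "p \<in> locus l" "p \<noteq> l"
  shows "smooth_at (locus l) p (D l p)"
proof -
  have p: "p \<in> U" "H l p = 0" using assms(2) by (auto simp: locus_def)
  have "perp (D l p) \<in> tangent_space p (locus l)"
  proof (rule perp_gradient_in_tangent_space[OF open_U H_deriv_snd[OF assms(1)] _ p(1) _ p(2)])
    show "continuous_on U (D l)" using assms by (intro continuous_intros) auto
    show "D l p \<noteq> 0" using assms p D_nonzero[of l p] by auto
  qed (auto simp: locus_def)
  then show ?thesis
    using flat_at_imp_normal_at[OF flat_at_locus[OF assms(1) p(1)] assms(2)] by (simp add: smooth_at_def)
qed

lemma compact_locus:
  assumes "l \<in> U" "compact K" "K \<subseteq> U"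
  shows "compact (locus l \<inter> K)"
proof -
  have "continuous_on K (H l)" using assms by (intro continuous_intros) auto
  then have "closedin (top_of_set K) {p \<in> K. H l p = 0}"
    by (rule continuous_closedin_preimage_constant)
  then have "compact {p \<in> K. H l p = 0}" using assms(2) closedin_compact by blast
  moreover have "locus l \<inter> K = {p \<in> K. H l p = 0}" using assms(3) by (auto simp: locus_def)
  ultimately show ?thesis by simp
qed

lemma negligible_locus:
  assumes "l \<in> U" shows "negligible (locus l)"
proof -
  have "negligible (locus l - {l})"
  proof (rule negligible_if_flat)
    show "continuous_on (locus l - {l}) (D l)"
      using assms by (intro continuous_intros) (auto simp: locus_def)
    show "D l p \<noteq> 0" if "p \<in> locus l - {l}" for p
      using that assms D_nonzero[of l p] by (auto simp: locus_def)
    show "flat_at (locus l - {l}) p (D l p)" if "p \<in> locus l - {l}" for p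
      using flat_at_subset[OF flat_at_locus[OF assms]] that by (auto simp: locus_def)
  qed
  then have "negligible (insert l (locus l - {l}))" by (simp only: negligible_insert)
  then show ?thesis by (rule negligible_subset) auto
qed

text \<open>
  Where the locus of \<open>r\<close> touches \<open>C\<close>, the gradient \<open>D r p\<close> is a multiple of the normal \<open>\<nu> p\<close>, so moving \<open>p\<close>
  along \<open>C\<close> does not change \<open>H r p\<close> to first order. As \<open>H\<close> vanishes throughout, \<open>r\<close> can only move
  orthogonally to \<open>D p r\<close>, the gradient of \<open>H\<close> with respect to the base state: this is the
  envelope situation.
\<close>

lemma negligible_tangent_base_states:
  assumes C: "C \<subseteq> U" and nu: "\<And>p. p \<in> C \<Longrightarrow> \<nu> p \<noteq> 0" "\<And>p. p \<in> C \<Longrightarrow> flat_at C p (\<nu> p)"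
  shows "negligible {r \<in> U. \<exists>p\<in>C. r \<noteq> p \<and> H r p = 0 \<and> D r p \<bullet> perp (\<nu> p) = 0}"
proof -
  define A where "A = {(r, p). r \<in> U \<and> p \<in> C \<and> r \<noteq> p \<and> H r p = 0 \<and> D r p \<bullet> perp (\<nu> p) = 0}"
  have A: "fst a \<in> U" "snd a \<in> C" "snd a \<in> U" "fst a \<noteq> snd a" "H (fst a) (snd a) = 0"
      "D (fst a) (snd a) \<bullet> perp (\<nu> (snd a)) = 0" if "a \<in> A" for a
    using that C by (auto simp: A_def)
  have "negligible (fst ` A)"
  proof (rule negligible_envelope[where n = "\<lambda>a. D (snd a) (fst a)" and \<nu> = "\<lambda>a. \<nu> (snd a)"])
    show "continuous_on A (\<lambda>a. D (snd a) (fst a))"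
      using A by (intro continuous_intros) auto
    show "D (snd a) (fst a) \<noteq> 0" if "a \<in> A" for a
      using A[OF that] H_sym by (intro D_nonzero) auto
    show "\<nu> (snd a) \<noteq> 0" if "a \<in> A" for a using nu(1) A[OF that] by blast
    fix a and \<epsilon> :: real assume a: "a \<in> A" and e: "0 < \<epsilon>"
    define r p where "r = fst a" and "p = snd a"
    have rp: "r \<in> U" "p \<in> U" "p \<in> C" and par: "D r p \<bullet> perp (\<nu> p) = 0" using A[OF a] by (auto simp: r_def p_def)
    have nz: "\<nu> p \<noteq> 0" using nu(1) rp by blast
    define c where "c = (\<nu> p \<bullet> D r p) / (\<nu> p \<bullet> \<nu> p)"
    have Dc: "D r p = c *\<^sub>R \<nu> p"
    proof -
      have "(\<nu> p \<bullet> \<nu> p) *\<^sub>R D r p = (\<nu> p \<bullet> D r p) *\<^sub>R \<nu> p"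
        using cramer_plane[of "\<nu> p" "perp (\<nu> p)" "D r p"] par
        by (simp add: perp_perp inner_commute[of "perp (\<nu> p)"])
      then have "D r p = (1 / (\<nu> p \<bullet> \<nu> p)) *\<^sub>R ((\<nu> p \<bullet> D r p) *\<^sub>R \<nu> p)"
        using nz by (simp flip: \<open>(\<nu> p \<bullet> \<nu> p) *\<^sub>R D r p = _\<close>)
      then show ?thesis by (simp add: c_def)
    qed
    define \<epsilon>' where "\<epsilon>' = \<epsilon> / (2 * (\<bar>c\<bar> + 1))"
    have e': "\<epsilon>' > 0" "\<bar>c\<bar> * \<epsilon>' \<le> \<epsilon> / 2" "\<epsilon>' \<le> \<epsilon>"
      using e by (auto simp: \<epsilon>'_def divide_simps add_nonneg_pos)
    have "\<exists>\<delta>>0. ball (r, p) \<delta> \<subseteq> U \<times> U \<and> (\<forall>x\<in>ball (r, p) \<delta>. \<forall>y\<in>ball (r, p) \<delta>.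
        \<bar>H (fst x) (snd x) - H (fst y) (snd y) - (D (snd (r, p)) (fst (r, p)), D (fst (r, p)) (snd (r, p))) \<bullet> (x - y)\<bar> \<le> \<epsilon> / 2 * norm (x - y))"
    proof (rule gradient_strict[OF open_Times[OF open_U open_U]])
      show "((\<lambda>z. H (fst z) (snd z)) has_derivative (\<lambda>h. (D (snd z) (fst z), D (fst z) (snd z)) \<bullet> h)) (at z)" if "z \<in> U \<times> U" for z
        using H_deriv[of "fst z" "snd z"] that by auto
      show "continuous_on (U \<times> U) (\<lambda>z. (D (snd z) (fst z), D (fst z) (snd z)))"
        by (intro continuous_intros) auto
    qed (use rp e in auto)
    then obtain d1 where d1: "d1 > 0" "\<forall>x\<in>ball (r, p) d1. \<forall>y\<in>ball (r, p) d1.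
        \<bar>H (fst x) (snd x) - H (fst y) (snd y) - (D p r, D r p) \<bullet> (x - y)\<bar> \<le> \<epsilon> / 2 * norm (x - y)"
      unfolding fst_conv snd_conv by (elim exE conjE)
    obtain d2 where d2: "d2 > 0" "\<forall>x\<in>C \<inter> ball p d2. \<forall>y\<in>C \<inter> ball p d2. \<bar>\<nu> p \<bullet> (x - y)\<bar> \<le> \<epsilon>' * norm (x - y)"
      using nu(2)[OF rp(3), unfolded flat_at_def, rule_format, OF e'(1)] by blast
    define \<delta> where "\<delta> = min d1 d2"
    have "\<bar>D p r \<bullet> (fst x - fst y)\<bar> \<le> \<epsilon> * norm (x - y) \<and> \<bar>\<nu> p \<bullet> (snd x - snd y)\<bar> \<le> \<epsilon> * norm (x - y)"
      if x: "x \<in> A \<inter> ball a \<delta>" and y: "y \<in> A \<inter> ball a \<delta>" for x y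
    proof -
      have a_eq: "a = (r, p)" by (simp add: r_def p_def)
      have "\<bar>(D p r, D r p) \<bullet> (x - y)\<bar> \<le> \<epsilon> / 2 * norm (x - y)"
        using d1(2)[rule_format, of x y] x y A(5) by (simp add: \<delta>_def a_eq)
      then have 1: "\<bar>D p r \<bullet> (fst x - fst y) + D r p \<bullet> (snd x - snd y)\<bar> \<le> \<epsilon> / 2 * norm (x - y)"
        by (simp add: inner_prod_def)
      have "snd x \<in> C \<inter> ball p d2" "snd y \<in> C \<inter> ball p d2"
        using x y A(2) order_le_less_trans[OF dist_snd_le[of a]] by (auto simp: \<delta>_def a_eq)
      then have "\<bar>\<nu> p \<bullet> (snd x - snd y)\<bar> \<le> \<epsilon>' * norm (snd x - snd y)" using d2(2) by blast
      also have "\<dots> \<le> \<epsilon>' * norm (x - y)" using e'(1) dist_snd_le[of x y] by (simp add: dist_norm)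
      finally have 2: "\<bar>\<nu> p \<bullet> (snd x - snd y)\<bar> \<le> \<epsilon>' * norm (x - y)" .
      have "\<bar>D r p \<bullet> (snd x - snd y)\<bar> = \<bar>c\<bar> * \<bar>\<nu> p \<bullet> (snd x - snd y)\<bar>" by (simp add: Dc abs_mult)
      also have "\<dots> \<le> (\<bar>c\<bar> * \<epsilon>') * norm (x - y)" using mult_left_mono[OF 2, of "\<bar>c\<bar>"] by (simp add: mult.assoc)
      also have "\<dots> \<le> \<epsilon> / 2 * norm (x - y)" by (rule mult_right_mono[OF e'(2)]) simp
      finally have "\<bar>D p r \<bullet> (fst x - fst y)\<bar> \<le> \<epsilon> / 2 * norm (x - y) + \<epsilon> / 2 * norm (x - y)" using 1 by linarith
      moreover have "\<epsilon>' * norm (x - y) \<le> \<epsilon> * norm (x - y)" by (rule mult_right_mono[OF e'(3)]) simp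
      ultimately show ?thesis using 2 by simp
    qed
    then show "\<exists>\<delta>>0. \<forall>x\<in>A \<inter> ball a \<delta>. \<forall>y\<in>A \<inter> ball a \<delta>.
        \<bar>D (snd a) (fst a) \<bullet> (fst x - fst y)\<bar> \<le> \<epsilon> * norm (x - y) \<and> \<bar>\<nu> (snd a) \<bullet> (snd x - snd y)\<bar> \<le> \<epsilon> * norm (x - y)"
      unfolding r_def[symmetric] p_def[symmetric] using d1(1) d2(1) by (intro exI[of _ \<delta>]) (auto simp: \<delta>_def)
  qed
  then show ?thesis
    by (rule negligible_subset) (force simp: A_def)
qed

lemma negligible_on_locus: "negligible {(l, r) \<in> U \<times> U. H l r = 0}"
proof (rule negligible_if_slices_negligible)
  have "continuous_on (U \<times> U) (\<lambda>z. H (fst z) (snd z))" by (rule H_cont)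
  from sigma_compact_zero_set[OF open_Times[OF open_U open_U] this]
  have "sigma_compact {z \<in> U \<times> U. H (fst z) (snd z) = 0}" .
  moreover have "{z \<in> U \<times> U. H (fst z) (snd z) = 0} = {(l, r) \<in> U \<times> U. H l r = 0}" by auto
  ultimately show "sigma_compact {(l, r) \<in> U \<times> U. H l r = 0}" by simp
  show "negligible {r. (l, r) \<in> {(l, r) \<in> U \<times> U. H l r = 0}}" for l
  proof (cases "l \<in> U")
    case True
    then show ?thesis using negligible_locus[OF True] by (simp add: locus_def)
  qed simp
qed

lemma negligible_tangent_loci:
  "negligible {(l, r). \<exists>p\<in>U. l \<in> U \<and> r \<in> U \<and> l \<noteq> p \<and> r \<noteq> p \<and> H l p = 0 \<and> H r p = 0 \<and> D r p \<bullet> perp (D l p) = 0}"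
    (is "negligible ?N")
proof (rule negligible_if_slices_negligible)
  define O' where "O' = {((l, r), p). (l \<in> U \<and> r \<in> U \<and> p \<in> U) \<and> l \<noteq> p \<and> r \<noteq> p}"
  have "O' = ((U \<times> U) \<times> U) \<inter> {z. fst (fst z) \<noteq> snd z} \<inter> {z. snd (fst z) \<noteq> snd z}"
    by (auto simp: O'_def)
  then have "open O'"
    by (simp only:) (intro open_Int open_Times open_U open_Collect_neq continuous_intros)
  moreover have "continuous_on O' (\<lambda>z. (H (fst (fst z)) (snd z), H (snd (fst z)) (snd z),
      D (snd (fst z)) (snd z) \<bullet> perp (D (fst (fst z)) (snd z))))"
    unfolding perp_def by (intro continuous_intros) (auto simp: O'_def)
  ultimately have sc: "sigma_compact {z \<in> O'. (H (fst (fst z)) (snd z), H (snd (fst z)) (snd z),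
      D (snd (fst z)) (snd z) \<bullet> perp (D (fst (fst z)) (snd z))) = 0}" (is "sigma_compact ?Z")
    by (rule sigma_compact_zero_set)
  have "sigma_compact (fst ` ?Z)"
    by (rule sigma_compact_image[OF sc]) (intro continuous_intros)
  moreover have "fst ` ?Z = ?N"
    by (force simp: O'_def zero_prod_def image_iff)
  ultimately show "sigma_compact ?N" by simp
  show "negligible {r. (l, r) \<in> ?N}" for l
  proof (cases "l \<in> U")
    case True
    have "negligible {r \<in> U. \<exists>p\<in>locus l - {l}. r \<noteq> p \<and> H r p = 0 \<and> D r p \<bullet> perp (D l p) = 0}"
    proof (rule negligible_tangent_base_states)
      show "locus l - {l} \<subseteq> U" by (auto simp: locus_def)
      show "D l p \<noteq> 0" if "p \<in> locus l - {l}" for p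
        using that True D_nonzero[of l p] by (auto simp: locus_def)
      show "flat_at (locus l - {l}) p (D l p)" if "p \<in> locus l - {l}" for p
        using flat_at_subset[OF flat_at_locus[OF True]] that by (auto simp: locus_def)
    qed
    then show ?thesis by (rule negligible_subset) (auto simp: locus_def)
  qed simp
qed

text \<open>
  For fixed \<open>b\<close> the points reached from \<open>b\<close> on either side form a flat set, to which the previous lemma
  applies; the slices over \<open>b\<close> are null. The second set consists of the pairs for which the base
  state of the locus, where the locus is singular, lies on the integral curve.
\<close>

lemma negligible_tangent_reach:
  assumes K: "compact K" "K \<subseteq> U" and L: "L-lipschitz_on K X" and X: "continuous_on U X"
  shows "negligible {(a, b). \<exists>p. (a, p) \<in> {(a, p). a \<in> U \<and> p \<in> U \<and> a \<noteq> p \<and> H a p = 0 \<and> D a p \<bullet> perp (- X p, 1) = 0}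
            \<and> (b, p) \<in> reach K X}" (is "negligible {(a, b). \<exists>p. (a, p) \<in> ?Z \<and> _}")
    and "negligible {(a, b). (b, a) \<in> reach K X}"
proof -
  have XK: "continuous_on K X" using X K(2) by (rule continuous_on_subset)
  define T where "T \<sigma> = reach K X \<inter> {z. 0 \<le> \<sigma> * (fst (snd z) - fst (fst z))}" for \<sigma> :: real
  have T: "compact (T \<sigma>)" for \<sigma>
    unfolding T_def by (intro compact_Int_closed compact_reach[OF K(1) XK] closed_Collect_le continuous_intros)
  have TU: "reach K X = T 1 \<union> T (- 1)" unfolding T_def by auto
  let ?C = "\<lambda>\<sigma> b. {p. (b, p) \<in> T \<sigma>}"
  have CU: "?C \<sigma> b \<subseteq> U" for \<sigma> b using reach_endpoints(2) K(2) unfolding T_def by blast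
  have flat: "flat_at (?C \<sigma> b) p (- X p, 1)" if "\<bar>\<sigma>\<bar> = 1" "p \<in> ?C \<sigma> b" for \<sigma> b p
    by (rule flat_at_subset[OF reach_flat[OF K(1) L, of b p \<sigma>]]) (use that in \<open>auto simp: T_def\<close>)
  define O' where "O' = (U \<times> U) \<inter> {z. fst z \<noteq> snd z}"
  have "open O'" unfolding O'_def
    by (intro open_Int open_Times open_U open_Collect_neq continuous_intros)
  moreover have "continuous_on O' (\<lambda>z. (H (fst z) (snd z), D (fst z) (snd z) \<bullet> perp (- X (snd z), 1)))"
    unfolding perp_def by (intro continuous_intros continuous_on_compose2[OF X]) (auto simp: O'_def)
  ultimately have "sigma_compact {z \<in> O'. (H (fst z) (snd z), D (fst z) (snd z) \<bullet> perp (- X (snd z), 1)) = 0}"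
    by (rule sigma_compact_zero_set)
  moreover have "{z \<in> O'. (H (fst z) (snd z), D (fst z) (snd z) \<bullet> perp (- X (snd z), 1)) = 0} = ?Z"
    by (auto simp: O'_def zero_prod_def)
  ultimately have Z: "sigma_compact ?Z" by simp
  have side: "negligible {(a, b). \<exists>p. (a, p) \<in> ?Z \<and> (b, p) \<in> T \<sigma>}" if \<sigma>: "\<bar>\<sigma>\<bar> = 1" for \<sigma>
  proof (rule negligible_if_swapped_slices_negligible)
    show "sigma_compact {(a, b). \<exists>p. (a, p) \<in> ?Z \<and> (b, p) \<in> T \<sigma>}"
      by (rule sigma_compact_compose[OF Z T])
    show "negligible {a. (a, b) \<in> {(a, b). \<exists>p. (a, p) \<in> ?Z \<and> (b, p) \<in> T \<sigma>}}" for b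
      by (rule negligible_subset[OF negligible_tangent_base_states[of "?C \<sigma> b" "\<lambda>p. (- X p, 1)"]])
         (use CU flat[OF \<sigma>] in \<open>auto simp: zero_prod_def\<close>)
  qed
  have "negligible ({(a, b). \<exists>p. (a, p) \<in> ?Z \<and> (b, p) \<in> T 1} \<union> {(a, b). \<exists>p. (a, p) \<in> ?Z \<and> (b, p) \<in> T (- 1)})"
    by (intro negligible_Un side) auto
  then show "negligible {(a, b). \<exists>p. (a, p) \<in> ?Z \<and> (b, p) \<in> reach K X}"
    by (rule negligible_subset) (auto simp: TU)
  have side: "negligible {(a, b). (b, a) \<in> T \<sigma>}" if \<sigma>: "\<bar>\<sigma>\<bar> = 1" for \<sigma>
  proof (rule negligible_if_swapped_slices_negligible)
    have "sigma_compact (prod.swap ` T \<sigma>)"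
      by (intro compact_imp_sigma_compact compact_continuous_image T) (auto simp: prod.swap_def intro!: continuous_intros)
    moreover have "prod.swap ` T \<sigma> = {(a, b). (b, a) \<in> T \<sigma>}" by force
    ultimately show "sigma_compact {(a, b). (b, a) \<in> T \<sigma>}" by simp
    have "continuous_on (?C \<sigma> b) (\<lambda>p. (- X p, 1))" for b
      by (intro continuous_intros continuous_on_subset[OF X CU])
    then have "negligible (?C \<sigma> b)" for b
      by (rule negligible_if_flat) (use flat[OF \<sigma>] in \<open>auto simp: zero_prod_def\<close>)
    then show "negligible {a. (a, b) \<in> {(a, b). (b, a) \<in> T \<sigma>}}" for b by simp
  qed
  have "negligible ({(a, b). (b, a) \<in> T 1} \<union> {(a, b). (b, a) \<in> T (- 1)})"
    by (intro negligible_Un side) auto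
  then show "negligible {(a, b). (b, a) \<in> reach K X}"
    by (rule negligible_subset) (auto simp: TU)
qed

text \<open>
  An exhaustion of \<open>U\<close> by compact sets produces one null set that serves all \<open>K\<close>.
\<close>

lemma generic_locus_trajectory:
  assumes X: "lipschitz_on_compacts U X"
  shows "\<exists>N. negligible N \<and> (\<forall>a b K. (a, b) \<notin> N \<and> compact K \<and> K \<subseteq> U \<longrightarrow>
     (b, a) \<notin> reach K X \<and>
     (\<forall>p. (b, p) \<in> reach K X \<and> a \<in> U \<and> a \<noteq> p \<and> H a p = 0 \<longrightarrow> D a p \<bullet> perp (- X p, 1) \<noteq> 0))"
proof -
  obtain C :: "nat \<Rightarrow> (real \<times> real) set" where
    "(\<forall>n. compact (C n) \<and> C n \<subseteq> U) \<and> (\<forall>K. compact K \<and> K \<subseteq> U \<longrightarrow> (\<exists>n. K \<subseteq> C n))"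
    using compact_exhaustion[OF open_U] ..
  then have C: "\<And>n. compact (C n)" "\<And>n. C n \<subseteq> U" and exh: "\<And>K. \<lbrakk>compact K; K \<subseteq> U\<rbrakk> \<Longrightarrow> \<exists>n. K \<subseteq> C n"
    by auto
  have Xc: "continuous_on U X" by (rule lipschitz_on_compacts_imp_continuous_on[OF open_U X])
  define N1 where "N1 n = {(a, b). \<exists>p. (a, p) \<in> {(a, p). a \<in> U \<and> p \<in> U \<and> a \<noteq> p \<and> H a p = 0 \<and> D a p \<bullet> perp (- X p, 1) = 0}
            \<and> (b, p) \<in> reach (C n) X}" for n
  define N2 where "N2 n = {(a, b). (b, a) \<in> reach (C n) X}" for n
  have "negligible (N1 n)" "negligible (N2 n)" for n
  proof -
    obtain L where L: "L-lipschitz_on (C n) X" using X C unfolding lipschitz_on_compacts_def by blast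
    show "negligible (N1 n)" "negligible (N2 n)"
      unfolding N1_def N2_def by (rule negligible_tangent_reach[OF C(1) C(2) L Xc])+
  qed
  then have "negligible (\<Union>n. N1 n \<union> N2 n)"
    by (intro negligible_countable_Union) (auto intro: negligible_Un)
  moreover have "(b, a) \<notin> reach K X \<and>
     (\<forall>p. (b, p) \<in> reach K X \<and> a \<in> U \<and> a \<noteq> p \<and> H a p = 0 \<longrightarrow> D a p \<bullet> perp (- X p, 1) \<noteq> 0)"
    if ab: "(a, b) \<notin> (\<Union>n. N1 n \<union> N2 n)" and K: "compact K" "K \<subseteq> U" for a b K
  proof -
    obtain n where n: "K \<subseteq> C n" using exh[OF K] by blast
    have r: "reach K X \<subseteq> reach (C n) X" by (rule reach_mono[OF n])
    have pU: "p \<in> U" if "(b, p) \<in> reach K X" for p using reach_endpoints[OF that] K by blast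
    have "(a, b) \<notin> N1 n" "(a, b) \<notin> N2 n" using ab by auto
    then have "(b, a) \<notin> reach (C n) X" and
      "\<And>p. \<lbrakk>a \<in> U; p \<in> U; a \<noteq> p; H a p = 0; (b, p) \<in> reach (C n) X\<rbrakk> \<Longrightarrow> D a p \<bullet> perp (- X p, 1) \<noteq> 0"
      unfolding N1_def N2_def by blast+
    then show ?thesis using r pU by blast
  qed
  ultimately show ?thesis by (intro exI[of _ "\<Union>n. N1 n \<union> N2 n"]) auto
qed

text \<open>
  The exceptional set excludes tangencies of two loci and of a locus with an integral curve, pairs with
  one state on the locus of the other, and pairs with the base state of a locus on the integral
  curve of the other state. The role of the base state is played by \<open>l\<close> for \<open>X2\<close> and by \<open>r\<close> for \<open>X1\<close>, which is
  why one of the sets has its coordinates interchanged.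
\<close>

theorem generic_transversality:
  assumes X1: "lipschitz_on_compacts U X1" and X2: "lipschitz_on_compacts U X2"
    and ne: "\<And>p. p \<in> U \<Longrightarrow> X1 p \<noteq> X2 p"
  shows "\<exists>N. N \<subseteq> U \<times> U \<and> negligible N \<and> (\<forall>(l, r) \<in> U \<times> U - N.
    (\<forall>Wl \<in> {locus l, trajectory U X1 l}. \<forall>Wr \<in> {locus r, trajectory U X2 r}.
       \<forall>p \<in> Wl \<inter> Wr - {l, r}. p isolated_in (Wl \<inter> Wr - {l, r}) \<and> transversal_at p Wl Wr) \<and>
    (\<forall>K. compact K \<and> K \<subseteq> U \<longrightarrow>
       (\<forall>Wl \<in> {locus l \<inter> K, {p. (l, p) \<in> reach K X1}}. \<forall>Wr \<in> {locus r \<inter> K, {p. (r, p) \<in> reach K X2}}.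
          finite (Wl \<inter> Wr))))"
proof -
  obtain N1 where N1: "negligible N1" and "\<forall>a b K. (a, b) \<notin> N1 \<and> compact K \<and> K \<subseteq> U \<longrightarrow>
     (b, a) \<notin> reach K X1 \<and>
     (\<forall>p. (b, p) \<in> reach K X1 \<and> a \<in> U \<and> a \<noteq> p \<and> H a p = 0 \<longrightarrow> D a p \<bullet> perp (- X1 p, 1) \<noteq> 0)"
    using generic_locus_trajectory[OF X1] by blast
  then have g1: "(b, a) \<notin> reach K X1 \<and>
     (\<forall>p. (b, p) \<in> reach K X1 \<and> a \<in> U \<and> a \<noteq> p \<and> H a p = 0 \<longrightarrow> D a p \<bullet> perp (- X1 p, 1) \<noteq> 0)"
    if "(a, b) \<notin> N1" "compact K" "K \<subseteq> U" for a b K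
    using that by presburger
  obtain N2 where N2: "negligible N2" and "\<forall>a b K. (a, b) \<notin> N2 \<and> compact K \<and> K \<subseteq> U \<longrightarrow>
     (b, a) \<notin> reach K X2 \<and>
     (\<forall>p. (b, p) \<in> reach K X2 \<and> a \<in> U \<and> a \<noteq> p \<and> H a p = 0 \<longrightarrow> D a p \<bullet> perp (- X2 p, 1) \<noteq> 0)"
    using generic_locus_trajectory[OF X2] by blast
  then have g2: "(b, a) \<notin> reach K X2 \<and>
     (\<forall>p. (b, p) \<in> reach K X2 \<and> a \<in> U \<and> a \<noteq> p \<and> H a p = 0 \<longrightarrow> D a p \<bullet> perp (- X2 p, 1) \<noteq> 0)"
    if "(a, b) \<notin> N2" "compact K" "K \<subseteq> U" for a b K
    using that by presburger
  define N3 where "N3 = {(l, r) \<in> U \<times> U. H l r = 0}"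
  define N4 where "N4 = {(l, r). \<exists>p\<in>U. l \<in> U \<and> r \<in> U \<and> l \<noteq> p \<and> r \<noteq> p \<and> H l p = 0 \<and> H r p = 0 \<and> D r p \<bullet> perp (D l p) = 0}"
  define N where "N = (U \<times> U) \<inter> (prod.swap ` N1 \<union> N2 \<union> N3 \<union> N4)"
  have "negligible (prod.swap ` N1 \<union> N2 \<union> N3 \<union> N4)"
    using negligible_on_locus negligible_tangent_loci N2 negligible_prod_swap[OF N1]
    by (auto simp: N3_def N4_def intro: negligible_Un)
  then have negN: "negligible N" unfolding N_def by (rule negligible_subset) auto
  have skew: "\<nu> \<bullet> perp \<mu> = - (\<mu> \<bullet> perp \<nu>)" for \<nu> \<mu> :: "real \<times> real"
    by (simp add: perp_def inner_prod_def)
  have good: "(\<forall>Wl \<in> {locus l, trajectory U X1 l}. \<forall>Wr \<in> {locus r, trajectory U X2 r}.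
       \<forall>p \<in> Wl \<inter> Wr - {l, r}. p isolated_in (Wl \<inter> Wr - {l, r}) \<and> transversal_at p Wl Wr) \<and>
    (\<forall>K. compact K \<and> K \<subseteq> U \<longrightarrow>
       (\<forall>Wl \<in> {locus l \<inter> K, {p. (l, p) \<in> reach K X1}}. \<forall>Wr \<in> {locus r \<inter> K, {p. (r, p) \<in> reach K X2}}.
          finite (Wl \<inter> Wr)))"
    if lr: "(l, r) \<in> U \<times> U - N" for l r
  proof -
    have lU: "l \<in> U" and rU: "r \<in> U" using lr by auto
    have nN1: "(r, l) \<notin> N1" and nN2: "(l, r) \<notin> N2" and nN3: "(l, r) \<notin> N3" and nN4: "(l, r) \<notin> N4"
      using lr by (auto simp: N_def image_iff)
    have Hlr: "H l r \<noteq> 0" using nN3 lU rU by (auto simp: N3_def)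
    have notin: "l \<notin> locus r" "r \<notin> locus l" using Hlr H_sym[of l r] by (auto simp: locus_def)
    have HH: "D l p \<bullet> perp (D r p) \<noteq> 0" if "p \<in> locus l" "p \<in> locus r" for p
    proof -
      have "p \<noteq> l" "p \<noteq> r" using that notin by auto
      then show ?thesis
        using that nN4 lU rU skew[of "D l p" "D r p"] unfolding N4_def locus_def by force
    qed
    have HR: "D l p \<bullet> perp (- X2 p, 1) \<noteq> 0" "p \<noteq> l"
      if "p \<in> locus l" "(r, p) \<in> reach K X2" "compact K" "K \<subseteq> U" for p K
      using g2[OF nN2 that(3,4)] that lU unfolding locus_def by blast+
    have RH: "(- X1 p, 1) \<bullet> perp (D r p) \<noteq> 0" "p \<noteq> r"
      if "p \<in> locus r" "(l, p) \<in> reach K X1" "compact K" "K \<subseteq> U" for p K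
    proof -
      show "p \<noteq> r" using g1[OF nN1 that(3,4)] that by blast
      have "D r p \<bullet> perp (- X1 p, 1) \<noteq> 0"
        using g1[OF nN1 that(3,4)] that rU unfolding locus_def by blast
      then show "(- X1 p, 1) \<bullet> perp (D r p) \<noteq> 0" using skew[of "(- X1 p, 1)" "D r p"] by simp
    qed
    have RR: "(- X1 p, 1) \<bullet> perp (- X2 p, 1) \<noteq> 0" if "p \<in> U" for p
      using ne[OF that] by (simp add: perp_def)
    have smT: "smooth_at (trajectory U X g) p (- X p, 1)"
      if "lipschitz_on_compacts U X" "p \<in> trajectory U X g" for X p g
    proof -
      have "perp (- X p, 1) = (- 1) *\<^sub>R (1, X p)" by (simp add: perp_def)
      then show ?thesis
        unfolding smooth_at_def using normal_at_trajectory[OF that] tangent_space_scaleR[OF tangent_space_trajectory[OF open_U that], of "- 1"] by simp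
    qed
    have part1: "\<forall>Wl \<in> {locus l, trajectory U X1 l}. \<forall>Wr \<in> {locus r, trajectory U X2 r}.
       \<forall>p \<in> Wl \<inter> Wr - {l, r}. p isolated_in (Wl \<inter> Wr - {l, r}) \<and> transversal_at p Wl Wr"
    proof (intro ballI)
      fix Wl Wr p
      assume Wl: "Wl \<in> {locus l, trajectory U X1 l}" and Wr: "Wr \<in> {locus r, trajectory U X2 r}"
        and p: "p \<in> Wl \<inter> Wr - {l, r}"
      consider "Wl = locus l" "Wr = locus r" | "Wl = locus l" "Wr = trajectory U X2 r"
        | "Wl = trajectory U X1 l" "Wr = locus r" | "Wl = trajectory U X1 l" "Wr = trajectory U X2 r"
        using Wl Wr by blast
      then show "p isolated_in (Wl \<inter> Wr - {l, r}) \<and> transversal_at p Wl Wr"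
      proof cases
        case 1
        show ?thesis
          using p unfolding 1
          by (intro smooth_transversal[OF smooth_at_locus[OF lU] smooth_at_locus[OF rU]] HH) auto
      next
        case 2
        obtain K where "compact K" "K \<subseteq> U" "(r, p) \<in> reach K X2"
          using trajectory_reach[OF X2, of p r] p 2 by blast
        then have "D l p \<bullet> perp (- X2 p, 1) \<noteq> 0" using p 2 HR(1)[of p K] by blast
        then show ?thesis
          using p unfolding 2 by (intro smooth_transversal[OF smooth_at_locus[OF lU] smT[OF X2]]) auto
      next
        case 3
        obtain K where "compact K" "K \<subseteq> U" "(l, p) \<in> reach K X1"
          using trajectory_reach[OF X1, of p l] p 3 by blast
        then have "(- X1 p, 1) \<bullet> perp (D r p) \<noteq> 0" using p 3 RH(1)[of p K] by blast
        then show ?thesis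
          using p unfolding 3 by (intro smooth_transversal[OF smT[OF X1] smooth_at_locus[OF rU]]) auto
      next
        case 4
        have "p \<in> U" using p 4 trajectory_subset by blast
        then show ?thesis
          using p RR[of p] unfolding 4 by (intro smooth_transversal[OF smT[OF X1] smT[OF X2]]) auto
      qed
    qed
    have part2: "finite (Wl \<inter> Wr)"
      if K: "compact K" "K \<subseteq> U" and Wl: "Wl \<in> {locus l \<inter> K, {p. (l, p) \<in> reach K X1}}"
        and Wr: "Wr \<in> {locus r \<inter> K, {p. (r, p) \<in> reach K X2}}" for K Wl Wr
    proof (rule finite_if_compact_no_islimpt)
      obtain L1 where L1: "L1-lipschitz_on K X1" using X1 K unfolding lipschitz_on_compacts_def by blast
      obtain L2 where L2: "L2-lipschitz_on K X2" using X2 K unfolding lipschitz_on_compacts_def by blast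
      have cR: "compact {p. (l, p) \<in> reach K X1}" "compact {p. (r, p) \<in> reach K X2}"
        using L1 L2 K by (auto intro: compact_reach_slice lipschitz_on_continuous_on)
      show "compact (Wl \<inter> Wr)"
        using Wl Wr cR compact_locus[OF lU K] compact_locus[OF rU K] by (auto intro: compact_Int)
      fix q assume q: "q \<in> Wl \<inter> Wr"
      have nl: "normal_at (locus g \<inter> K) q (D g q)" if "g \<in> U" "q \<in> locus g" for g
        by (rule normal_at_subset[OF flat_at_imp_normal_at[OF flat_at_locus]]) (use that in \<open>auto simp: locus_def\<close>)
      have qU: "q \<in> U" using q Wl K reach_endpoints by blast
      consider "Wl = locus l \<inter> K" "Wr = locus r \<inter> K" | "Wl = locus l \<inter> K" "Wr = {p. (r, p) \<in> reach K X2}"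
        | "Wl = {p. (l, p) \<in> reach K X1}" "Wr = locus r \<inter> K" | "Wl = {p. (l, p) \<in> reach K X1}" "Wr = {p. (r, p) \<in> reach K X2}"
        using Wl Wr by blast
      then show "\<not> q islimpt (Wl \<inter> Wr)"
      proof cases
        case 1
        show ?thesis unfolding 1
          by (rule not_islimpt_Int_if_normals_independent[OF nl[OF lU] nl[OF rU] HH]) (use q 1 in auto)
      next
        case 2
        show ?thesis unfolding 2
          by (rule not_islimpt_Int_if_normals_independent[OF nl[OF lU] normal_at_reach[OF K(1) L2] HR(1)[OF _ _ K]]) (use q 2 in auto)
      next
        case 3
        show ?thesis unfolding 3
          by (rule not_islimpt_Int_if_normals_independent[OF normal_at_reach[OF K(1) L1] nl[OF rU] RH(1)[OF _ _ K]]) (use q 3 in auto)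
      next
        case 4
        show ?thesis unfolding 4
          by (rule not_islimpt_Int_if_normals_independent[OF normal_at_reach[OF K(1) L1] normal_at_reach[OF K(1) L2] RR[OF qU]]) (use q 4 in auto)
      qed
    qed
    show ?thesis using part1 part2 by blast
  qed
  have "N \<subseteq> U \<times> U" by (auto simp: N_def)
  show ?thesis
    by (rule exI[of _ N], rule conjI, fact, rule conjI, rule negN, rule ballI, rule case_prodI2, rule good, simp only:)
qed

end

section \<open>Characteristic speeds and slopes\<close>

text \<open>
  The local Lipschitz constants are combined by compactness; \<open>K\<close> may have any shape, so the mean value
  theorem cannot be applied on \<open>K\<close> itself.
\<close>

lemma C1_imp_lipschitz_on_compact:
  fixes f :: "'a::{real_inner, heine_borel} \<Rightarrow> real"
  assumes O': "open O'" and der: "\<And>z. z \<in> O' \<Longrightarrow> (f has_derivative (\<lambda>h. g z \<bullet> h)) (at z)"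
    and cont: "continuous_on O' g" and K: "compact K" "K \<subseteq> O'"
  obtains L where "L-lipschitz_on K f"
proof -
  have "\<exists>u>0. \<exists>L. L-lipschitz_on (cball a u \<inter> K) f" if a: "a \<in> K" for a
  proof -
    obtain \<delta> where \<delta>: "\<delta> > 0" "\<forall>x\<in>ball a \<delta>. \<forall>y\<in>ball a \<delta>. \<bar>f x - f y - g a \<bullet> (x - y)\<bar> \<le> 1 * norm (x - y)"
      using gradient_strict[OF O' der cont, of a 1] a K(2) by auto
    have "(norm (g a) + 1)-lipschitz_on (cball a (\<delta>/2) \<inter> K) f"
    proof (rule lipschitz_onI)
      fix x y assume "x \<in> cball a (\<delta>/2) \<inter> K" "y \<in> cball a (\<delta>/2) \<inter> K"
      then have "x \<in> ball a \<delta>" "y \<in> ball a \<delta>" using \<delta>(1) by auto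
      then have "\<bar>f x - f y - g a \<bullet> (x - y)\<bar> \<le> norm (x - y)" using \<delta>(2) by auto
      moreover have "\<bar>g a \<bullet> (x - y)\<bar> \<le> norm (g a) * norm (x - y)" by (rule Cauchy_Schwarz_ineq2)
      ultimately show "dist (f x) (f y) \<le> (norm (g a) + 1) * dist x y"
        by (simp add: dist_norm algebra_simps)
    qed simp
    then show ?thesis using \<delta>(1) half_gt_zero by blast
  qed
  then have ll: "local_lipschitz {0::real} K (\<lambda>_. f)"
    unfolding local_lipschitz_def by fastforce
  then show ?thesis
    using local_lipschitz_compact_implies_lipschitz[OF ll K(1) compact_sing continuous_on_const] that by blast
qed

lemma lipschitz_on_compacts_C1:
  assumes "open U" "\<And>z. z \<in> U \<Longrightarrow> (f has_derivative (\<lambda>h. g z \<bullet> h)) (at z)" "continuous_on U g"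
  shows "lipschitz_on_compacts U f"
  unfolding lipschitz_on_compacts_def
  using C1_imp_lipschitz_on_compact[OF assms] by metis

lemma lipschitz_on_compacts_compose:
  fixes \<phi> \<phi>' :: "real \<Rightarrow> real"
  assumes f: "lipschitz_on_compacts U f" and S: "open S" "\<And>x. x \<in> S \<Longrightarrow> (\<phi> has_real_derivative \<phi>' x) (at x)"
    "continuous_on S \<phi>'" "\<And>p. p \<in> U \<Longrightarrow> f p \<in> S"
  shows "lipschitz_on_compacts U (\<lambda>p. \<phi> (f p))"
  unfolding lipschitz_on_compacts_def
proof (intro allI impI)
  fix K assume K: "compact K \<and> K \<subseteq> U"
  obtain L where L: "L-lipschitz_on K f" using f K unfolding lipschitz_on_compacts_def by blast
  have "compact (f ` K)" using K lipschitz_on_continuous_on[OF L] by (intro compact_continuous_image) auto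
  moreover have "f ` K \<subseteq> S" using K S(4) by auto
  moreover have "(\<phi> has_derivative (\<lambda>h. \<phi>' x \<bullet> h)) (at x)" if "x \<in> S" for x
    using S(2)[OF that] by (simp add: has_field_derivative_def inner_real_def[abs_def])
  ultimately obtain M where "M-lipschitz_on (f ` K) \<phi>"
    using C1_imp_lipschitz_on_compact[OF S(1) _ S(3), of \<phi> "f ` K"] by metis
  then show "\<exists>L. L-lipschitz_on K (\<lambda>p. \<phi> (f p))"
    using lipschitz_on_compose2[OF L] by blast
qed

lemma lipschitz_on_compacts_add:
  assumes "lipschitz_on_compacts U f" "lipschitz_on_compacts U g"
  shows "lipschitz_on_compacts U (\<lambda>p. f p + g p)"
  using assms lipschitz_on_add unfolding lipschitz_on_compacts_def by metis

lemma lipschitz_on_compacts_minus: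
  assumes "lipschitz_on_compacts U f"
  shows "lipschitz_on_compacts U (\<lambda>p. - f p)"
  using assms lipschitz_on_minus unfolding lipschitz_on_compacts_def by metis

lemma lipschitz_on_compacts_const: "lipschitz_on_compacts U (\<lambda>p. c)"
  using lipschitz_on_constant unfolding lipschitz_on_compacts_def by blast

lemma lipschitz_on_compacts_mult:
  assumes f: "lipschitz_on_compacts U f" and g: "lipschitz_on_compacts U g"
  shows "lipschitz_on_compacts U (\<lambda>p. f p * g p)"
  unfolding lipschitz_on_compacts_def
proof (intro allI impI)
  fix K assume K: "compact K \<and> K \<subseteq> U"
  obtain L where L: "L-lipschitz_on K f" using f K unfolding lipschitz_on_compacts_def by blast
  obtain M where M: "M-lipschitz_on K g" using g K unfolding lipschitz_on_compacts_def by blast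
  have bd: "\<exists>B\<ge>0. \<forall>p\<in>K. \<bar>h p\<bar> \<le> B" if "C-lipschitz_on K h" for h :: "real \<times> real \<Rightarrow> real" and C
  proof -
    have "bounded (h ` K)"
      using K lipschitz_on_continuous_on[OF that] by (intro compact_imp_bounded compact_continuous_image) auto
    then obtain B where "B > 0" "\<forall>y\<in>h ` K. norm y \<le> B" unfolding bounded_pos by blast
    then show ?thesis by (intro exI[of _ B]) auto
  qed
  obtain A where A: "A \<ge> 0" "\<forall>p\<in>K. \<bar>f p\<bar> \<le> A" using bd[OF L] by blast
  obtain B where B: "B \<ge> 0" "\<forall>p\<in>K. \<bar>g p\<bar> \<le> B" using bd[OF M] by blast
  have "(A * M + B * L)-lipschitz_on K (\<lambda>p. f p * g p)"
  proof (rule lipschitz_onI)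
    fix x y assume x: "x \<in> K" and y: "y \<in> K"
    have "\<bar>f x * g x - f y * g y\<bar> = \<bar>f x * (g x - g y) + g y * (f x - f y)\<bar>" by (simp add: algebra_simps)
    also have "\<dots> \<le> \<bar>f x\<bar> * \<bar>g x - g y\<bar> + \<bar>g y\<bar> * \<bar>f x - f y\<bar>"
      by (rule order_trans[OF abs_triangle_ineq]) (simp add: abs_mult)
    also have "\<dots> \<le> A * (M * dist x y) + B * (L * dist x y)"
      using lipschitz_onD[OF L x y] lipschitz_onD[OF M x y] A B x y
      by (intro add_mono mult_mono) (auto simp: dist_real_def)
    finally show "dist (f x * g x) (f y * g y) \<le> (A * M + B * L) * dist x y"
      by (simp add: dist_real_def algebra_simps)
  qed (use A B lipschitz_on_nonneg[OF L] lipschitz_on_nonneg[OF M] in auto)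
  then show "\<exists>L. L-lipschitz_on K (\<lambda>p. f p * g p)" by blast
qed

lemma lipschitz_on_compacts_cong:
  assumes "lipschitz_on_compacts U f" "\<And>p. p \<in> U \<Longrightarrow> f p = g p"
  shows "lipschitz_on_compacts U g"
  unfolding lipschitz_on_compacts_def
proof (intro allI impI)
  fix K assume K: "compact K \<and> K \<subseteq> U"
  then obtain L where "L-lipschitz_on K f" using assms(1) unfolding lipschitz_on_compacts_def by blast
  moreover have "L-lipschitz_on K f = L-lipschitz_on K g"
    by (rule lipschitz_on_cong) (use K assms(2) in auto)
  ultimately show "\<exists>L. L-lipschitz_on K g" by blast
qed

lemma has_derivative_du_dv:
  assumes "f differentiable (at p)"
  shows "(f has_derivative (\<lambda>h. (du f p, dv f p) \<bullet> h)) (at p)"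
proof -
  obtain L where L: "(f has_derivative L) (at p)" using assms unfolding differentiable_def by blast
  have lin: "linear L" using has_derivative_linear[OF L] .
  obtain a b where p: "p = (a, b)" by (cases p)
  have "((\<lambda>x. (x, b)) has_derivative (\<lambda>h. (h, 0))) (at a)"
    by (auto intro!: derivative_eq_intros)
  from diff_chain_at[OF this] L have "((\<lambda>x. f (x, b)) has_derivative (\<lambda>h. L (h, 0))) (at a)"
    by (auto simp: p o_def)
  moreover have "(\<lambda>h. L (h, 0)) = (*) (L (1, 0))"
  proof
    show "L (h, 0) = L (1, 0) * h" for h using linear_scale[OF lin, of h "(1, 0)"] by simp
  qed
  ultimately have "((\<lambda>x. f (x, b)) has_real_derivative L (1, 0)) (at a)"
    by (simp only: has_field_derivative_def)
  then have du: "du f p = L (1, 0)" by (simp add: du_def p DERIV_imp_deriv)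
  have "((\<lambda>y. (a, y)) has_derivative (\<lambda>h. (0, h))) (at b)"
    by (auto intro!: derivative_eq_intros)
  from diff_chain_at[OF this] L have "((\<lambda>y. f (a, y)) has_derivative (\<lambda>h. L (0, h))) (at b)"
    by (auto simp: p o_def)
  moreover have "(\<lambda>h. L (0, h)) = (*) (L (0, 1))"
  proof
    show "L (0, h) = L (0, 1) * h" for h using linear_scale[OF lin, of h "(0, 1)"] by simp
  qed
  ultimately have "((\<lambda>y. f (a, y)) has_real_derivative L (0, 1)) (at b)"
    by (simp only: has_field_derivative_def)
  then have dv: "dv f p = L (0, 1)" by (simp add: dv_def p DERIV_imp_deriv)
  have "L h = (du f p, dv f p) \<bullet> h" for h
  proof -
    have "L h = L (fst h *\<^sub>R (1, 0) + snd h *\<^sub>R (0, 1))" by simp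
    also have "\<dots> = (du f p, dv f p) \<bullet> h"
      unfolding linear_add[OF lin] linear_scale[OF lin] by (simp add: du dv inner_prod_def mult.commute)
    finally show ?thesis .
  qed
  then have "L = (\<lambda>h. (du f p, dv f p) \<bullet> h)" by auto
  then show ?thesis using L by simp
qed

lemma C1_onD:
  assumes "open U" "C1_on U f"
  shows "p \<in> U \<Longrightarrow> (f has_derivative (\<lambda>h. (du f p, dv f p) \<bullet> h)) (at p)"
    and "continuous_on U f" "continuous_on U (du f)" "continuous_on U (dv f)"
    and "lipschitz_on_compacts U f"
proof -
  have diff: "f differentiable_on U" and c: "continuous_on U (du f)" "continuous_on U (dv f)"
    using assms(2) unfolding C1_on_def by auto
  show d: "(f has_derivative (\<lambda>h. (du f p, dv f p) \<bullet> h)) (at p)" if "p \<in> U" for p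
    using has_derivative_du_dv diff that assms(1) by (simp add: differentiable_on_eq_differentiable_at)
  show "continuous_on U f" using diff by (rule differentiable_imp_continuous_on)
  show "continuous_on U (du f)" "continuous_on U (dv f)" by fact+
  show "lipschitz_on_compacts U f"
    by (rule lipschitz_on_compacts_C1[OF assms(1), of f "\<lambda>z. (du f z, dv f z)"], erule d, intro continuous_intros c)
qed

lemma eigenvalues_2x2:
  "eigenvalues (vector [vector [a, b], vector [c, d]] :: real ^ 2 ^ 2) = {\<mu>. (a - \<mu>) * (d - \<mu>) = b * c}"
    (is "eigenvalues ?A = _")
proof -
  have ev: "right_eigenvector ?A \<mu> r \<longleftrightarrow>
      (r $ 1 \<noteq> 0 \<or> r $ 2 \<noteq> 0) \<and> a * r $ 1 + b * r $ 2 = \<mu> * r $ 1 \<and> c * r $ 1 + d * r $ 2 = \<mu> * r $ 2" for \<mu> and r :: "real ^ 2"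
    by (simp add: right_eigenvector_def vec_eq_iff forall_2 matrix_vector_mult_def UNIV_2)
  have "(\<exists>r. right_eigenvector ?A \<mu> r) \<longleftrightarrow> (a - \<mu>) * (d - \<mu>) = b * c" for \<mu>
  proof
    assume "\<exists>r. right_eigenvector ?A \<mu> r"
    then obtain r :: "real ^ 2" where nz: "r $ 1 \<noteq> 0 \<or> r $ 2 \<noteq> 0"
      and e: "a * r $ 1 + b * r $ 2 = \<mu> * r $ 1" "c * r $ 1 + d * r $ 2 = \<mu> * r $ 2"
      unfolding ev by blast
    have "((a - \<mu>) * (d - \<mu>) - b * c) * r $ 1 = 0" "((a - \<mu>) * (d - \<mu>) - b * c) * r $ 2 = 0"
      using e by algebra+
    then show "(a - \<mu>) * (d - \<mu>) = b * c" using nz by auto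
  next
    assume det: "(a - \<mu>) * (d - \<mu>) = b * c"
    \<comment> \<open>Each row of the singular matrix, turned by a right angle, is an eigenvector unless it vanishes.\<close>
    consider "b \<noteq> 0 \<or> \<mu> \<noteq> a" | "c \<noteq> 0 \<or> \<mu> \<noteq> d" | "b = 0" "c = 0" "\<mu> = a" "\<mu> = d" by blast
    then show "\<exists>r. right_eigenvector ?A \<mu> r"
    proof cases
      case 1
      then show ?thesis unfolding ev using det
        by (intro exI[of _ "vector [b, \<mu> - a]"]) (auto simp: algebra_simps)
    next
      case 2
      then show ?thesis unfolding ev using det
        by (intro exI[of _ "vector [\<mu> - d, c]"]) (auto simp: algebra_simps)
    next
      case 3
      then show ?thesis unfolding ev by (intro exI[of _ "vector [1, 0]"]) auto
    qed
  qed
  then show ?thesis unfolding eigenvalues_def by blast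
qed

text \<open>
  The discriminant of the characteristic polynomial of the Jacobian.
\<close>

definition disc :: "(real \<times> real \<Rightarrow> real) \<Rightarrow> (real \<times> real \<Rightarrow> real) \<Rightarrow> real \<times> real \<Rightarrow> real" where
  "disc F G p = (du F p - dv G p)\<^sup>2 + 4 * (dv F p * du G p)"

text \<open>
  The quadratic formula; two distinct eigenvalues force a positive discriminant, which keeps the square
  root smooth.
\<close>

lemma speeds_explicit:
  assumes "card (eigenvalues (jac F G p)) = 2"
  shows "disc F G p > 0"
    and "lam F G k p = (du F p + dv G p + (if k = 1 then - 1 else 1) * sqrt (disc F G p)) / 2"
proof -
  let ?a = "du F p" and ?b = "dv F p" and ?c = "du G p" and ?d = "dv G p"
  have "(?a - \<mu>) * (?d - \<mu>) = ?b * ?c \<longleftrightarrow> (2 * \<mu> - (?a + ?d))\<^sup>2 = disc F G p" for \<mu>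
  proof -
    have "(2 * \<mu> - (?a + ?d))\<^sup>2 - disc F G p = 4 * ((?a - \<mu>) * (?d - \<mu>) - ?b * ?c)"
      unfolding disc_def by algebra
    then show ?thesis by auto
  qed
  then have E: "eigenvalues (jac F G p) = {\<mu>. (2 * \<mu> - (?a + ?d))\<^sup>2 = disc F G p}"
    unfolding jac_def eigenvalues_2x2 by auto
  show pos: "disc F G p > 0"
  proof (rule ccontr)
    assume "\<not> disc F G p > 0"
    then have "eigenvalues (jac F G p) \<subseteq> {(?a + ?d) / 2}"
      unfolding E
    proof safe
      fix \<mu> assume "(2 * \<mu> - (?a + ?d))\<^sup>2 = disc F G p"
      with \<open>\<not> disc F G p > 0\<close> have "(2 * \<mu> - (?a + ?d))\<^sup>2 \<le> 0" by simp
      then have "2 * \<mu> - (?a + ?d) = 0" by simp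
      then show "\<mu> = (?a + ?d) / 2" by simp
    qed
    then have "card (eigenvalues (jac F G p)) \<le> card {(?a + ?d) / 2}" by (intro card_mono) auto
    then show False using assms by simp
  qed
  let ?s = "sqrt (disc F G p)"
  have s: "?s > 0" "?s\<^sup>2 = disc F G p" using pos by auto
  have E2: "eigenvalues (jac F G p) = {(?a + ?d - ?s) / 2, (?a + ?d + ?s) / 2}"
  proof -
    have "(2 * \<mu> - t)\<^sup>2 = s\<^sup>2 \<longleftrightarrow> \<mu> = (t - s) / 2 \<or> \<mu> = (t + s) / 2" for \<mu> t s :: real
      unfolding power2_eq_iff by auto
    then have "(2 * \<mu> - (?a + ?d))\<^sup>2 = ?s\<^sup>2 \<longleftrightarrow> \<mu> = (?a + ?d - ?s) / 2 \<or> \<mu> = (?a + ?d + ?s) / 2" for \<mu> .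
    from this[unfolded s(2)] show ?thesis
      unfolding E by (intro set_eqI) (simp only: mem_Collect_eq insert_iff empty_iff simp_thms)
  qed
  show "lam F G k p = (?a + ?d + (if k = 1 then - 1 else 1) * ?s) / 2"
    unfolding lam_def E2 using s(1) by (auto simp: min_def max_def)
qed

lemma lipschitz_on_compacts_Xi:
  assumes U: "open U" and F: "C2_on U F" and G: "C2_on U G"
    and hyp: "strictly_hyperbolic F G U" and Fv: "\<And>p. p \<in> U \<Longrightarrow> dv F p \<noteq> 0"
  shows "lipschitz_on_compacts U (Xi F G k)"
proof -
  have a: "lipschitz_on_compacts U (du F)" and b: "lipschitz_on_compacts U (dv F)"
    and c: "lipschitz_on_compacts U (du G)" and d: "lipschitz_on_compacts U (dv G)"
    using F G U C1_onD(5) unfolding C2_on_def by auto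
  have card: "card (eigenvalues (jac F G p)) = 2" if "p \<in> U" for p
    using hyp that unfolding strictly_hyperbolic_def by blast
  note lip = lipschitz_on_compacts_add lipschitz_on_compacts_minus lipschitz_on_compacts_mult lipschitz_on_compacts_const
  have "lipschitz_on_compacts U (\<lambda>p. (du F p + - dv G p) * (du F p + - dv G p) + 4 * (dv F p * du G p))"
    by (intro lip a b c d)
  then have D: "lipschitz_on_compacts U (disc F G)"
    by (rule lipschitz_on_compacts_cong) (simp add: disc_def power2_eq_square)
  have "lipschitz_on_compacts U (\<lambda>p. sqrt (disc F G p))"
  proof (rule lipschitz_on_compacts_compose[OF D, of "{0<..}" sqrt "\<lambda>x. inverse (sqrt x) / 2"])
    show "(sqrt has_real_derivative inverse (sqrt x) / 2) (at x)" if "x \<in> {0<..}" for x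
      using DERIV_real_sqrt[of x] that by simp
    show "continuous_on {0<..} (\<lambda>x. inverse (sqrt x) / 2)" by (intro continuous_intros) auto
  qed (use speeds_explicit(1)[OF card] in auto)
  moreover have "lipschitz_on_compacts U (\<lambda>p. inverse (dv F p))"
  proof (rule lipschitz_on_compacts_compose[OF b, of "- {0}" inverse "\<lambda>x. - (inverse x * inverse x)"])
    show "(inverse has_real_derivative - (inverse x * inverse x)) (at x)" if "x \<in> - {0}" for x :: real
      using DERIV_inverse[of x UNIV] that by (simp add: power2_eq_square)
    show "continuous_on (- {0}) (\<lambda>x::real. - (inverse x * inverse x))" by (intro continuous_intros) auto
  qed (use Fv in auto)
  ultimately have "lipschitz_on_compacts U (\<lambda>p. - (du F p + - ((du F p + dv G p + (if k = 1 then - 1 else 1) * sqrt (disc F G p)) * (1/2))) * inverse (dv F p))"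
    by (intro lip a d)
  then show ?thesis
  proof (rule lipschitz_on_compacts_cong)
    fix p assume "p \<in> U"
    have arith: "- (x + - (s * (1/2))) * inverse y = - (x - s / 2) / y" for x y s :: real
      by (cases "y = 0") (simp_all add: field_simps)
    show "- (du F p + - ((du F p + dv G p + (if k = 1 then - 1 else 1) * sqrt (disc F G p)) * (1/2))) * inverse (dv F p) = Xi F G k p"
      unfolding Xi_def speeds_explicit(2)[OF card[OF \<open>p \<in> U\<close>]] by (rule arith)
  qed
qed

lemma Xi_distinct:
  assumes "card (eigenvalues (jac F G p)) = 2" "dv F p \<noteq> 0"
  shows "Xi F G 1 p \<noteq> Xi F G 2 p"
  using speeds_explicit(1)[OF assms(1)] assms(2)
  by (simp add: Xi_def speeds_explicit(2)[OF assms(1)] field_simps)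

section \<open>The Hugoniot function\<close>

text \<open>
  The gradient of \<^term>\<open>hugoniot_fun F G g\<close> at \<open>p\<close>.
\<close>

definition hugoniot_grad :: "(real \<times> real \<Rightarrow> real) \<Rightarrow> (real \<times> real \<Rightarrow> real) \<Rightarrow> real \<times> real \<Rightarrow> real \<times> real \<Rightarrow> real \<times> real" where
  "hugoniot_grad F G g p =
     (du F p * (snd p - snd g) - du G p * (fst p - fst g) - (G p - G g),
      dv F p * (snd p - snd g) - dv G p * (fst p - fst g) + (F p - F g))"

lemma shock_function_hugoniot:
  assumes U: "open U" and F: "C1_on U F" and G: "C1_on U G" and reg: "regular_manifold F G U"
  shows "shock_function U (hugoniot_fun F G) (hugoniot_grad F G)"
proof -
  note dF = C1_onD(1)[OF U F] and dG = C1_onD(1)[OF U G]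
  have der: "((\<lambda>z. hugoniot_fun F G (fst z) (snd z)) has_derivative
      (\<lambda>h. (hugoniot_grad F G p l, hugoniot_grad F G l p) \<bullet> h)) (at (l, p))" if l: "l \<in> U" and p: "p \<in> U" for l p
  proof -
    have s: "((\<lambda>z. f (snd z)) has_derivative (\<lambda>h. (du f p, dv f p) \<bullet> snd h)) (at (l, p))"
      if "(f has_derivative (\<lambda>h. (du f p, dv f p) \<bullet> h)) (at p)" for f
      using diff_chain_at[OF bounded_linear_imp_has_derivative[OF bounded_linear_snd], of f _ "(l, p)"] that
      by (auto simp: o_def)
    have t: "((\<lambda>z. f (fst z)) has_derivative (\<lambda>h. (du f l, dv f l) \<bullet> fst h)) (at (l, p))"
      if "(f has_derivative (\<lambda>h. (du f l, dv f l) \<bullet> h)) (at l)" for f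
      using diff_chain_at[OF bounded_linear_imp_has_derivative[OF bounded_linear_fst], of f _ "(l, p)"] that
      by (auto simp: o_def)
    show ?thesis
      unfolding hugoniot_fun_def
      by (rule has_derivative_eq_rhs,
          (rule has_derivative_diff has_derivative_mult s[OF dF[OF p]] s[OF dG[OF p]] t[OF dF[OF l]] t[OF dG[OF l]]
            has_derivative_fst has_derivative_snd has_derivative_ident)+)
         (auto simp: hugoniot_grad_def inner_prod_def algebra_simps)
  qed
  have cont: "continuous_on (U \<times> U) (\<lambda>z. hugoniot_grad F G (fst z) (snd z))"
    unfolding hugoniot_grad_def
    by (intro continuous_intros continuous_on_compose2[OF C1_onD(2)[OF U F]] continuous_on_compose2[OF C1_onD(2)[OF U G]]
        continuous_on_compose2[OF C1_onD(3)[OF U F]] continuous_on_compose2[OF C1_onD(3)[OF U G]]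
        continuous_on_compose2[OF C1_onD(4)[OF U F]] continuous_on_compose2[OF C1_onD(4)[OF U G]]) auto
  have nz: "hugoniot_grad F G l p \<noteq> 0" if l: "l \<in> U" and p: "p \<in> U" "l \<noteq> p" "hugoniot_fun F G l p = 0" for l p
  proof
    assume 0: "hugoniot_grad F G l p = 0"
    obtain f' where f': "(hugoniot_fun F G l has_derivative f') (at p)" "surj f'"
      using reg l p unfolding regular_manifold_def regular_value_on_def by blast
    have "((\<lambda>p. (l, p)) has_derivative (\<lambda>h. (0, h))) (at p)"
      by (auto intro!: derivative_eq_intros)
    from diff_chain_at[OF this der[OF l p(1)]]
    have "(hugoniot_fun F G l has_derivative (\<lambda>h. hugoniot_grad F G l p \<bullet> h)) (at p)" by (simp add: o_def)
    from has_derivative_unique[OF f'(1) this] have "f' = (\<lambda>h. 0)" by (simp add: 0)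
    then show False using f'(2) by (metis surj_def zero_neq_one)
  qed
  show ?thesis
    by (unfold_locales; (rule U der cont nz; assumption)?) (auto simp: hugoniot_fun_def algebra_simps U cont)
qed

section \<open>Graphs over the first coordinate\<close>

text \<open>
  The conclusion for one pair of states, with loci and curves as parameters so that it can be carried
  through an interchange of coordinates. Finiteness on \<open>K\<close> is asserted without removing \<open>l\<close> and \<open>r\<close>; the
  tangent condition on \<open>K\<close> is inherited from the full curves.
\<close>

definition generic_pair ::
    "(real \<times> real) set \<Rightarrow> (real \<times> real \<Rightarrow> (real \<times> real) set) \<Rightarrow>
     ((real \<times> real) set \<Rightarrow> nat \<Rightarrow> real \<times> real \<Rightarrow> (real \<times> real) set) \<Rightarrow> real \<times> real \<Rightarrow> real \<times> real \<Rightarrow> bool" where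
  "generic_pair U Hug R l r \<longleftrightarrow>
     (\<forall>Wl \<in> {Hug l, R {} 1 l}. \<forall>Wr \<in> {Hug r, R {} 2 r}.
        \<forall>p \<in> Wl \<inter> Wr - {l, r}. p isolated_in (Wl \<inter> Wr - {l, r}) \<and> transversal_at p Wl Wr) \<and>
     (\<forall>K. compact K \<and> K \<subseteq> U \<and> l \<in> interior K \<and> r \<in> interior K \<longrightarrow>
        (\<forall>Wl \<in> {Hug l \<inter> K, R (frontier K) 1 l}. \<forall>Wr \<in> {Hug r \<inter> K, R (frontier K) 2 r}. finite (Wl \<inter> Wr)))"

lemma generic_pair_graph:
  assumes U: "open U" and F: "C2_on U F" and G: "C2_on U G" and hyp: "strictly_hyperbolic F G U"
    and reg: "regular_manifold F G U" and Fv: "\<And>p. p \<in> U \<Longrightarrow> dv F p \<noteq> 0"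
  shows "\<exists>N. N \<subseteq> U \<times> U \<and> negligible N \<and>
    (\<forall>(l, r) \<in> U \<times> U - N. generic_pair U (hugoniot F G U) (rarefaction_graph F G U) l r)"
proof -
  interpret shock_function U "hugoniot_fun F G" "hugoniot_grad F G"
    using shock_function_hugoniot[OF U _ _ reg] F G unfolding C2_on_def by blast
  have loc: "locus = hugoniot F G U" by (auto simp: fun_eq_iff locus_def hugoniot_def)
  have X: "lipschitz_on_compacts U (Xi F G k)" for k by (rule lipschitz_on_compacts_Xi[OF U F G hyp Fv])
  have ne: "Xi F G 1 p \<noteq> Xi F G 2 p" if "p \<in> U" for p
    using Xi_distinct Fv[OF that] hyp that unfolding strictly_hyperbolic_def by blast
  obtain N where N: "N \<subseteq> U \<times> U" "negligible N" and good: "\<forall>(l, r) \<in> U \<times> U - N.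
    (\<forall>Wl \<in> {locus l, trajectory U (Xi F G 1) l}. \<forall>Wr \<in> {locus r, trajectory U (Xi F G 2) r}.
       \<forall>p \<in> Wl \<inter> Wr - {l, r}. p isolated_in (Wl \<inter> Wr - {l, r}) \<and> transversal_at p Wl Wr) \<and>
    (\<forall>K. compact K \<and> K \<subseteq> U \<longrightarrow>
       (\<forall>Wl \<in> {locus l \<inter> K, {p. (l, p) \<in> reach K (Xi F G 1)}}. \<forall>Wr \<in> {locus r \<inter> K, {p. (r, p) \<in> reach K (Xi F G 2)}}.
          finite (Wl \<inter> Wr)))"
    using generic_transversality[OF X[of 1] X[of 2] ne] by blast
  have "generic_pair U (hugoniot F G U) (rarefaction_graph F G U) l r" if lr: "(l, r) \<in> U \<times> U - N" for l r
    unfolding generic_pair_def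
  proof (intro conjI allI impI)
    show "\<forall>Wl \<in> {hugoniot F G U l, rarefaction_graph F G U {} 1 l}. \<forall>Wr \<in> {hugoniot F G U r, rarefaction_graph F G U {} 2 r}.
        \<forall>p \<in> Wl \<inter> Wr - {l, r}. p isolated_in (Wl \<inter> Wr - {l, r}) \<and> transversal_at p Wl Wr"
      using bspec[OF good lr] unfolding loc rarefaction_graph_empty_barrier prod.case by (rule conjunct1)
    fix K assume K: "compact K \<and> K \<subseteq> U \<and> l \<in> interior K \<and> r \<in> interior K"
    have fin: "\<forall>Wl \<in> {hugoniot F G U l \<inter> K, {p. (l, p) \<in> reach K (Xi F G 1)}}. \<forall>Wr \<in> {hugoniot F G U r \<inter> K, {p. (r, p) \<in> reach K (Xi F G 2)}}.
          finite (Wl \<inter> Wr)"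
      using bspec[OF good lr] K unfolding loc prod.case by simp
    have sub: "rarefaction_graph F G U (frontier K) 1 l \<subseteq> {p. (l, p) \<in> reach K (Xi F G 1)}"
      "rarefaction_graph F G U (frontier K) 2 r \<subseteq> {p. (r, p) \<in> reach K (Xi F G 2)}"
      using K by (intro rarefaction_graph_barrier_reach; simp)+
    show "\<forall>Wl \<in> {hugoniot F G U l \<inter> K, rarefaction_graph F G U (frontier K) 1 l}.
       \<forall>Wr \<in> {hugoniot F G U r \<inter> K, rarefaction_graph F G U (frontier K) 2 r}. finite (Wl \<inter> Wr)"
    proof (intro ballI)
      fix Wl Wr assume W: "Wl \<in> {hugoniot F G U l \<inter> K, rarefaction_graph F G U (frontier K) 1 l}"
        "Wr \<in> {hugoniot F G U r \<inter> K, rarefaction_graph F G U (frontier K) 2 r}"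
      obtain Vl where Vl: "Wl \<subseteq> Vl" "Vl \<in> {hugoniot F G U l \<inter> K, {p. (l, p) \<in> reach K (Xi F G 1)}}" using W(1) sub(1) by blast
      obtain Vr where Vr: "Wr \<subseteq> Vr" "Vr \<in> {hugoniot F G U r \<inter> K, {p. (r, p) \<in> reach K (Xi F G 2)}}" using W(2) sub(2) by blast
      have "finite (Vl \<inter> Vr)" using bspec[OF bspec[OF fin Vl(2)] Vr(2)] .
      then show "finite (Wl \<inter> Wr)" by (rule rev_finite_subset) (use Vl Vr in blast)
    qed
  qed
  then show ?thesis using N by blast
qed

section \<open>Interchanging the coordinates\<close>

lemma bounded_linear_swap: "bounded_linear (prod.swap :: real \<times> real \<Rightarrow> real \<times> real)"
  unfolding prod.swap_def by (intro bounded_linear_Pair bounded_linear_fst bounded_linear_snd)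

lemma swap_has_derivative: "(prod.swap has_derivative (prod.swap :: real \<times> real \<Rightarrow> real \<times> real)) F"
  by (rule bounded_linear_imp_has_derivative[OF bounded_linear_swap])

lemma swap_image_iff: "x \<in> prod.swap ` S \<longleftrightarrow> prod.swap x \<in> S"
  by (force simp: image_iff)

lemma swap_image_Int: "prod.swap ` A \<inter> prod.swap ` B = prod.swap ` (A \<inter> B)"
  by (auto simp: swap_image_iff)

lemma continuous_on_swap: "continuous_on S (prod.swap :: real \<times> real \<Rightarrow> real \<times> real)"
  by (rule linear_continuous_on[OF bounded_linear_swap])

lemma open_swap_image:
  fixes U :: "(real \<times> real) set" assumes "open U" shows "open (prod.swap ` U)"
proof -
  have "prod.swap ` U = prod.swap -` U" by (auto simp: swap_image_iff)
  then show ?thesis using open_vimage[OF assms, of prod.swap] continuous_on_swap by simp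
qed

lemma interior_swap_image: "interior (prod.swap ` K) = prod.swap ` interior (K :: (real \<times> real) set)"
  by (rule interior_injective_linear_image) (auto intro: bounded_linear.linear[OF bounded_linear_swap])

lemma frontier_swap_image: "frontier (prod.swap ` K) = prod.swap ` frontier (K :: (real \<times> real) set)"
proof -
  have "closure (prod.swap ` K) = prod.swap ` closure K"
    by (rule closure_injective_linear_image[symmetric]) (auto intro: bounded_linear.linear[OF bounded_linear_swap])
  then show ?thesis unfolding frontier_def interior_swap_image by (simp add: image_set_diff)
qed

lemma tangent_space_swap:
  fixes W :: "(real \<times> real) set"
  assumes "v \<in> tangent_space (prod.swap p) W"
  shows "prod.swap v \<in> tangent_space p (prod.swap ` W)"
proof -
  obtain \<gamma> e where e: "0 < e" "\<gamma> C1_differentiable_on {-e<..<e}" "\<gamma> ` {-e<..<e} \<subseteq> W" "\<gamma> 0 = prod.swap p"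
      "(\<gamma> has_vector_derivative v) (at (0::real))"
    using assms unfolding tangent_space_def by blast
  obtain D where D: "\<And>x. x \<in> {-e<..<e} \<Longrightarrow> (\<gamma> has_vector_derivative D x) (at x)" "continuous_on {-e<..<e} D"
    using e(2) unfolding C1_differentiable_on_def by blast
  note bl = bounded_linear.has_vector_derivative[OF bounded_linear_swap]
  have "(\<lambda>t. prod.swap (\<gamma> t)) C1_differentiable_on {-e<..<e}"
    unfolding C1_differentiable_on_def
    by (intro exI[of _ "\<lambda>t. prod.swap (D t)"] conjI ballI bl D(1) continuous_on_compose2[OF continuous_on_swap D(2)]) auto
  moreover have "(\<lambda>t. prod.swap (\<gamma> t)) ` {-e<..<e} \<subseteq> prod.swap ` W" using e(3) by blast
  ultimately show ?thesis
    unfolding tangent_space_def using e(1,4) bl[OF e(5)] by (intro CollectI exI conjI) auto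
qed

lemma transversal_at_swap:
  fixes V W :: "(real \<times> real) set"
  assumes "transversal_at (prod.swap p) V W"
  shows "transversal_at p (prod.swap ` V) (prod.swap ` W)"
proof -
  have "z \<in> {a + b |a b. a \<in> tangent_space p (prod.swap ` V) \<and> b \<in> tangent_space p (prod.swap ` W)}" for z
  proof -
    have "prod.swap z \<in> {a + b |a b. a \<in> tangent_space (prod.swap p) V \<and> b \<in> tangent_space (prod.swap p) W}"
      using assms unfolding transversal_at_def by simp
    then obtain a b where ab: "prod.swap z = a + b" "a \<in> tangent_space (prod.swap p) V" "b \<in> tangent_space (prod.swap p) W" by blast
    have "z = prod.swap a + prod.swap b"
      using arg_cong[OF ab(1), of prod.swap] by (cases a; cases b) simp
    then show ?thesis using tangent_space_swap ab(2,3) by blast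
  qed
  then show ?thesis unfolding transversal_at_def by blast
qed

lemma isolated_in_swap:
  fixes S :: "(real \<times> real) set"
  assumes "prod.swap p isolated_in S"
  shows "p isolated_in (prod.swap ` S)"
proof -
  obtain T where T: "prod.swap p \<in> S" "open T" "T \<inter> S = {prod.swap p}" using assms by (rule isolated_inE)
  show ?thesis
  proof (rule isolated_inI)
    show "p \<in> prod.swap ` S" using T(1) by (simp add: swap_image_iff)
    show "open (prod.swap ` T)" using T(2) by (rule open_swap_image)
    show "prod.swap ` T \<inter> prod.swap ` S = {p}" using T(3) by (simp add: swap_image_Int)
  qed
qed

lemma generic_pair_swap:
  assumes "generic_pair (prod.swap ` U) Hug R (prod.swap l) (prod.swap r)"
  shows "generic_pair U (\<lambda>g. prod.swap ` Hug (prod.swap g)) (\<lambda>B k g. prod.swap ` R (prod.swap ` B) k (prod.swap g)) l r"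
proof -
  have g1: "\<And>Wl Wr p. \<lbrakk>Wl \<in> {Hug (prod.swap l), R {} 1 (prod.swap l)}; Wr \<in> {Hug (prod.swap r), R {} 2 (prod.swap r)};
        p \<in> Wl \<inter> Wr - {prod.swap l, prod.swap r}\<rbrakk> \<Longrightarrow>
        p isolated_in (Wl \<inter> Wr - {prod.swap l, prod.swap r}) \<and> transversal_at p Wl Wr"
    and g2: "\<And>K Wl Wr. \<lbrakk>compact K \<and> K \<subseteq> prod.swap ` U \<and> prod.swap l \<in> interior K \<and> prod.swap r \<in> interior K;
        Wl \<in> {Hug (prod.swap l) \<inter> K, R (frontier K) 1 (prod.swap l)};
        Wr \<in> {Hug (prod.swap r) \<inter> K, R (frontier K) 2 (prod.swap r)}\<rbrakk> \<Longrightarrow> finite (Wl \<inter> Wr)"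
    using assms unfolding generic_pair_def by blast+
  have main: "p isolated_in (prod.swap ` Vl \<inter> prod.swap ` Vr - {l, r}) \<and> transversal_at p (prod.swap ` Vl) (prod.swap ` Vr)"
    if V: "Vl \<in> {Hug (prod.swap l), R {} 1 (prod.swap l)}" "Vr \<in> {Hug (prod.swap r), R {} 2 (prod.swap r)}"
      and p: "p \<in> prod.swap ` Vl \<inter> prod.swap ` Vr - {l, r}" for Vl Vr p
  proof -
    have eq: "prod.swap ` Vl \<inter> prod.swap ` Vr - {l, r} = prod.swap ` (Vl \<inter> Vr - {prod.swap l, prod.swap r})"
      by (auto simp: swap_image_iff)
    have "prod.swap p \<in> Vl \<inter> Vr - {prod.swap l, prod.swap r}" using p unfolding eq swap_image_iff .
    from g1[OF V this] show ?thesis unfolding eq by (intro conjI isolated_in_swap transversal_at_swap; elim conjunct1 conjunct2)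
  qed
  have main2: "finite (Wl \<inter> Wr)"
    if K: "compact K \<and> K \<subseteq> U \<and> l \<in> interior K \<and> r \<in> interior K"
      and W: "Wl \<in> {prod.swap ` Hug (prod.swap l) \<inter> K, prod.swap ` R (prod.swap ` frontier K) 1 (prod.swap l)}"
       "Wr \<in> {prod.swap ` Hug (prod.swap r) \<inter> K, prod.swap ` R (prod.swap ` frontier K) 2 (prod.swap r)}" for K Wl Wr
  proof -
    let ?K = "prod.swap ` K"
    have K': "compact ?K \<and> ?K \<subseteq> prod.swap ` U \<and> prod.swap l \<in> interior ?K \<and> prod.swap r \<in> interior ?K"
      using K by (auto simp: interior_swap_image intro: compact_continuous_image continuous_on_swap)
    have HK: "prod.swap ` A \<inter> K = prod.swap ` (A \<inter> ?K)" for A by (auto simp: swap_image_iff)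
    obtain Vl where Vl: "Wl = prod.swap ` Vl" "Vl \<in> {Hug (prod.swap l) \<inter> ?K, R (frontier ?K) 1 (prod.swap l)}"
      using W(1) unfolding HK frontier_swap_image by blast
    obtain Vr where Vr: "Wr = prod.swap ` Vr" "Vr \<in> {Hug (prod.swap r) \<inter> ?K, R (frontier ?K) 2 (prod.swap r)}"
      using W(2) unfolding HK frontier_swap_image by blast
    show ?thesis unfolding Vl(1) Vr(1) swap_image_Int using g2[OF K' Vl(2) Vr(2)] by simp
  qed
  show ?thesis
    unfolding generic_pair_def using main main2 by auto
qed

lemma du_swap: "du (f \<circ> prod.swap) = dv f \<circ> prod.swap" and dv_swap: "dv (f \<circ> prod.swap) = du f \<circ> prod.swap"
  by (auto simp: fun_eq_iff du_def dv_def)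

lemma C1_on_swap:
  assumes "C1_on U f" shows "C1_on (prod.swap ` U) (f \<circ> prod.swap)"
proof -
  have img: "prod.swap ` prod.swap ` U = U" by (simp add: image_image)
  have "f \<circ> prod.swap differentiable_on prod.swap ` U"
    unfolding differentiable_on_def
  proof
    fix x assume x: "x \<in> prod.swap ` U"
    have "prod.swap differentiable (at x within prod.swap ` U)"
      using swap_has_derivative unfolding differentiable_def by blast
    moreover have "f differentiable (at (prod.swap x) within prod.swap ` prod.swap ` U)"
      unfolding img using assms x unfolding C1_on_def differentiable_on_def by (auto simp: swap_image_iff)
    ultimately show "f \<circ> prod.swap differentiable (at x within prod.swap ` U)"
      by (rule differentiable_chain_within)
  qed
  moreover have "continuous_on (prod.swap ` U) (h \<circ> prod.swap)" if "continuous_on U h" for h :: "real \<times> real \<Rightarrow> real"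
    by (intro continuous_on_compose continuous_on_swap) (simp add: img that)
  ultimately show ?thesis
    using assms unfolding C1_on_def du_swap dv_swap by blast
qed

lemma C2_on_swap: "C2_on U f \<Longrightarrow> C2_on (prod.swap ` U) (f \<circ> prod.swap)"
  unfolding C2_on_def du_swap dv_swap using C1_on_swap by blast

lemma strictly_hyperbolic_swap:
  assumes "strictly_hyperbolic F G U"
  shows "strictly_hyperbolic (G \<circ> prod.swap) (F \<circ> prod.swap) (prod.swap ` U)"
proof -
  have "eigenvalues (jac (G \<circ> prod.swap) (F \<circ> prod.swap) p) = eigenvalues (jac F G (prod.swap p))" for p
    unfolding jac_def eigenvalues_2x2 du_swap dv_swap by (auto simp: mult.commute)
  then show ?thesis using assms unfolding strictly_hyperbolic_def by auto
qed

lemma hugoniot_fun_swap: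
  "hugoniot_fun (G \<circ> prod.swap) (F \<circ> prod.swap) g p = - hugoniot_fun F G (prod.swap g) (prod.swap p)"
  by (simp add: hugoniot_fun_def)

lemma hugoniot_swap:
  "prod.swap ` hugoniot (G \<circ> prod.swap) (F \<circ> prod.swap) (prod.swap ` U) (prod.swap g) = hugoniot F G U g"
  by (auto simp: hugoniot_def hugoniot_fun_swap swap_image_iff)

lemma regular_manifold_swap:
  assumes "regular_manifold F G U"
  shows "regular_manifold (G \<circ> prod.swap) (F \<circ> prod.swap) (prod.swap ` U)"
  unfolding regular_manifold_def regular_value_on_def
proof (intro ballI impI)
  fix g p assume g: "g \<in> prod.swap ` U" and p: "p \<in> prod.swap ` U - {g}"
    and 0: "hugoniot_fun (G \<circ> prod.swap) (F \<circ> prod.swap) g p = 0"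
  have "prod.swap p \<noteq> prod.swap g" using p by (metis DiffE insertI1 swap_swap)
  then have "prod.swap g \<in> U" "prod.swap p \<in> U - {prod.swap g}" "hugoniot_fun F G (prod.swap g) (prod.swap p) = 0"
    using g p 0 by (auto simp: swap_image_iff hugoniot_fun_swap)
  then obtain f' where f': "(hugoniot_fun F G (prod.swap g) has_derivative f') (at (prod.swap p))" "surj f'"
    using assms unfolding regular_manifold_def regular_value_on_def by blast
  have "((\<lambda>p. - hugoniot_fun F G (prod.swap g) (prod.swap p)) has_derivative (\<lambda>h. - f' (prod.swap h))) (at p)"
    using has_derivative_minus[OF diff_chain_at[OF swap_has_derivative f'(1)]] by (simp add: o_def)
  moreover have "surj (\<lambda>h. - f' (prod.swap h))"
    unfolding surj_def
  proof
    fix y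
    obtain h where "- y = f' h" using f'(2) unfolding surj_def by blast
    then show "\<exists>h. y = - f' (prod.swap h)" by (intro exI[of _ "prod.swap h"]) (simp add: equation_minus_iff)
  qed
  ultimately show "\<exists>f'. (hugoniot_fun (G \<circ> prod.swap) (F \<circ> prod.swap) g has_derivative f') (at p) \<and> surj f'"
    unfolding hugoniot_fun_swap[abs_def] by blast
qed

section \<open>The transversality theorem\<close>

lemma generic_pair_imp_transversality:
  assumes "generic_pair U (hugoniot F G U) (rarefaction_until F G U) l r"
  shows "transversality F G U l r"
    and "\<lbrakk>compact K; K \<subseteq> U; l \<in> interior K; r \<in> interior K\<rbrakk> \<Longrightarrow> transversality_on F G U K l r"
proof -
  have tr: "\<And>Wl Wr p. \<lbrakk>Wl \<in> {hugoniot F G U l, rarefaction F G U 1 l}; Wr \<in> {hugoniot F G U r, rarefaction F G U 2 r};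
        p \<in> Wl \<inter> Wr - {l, r}\<rbrakk> \<Longrightarrow> p isolated_in (Wl \<inter> Wr - {l, r}) \<and> transversal_at p Wl Wr"
    using assms unfolding generic_pair_def rarefaction_def by blast
  then show "transversality F G U l r" unfolding transversality_def by blast
  have "rarefaction_graph F' G' U' B k g \<subseteq> rarefaction_graph F' G' U' {} k g" for F' G' U' B k g
    unfolding rarefaction_graph_def by blast
  then have sub: "rarefaction_until F G U B k g \<subseteq> rarefaction F G U k g" for B k g
    unfolding rarefaction_def rarefaction_until_def by (auto simp: image_mono)
  assume K: "compact K" "K \<subseteq> U" "l \<in> interior K" "r \<in> interior K"
  have fin: "\<And>Wl Wr. \<lbrakk>Wl \<in> {hugoniot F G U l \<inter> K, rarefaction_until F G U (frontier K) 1 l};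
       Wr \<in> {hugoniot F G U r \<inter> K, rarefaction_until F G U (frontier K) 2 r}\<rbrakk> \<Longrightarrow> finite (Wl \<inter> Wr)"
    using assms K unfolding generic_pair_def by blast
  show "transversality_on F G U K l r"
    unfolding transversality_on_def
  proof (intro ballI case_prodI2 conjI)
    fix x y Wl WlK Wr WrK
    assume x: "x \<in> {(hugoniot F G U l, hugoniot F G U l \<inter> K), (rarefaction F G U 1 l, rarefaction_until F G U (frontier K) 1 l)}"
      "x = (Wl, WlK)"
      and y: "y \<in> {(hugoniot F G U r, hugoniot F G U r \<inter> K), (rarefaction F G U 2 r, rarefaction_until F G U (frontier K) 2 r)}"
      "y = (Wr, WrK)"
    have Wl: "Wl \<in> {hugoniot F G U l, rarefaction F G U 1 l}" "WlK \<in> {hugoniot F G U l \<inter> K, rarefaction_until F G U (frontier K) 1 l}" "WlK \<subseteq> Wl"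
      using x sub[of "frontier K" 1 l] by (auto simp del: One_nat_def)
    have Wr: "Wr \<in> {hugoniot F G U r, rarefaction F G U 2 r}" "WrK \<in> {hugoniot F G U r \<inter> K, rarefaction_until F G U (frontier K) 2 r}" "WrK \<subseteq> Wr"
      using y sub[of "frontier K" 2 r] by auto
    show "finite (WlK \<inter> WrK - {l, r})" using fin[OF Wl(2) Wr(2)] by simp
    show "transversal_at p Wl Wr" if "p \<in> WlK \<inter> WrK - {l, r}" for p
      using tr[OF Wl(1) Wr(1), of p] that Wl(3) Wr(3) by blast
  qed
qed

text \<open>
  Under the interchange of coordinates and fluxes \<open>G\<^sub>u\<close> takes the place of \<open>F\<^sub>v\<close>, while the Hugoniot function
  only changes its sign and the characteristic polynomial does not change at all.
\<close>

lemma generic_pair_until: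
  assumes U: "open U" and F: "C2_on U F" and G: "C2_on U G" and hyp: "strictly_hyperbolic F G U"
    and graph: "graph_condition F G U" and reg: "regular_manifold F G U"
  shows "\<exists>N. N \<subseteq> U \<times> U \<and> negligible N \<and>
    (\<forall>(l, r) \<in> U \<times> U - N. generic_pair U (hugoniot F G U) (rarefaction_until F G U) l r)"
proof (cases "\<forall>p\<in>U. dv F p \<noteq> 0")
  case True
  then have "rarefaction_until F G U = rarefaction_graph F G U"
    by (simp add: fun_eq_iff rarefaction_until_def)
  then show ?thesis using generic_pair_graph[OF U F G hyp reg] True by simp
next
  case False
  let ?F = "G \<circ> prod.swap" and ?G = "F \<circ> prod.swap" and ?U = "prod.swap ` U"
  have Gu: "\<forall>p\<in>U. du G p \<noteq> 0" using False graph unfolding graph_condition_def by blast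
  have "dv ?F p \<noteq> 0" if "p \<in> ?U" for p using Gu that by (auto simp: dv_swap)
  then obtain N where N: "N \<subseteq> ?U \<times> ?U" "negligible N"
    and good: "\<And>l r. (l, r) \<in> ?U \<times> ?U - N \<Longrightarrow> generic_pair ?U (hugoniot ?F ?G ?U) (rarefaction_graph ?F ?G ?U) l r"
    using generic_pair_graph[OF open_swap_image[OF U] C2_on_swap[OF G] C2_on_swap[OF F]
        strictly_hyperbolic_swap[OF hyp] regular_manifold_swap[OF reg]] by blast
  define S :: "(real \<times> real) \<times> (real \<times> real) \<Rightarrow> (real \<times> real) \<times> (real \<times> real)" where
    "S z = (prod.swap (fst z), prod.swap (snd z))" for z
  have "bounded_linear S"
    unfolding S_def
    by (intro bounded_linear_Pair bounded_linear_compose[OF bounded_linear_swap] bounded_linear_fst bounded_linear_snd)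
  then have "S differentiable_on N"
    by (simp add: bounded_linear_imp_differentiable_on)
  then have "negligible (S ` N)"
    by (rule negligible_differentiable_image_negligible[OF _ N(2), rotated]) simp
  moreover have "S ` N \<subseteq> U \<times> U" using N(1) by (auto simp: S_def swap_image_iff)
  moreover have "generic_pair U (hugoniot F G U) (rarefaction_until F G U) l r" if lr: "(l, r) \<in> U \<times> U - S ` N" for l r
  proof -
    have "(prod.swap l, prod.swap r) \<notin> N"
    proof
      assume "(prod.swap l, prod.swap r) \<in> N"
      then have "S (prod.swap l, prod.swap r) \<in> S ` N" by blast
      then show False using lr by (simp add: S_def)
    qed
    then have "(prod.swap l, prod.swap r) \<in> ?U \<times> ?U - N" using lr by auto
    from generic_pair_swap[OF good[OF this]]
    have "generic_pair U (\<lambda>g. prod.swap ` hugoniot ?F ?G ?U (prod.swap g))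
       (\<lambda>B k g. prod.swap ` rarefaction_graph ?F ?G ?U (prod.swap ` B) k (prod.swap g)) l r" .
    moreover have "rarefaction_until F G U = (\<lambda>B k g. prod.swap ` rarefaction_graph ?F ?G ?U (prod.swap ` B) k (prod.swap g))"
      by (intro ext) (simp only: rarefaction_until_def False if_False)
    ultimately show ?thesis by (simp add: hugoniot_swap)
  qed
  ultimately show ?thesis by blast
qed

theorem theorem3p7:
  fixes F G :: "real \<times> real \<Rightarrow> real" and U :: "(real \<times> real) set"
  assumes "open U"
    and "C2_on U F" and "C2_on U G"
    and "strictly_hyperbolic F G U"
    and "genuinely_nonlinear F G U"
    and "graph_condition F G U"
    and "regular_manifold F G U"
  shows "\<exists>N. N \<subseteq> U \<times> U \<and> negligible N \<and>
           (\<forall>(l, r)\<in>U \<times> U - N.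
              transversality F G U l r \<and>
              (\<forall>K. compact K \<and> K \<subseteq> U \<and> l \<in> interior K \<and> r \<in> interior K \<longrightarrow>
                 transversality_on F G U K l r))"
proof -
  obtain N where N: "N \<subseteq> U \<times> U" "negligible N"
    and good: "\<forall>(l, r)\<in>U \<times> U - N. generic_pair U (hugoniot F G U) (rarefaction_until F G U) l r"
    using generic_pair_until[OF assms(1-4,6,7)] by (elim exE conjE)
  have "transversality F G U l r \<and>
      (\<forall>K. compact K \<and> K \<subseteq> U \<and> l \<in> interior K \<and> r \<in> interior K \<longrightarrow> transversality_on F G U K l r)"
    if "(l, r) \<in> U \<times> U - N" for l r
    using generic_pair_imp_transversality[of U F G l r] bspec[OF good that] by auto
  then show ?thesis using N by (intro exI[of _ N]) auto
qed

end
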